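(* Let $(M,\tau)$ be a tracial von Neumann algebra with a separable predual, let $(\Omega,\mathbb{P})$ be a probability space equipped with an ergodic $T\in\operatorname{Aut}(\Omega,\mathbb{P})$, let $\gamma_\omega\colon L^1(M,\tau)\to L^1(M,\tau)$ be a bounded positive faithful random linear operator, and for integers $n\ge m$ let $\Gamma_{n,m}(\omega)=\gamma_{T^n\omega}\circ\gamma_{T^{n-1}\omega}\circ\cdots\circ\gamma_{T^m\omega}$. Suppose that $$\mathbb{P}[\exists n,m\in\mathbb{Z}\colon n\ge m \text{ and } c(\Gamma_{n,m})<1]>0.$$ Then there exists a family of random variables $X_n\colon\Omega\to S$, $n\in\mathbb{Z}$, satisfying, for all $n\in\mathbb{Z}$, $$\gamma_{T^{n+1}\omega}\cdot X_n(\omega)=X_{n+1}(\omega)\qquad\text{and}\qquad X_n(T^{\pm1}\omega)=X_{n\pm1}(\omega)$$ almost surely, and such that for all $x\in S$ $$\lim_{m\to-\infty}\|\Gamma_{n,m}\cdot x-X_n\|_1=0$$ almost surely for all $n\in\mathbb{Z}$.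
   Context: A tracial von Neumann algebra $(M,\tau)$ is a von Neumann algebra $M$ with a faithful normal tracial state $\tau$. $L^1(M,\tau)$ is the completion of $M$ in the norm $\|x\|_1=\tau(|x|)$; its elements are identified with the closed densely defined operators $x$ affiliated with $M$ with $\tau(|x|)<\infty$, and $L^1(M,\tau)$ is identified with the predual of $M$ via $x\mapsto\tau(x\,\cdot\,)$. $L^1(M,\tau)_+$ denotes the positive elements, and $x\le y$ means that (the closure of) $y-x$ is positive. $S:=\{x\in L^1(M,\tau)_+\colon\tau(x)=1\}$. For nonzero $x,y\in L^1(M,\tau)_+$, $m(x,y):=\max\{\lambda\in\mathbb{R}\colon\lambda y\le x\}$, and for $x,y\in S$ Hennion's metric is $d(x,y):=\frac{1-m(x,y)m(y,x)}{1+m(x,y)m(y,x)}$. A linear map $\gamma$ on $L^1(M,\tau)$ is positive if $\gamma(L^1(M,\tau)_+)\subset L^1(M,\tau)_+$, and a positive map is faithful if $\gamma(x)\neq0$ for all nonzero $x\in L^1(M,\tau)_+$. The projective action of a faithful positive linear $\gamma$ on $x\in S$ is $\gamma\cdot x:=\frac{1}{\tau(\gamma(x))}\gamma(x)\in S$. Its Hennion contraction constant is $c(\gamma):=\sup_{x\ne y\in S}\frac{d(\gamma\cdot x,\gamma\cdot y)}{d(x,y)}$ (with $\sup\emptyset=0$). $\operatorname{Aut}(\Omega,\mathbb{P})$ is the set of bijections $T$ of $\Omega$ with $T,T^{-1}$ measurable and measure preserving; $T$ is ergodic if $T^{-1}(A)\subset A$ implies $\mathbb{P}[A]\in\{0,1\}$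 for measurable $A$. A random variable in a Banach space is a strongly measurable function (an almost sure norm limit of simple functions). A random linear operator on a Banach space $\mathfrak{X}$ is a map $\gamma\colon\Omega\times\mathfrak{X}\to\mathfrak{X}$ such that $\omega\mapsto\gamma_\omega(x)$ is a random variable for each $x$ and which is linear almost surely; it is said to have a property of linear maps (bounded, positive, faithful, ...) if for almost every $\omega$ the map $x\mapsto\gamma_\omega(x)$ is a linear map with that property. Events are understood up to null sets. *)

theory Defs
  imports "HOL-Probability.Probability"
begin

section \<open>Complex Banach and Hilbert spaces\<close>

class cbanach = banach +
  fixes scaleC :: "complex \<Rightarrow> 'a \<Rightarrow> 'a"  (infixr "*\<^sub>C" 75)
  assumes scaleC_add_right: "c *\<^sub>C (x + y) = c *\<^sub>C x + c *\<^sub>C y"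
    and scaleC_add_left: "(c + d) *\<^sub>C x = c *\<^sub>C x + d *\<^sub>C x"
    and scaleC_scaleC: "c *\<^sub>C (d *\<^sub>C x) = (c * d) *\<^sub>C x"
    and scaleR_scaleC: "scaleR r x = complex_of_real r *\<^sub>C x"
    and norm_scaleC: "norm (c *\<^sub>C x) = cmod c * norm x"

text \<open>The inner product is conjugate linear in its first argument. Positive definiteness is
  contained in the last axiom.\<close>

class chilbert_space = cbanach +
  fixes cinner :: "'a \<Rightarrow> 'a \<Rightarrow> complex"
  assumes cinner_commute: "cinner x y = cnj (cinner y x)"
    and cinner_add_right: "cinner x (y + z) = cinner x y + cinner x z"
    and cinner_scaleC_right: "cinner x (c *\<^sub>C y) = c * cinner x y"
    and cinner_self: "cinner x x = complex_of_real ((norm x)\<^sup>2)"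

definition clinear :: "('a::cbanach \<Rightarrow> 'b::cbanach) \<Rightarrow> bool" where
  "clinear f \<longleftrightarrow> (\<forall>x y. f (x + y) = f x + f y) \<and> (\<forall>c x. f (c *\<^sub>C x) = c *\<^sub>C f x)"

section \<open>Bounded operators and von Neumann algebras\<close>

text \<open>The library type of bounded operators consists of the real linear ones; the complex linear
  ones are singled out by the set \<open>bounded_ops\<close>.\<close>

type_synonym 'h op = "'h \<Rightarrow>\<^sub>L 'h"

definition bounded_ops :: "'h::chilbert_space op set" where
  "bounded_ops = {a. clinear (blinfun_apply a)}"

definition scale_op :: "complex \<Rightarrow> 'h::chilbert_space op \<Rightarrow> 'h op" where
  "scale_op c a = Blinfun (\<lambda>x. c *\<^sub>C blinfun_apply a x)"

definition adj_op :: "'h::chilbert_space op \<Rightarrow> 'h op" where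
  "adj_op a = (THE b. \<forall>x y. cinner (blinfun_apply b x) y = cinner x (blinfun_apply a y))"

definition pos_op :: "'h::chilbert_space op \<Rightarrow> bool" where
  "pos_op a \<longleftrightarrow> a \<in> bounded_ops \<and> (\<forall>x. cinner x (blinfun_apply a x) \<in> nonneg_Reals)"

definition abs_op :: "'h::chilbert_space op \<Rightarrow> 'h op" where
  "abs_op a = (THE b. pos_op b \<and> b o\<^sub>L b = adj_op a o\<^sub>L a)"

definition commutant :: "'h::chilbert_space op set \<Rightarrow> 'h op set" where
  "commutant A = {b \<in> bounded_ops. \<forall>a\<in>A. a o\<^sub>L b = b o\<^sub>L a}"

definition von_neumann_algebra :: "'h::chilbert_space op set \<Rightarrow> bool" where
  "von_neumann_algebra M \<longleftrightarrow>
     M \<subseteq> bounded_ops \<and> (\<forall>a\<in>M. adj_op a \<in> M) \<and> commutant (commutant M) = M"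

text \<open>The ultraweak topology is the initial topology for the functionals
  \<open>a \<mapsto> (\<Sum>n. \<langle>\<eta>\<^sub>n, a \<xi>\<^sub>n\<rangle>)\<close> with \<open>\<xi>\<close>, \<open>\<eta>\<close> square summable.\<close>

definition ultraweak_functionals :: "('h::chilbert_space op \<Rightarrow> complex) set" where
  "ultraweak_functionals =
     {\<lambda>a. \<Sum>n. cinner (\<eta> n) (blinfun_apply a (\<xi> n)) | \<xi> \<eta> :: nat \<Rightarrow> 'h.
        summable (\<lambda>n. (norm (\<xi> n))\<^sup>2) \<and> summable (\<lambda>n. (norm (\<eta> n))\<^sup>2)}"

definition ultraweak_topology :: "'h::chilbert_space op set \<Rightarrow> 'h op topology" where
  "ultraweak_topology M =
     topology_generated_by {{a \<in> M. \<phi> a \<in> U} | \<phi> U. \<phi> \<in> ultraweak_functionals \<and> open U}"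

definition linear_functional_on :: "'h::chilbert_space op set \<Rightarrow> ('h op \<Rightarrow> complex) \<Rightarrow> bool" where
  "linear_functional_on M \<phi> \<longleftrightarrow>
     (\<forall>a\<in>M. \<forall>b\<in>M. \<phi> (a + b) = \<phi> a + \<phi> b) \<and> (\<forall>c. \<forall>a\<in>M. \<phi> (scale_op c a) = c * \<phi> a)"

definition normal_functional :: "'h::chilbert_space op set \<Rightarrow> ('h op \<Rightarrow> complex) \<Rightarrow> bool" where
  "normal_functional M \<phi> \<longleftrightarrow>
     linear_functional_on M \<phi> \<and> continuous_map (ultraweak_topology M) euclidean \<phi>"

text \<open>Separability of the Banach space of normal functionals on \<open>M\<close> with the functional norm.
  Functionals are total functions of which only the values on \<open>M\<close> matter.\<close>

definition separable_predual :: "'h::chilbert_space op set \<Rightarrow> bool" where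
  "separable_predual M \<longleftrightarrow>
     (\<exists>D. countable D \<and> D \<subseteq> Collect (normal_functional M) \<and>
       (\<forall>\<phi>. normal_functional M \<phi> \<longrightarrow>
         (\<forall>e>0. \<exists>\<psi>\<in>D. \<forall>a\<in>M. norm a \<le> 1 \<longrightarrow> cmod (\<phi> a - \<psi> a) \<le> e)))"

definition tracial_von_neumann_algebra ::
  "'h::chilbert_space op set \<Rightarrow> ('h op \<Rightarrow> complex) \<Rightarrow> bool" where
  "tracial_von_neumann_algebra M \<tau> \<longleftrightarrow>
     von_neumann_algebra M \<and> normal_functional M \<tau> \<and>
     (\<forall>a\<in>M. pos_op a \<longrightarrow> \<tau> a \<in> nonneg_Reals) \<and> \<tau> id_blinfun = 1 \<and>
     (\<forall>a\<in>M. pos_op a \<and> \<tau> a = 0 \<longrightarrow> a = 0) \<and>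
     (\<forall>a\<in>M. \<forall>b\<in>M. \<tau> (a o\<^sub>L b) = \<tau> (b o\<^sub>L a))"

section \<open>The space \<open>L\<^sup>1(M,\<tau>)\<close>\<close>

text \<open>A completion of \<open>M\<close> in the norm \<open>\<tau>(|a|)\<close> is a complex Banach space together with an isometric
  linear map \<open>\<iota>\<close> from \<open>M\<close> onto a dense subspace. It is unique up to a unique isometric isomorphism
  compatible with \<open>\<iota>\<close>.\<close>

definition L1_completion ::
  "'h::chilbert_space op set \<Rightarrow> ('h op \<Rightarrow> complex) \<Rightarrow> ('h op \<Rightarrow> 'l::cbanach) \<Rightarrow> bool" where
  "L1_completion M \<tau> \<iota> \<longleftrightarrow>
     (\<forall>a\<in>M. \<forall>b\<in>M. \<iota> (a + b) = \<iota> a + \<iota> b) \<and> (\<forall>c. \<forall>a\<in>M. \<iota> (scale_op c a) = c *\<^sub>C \<iota> a) \<and>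
     (\<forall>a\<in>M. complex_of_real (norm (\<iota> a)) = \<tau> (abs_op a)) \<and> closure (\<iota> ` M) = UNIV"

text \<open>\<open>L1_pair M \<tau> \<iota> x a\<close> is \<open>\<tau>(x a)\<close> for \<open>x \<in> L\<^sup>1(M,\<tau>)\<close> and \<open>a \<in> M\<close>: the continuous extension to
  \<open>L\<^sup>1(M,\<tau>)\<close> of the functional \<open>b \<mapsto> \<tau>(b a)\<close> on \<open>M\<close>.\<close>

definition L1_pair ::
  "'h::chilbert_space op set \<Rightarrow> ('h op \<Rightarrow> complex) \<Rightarrow> ('h op \<Rightarrow> 'l::cbanach) \<Rightarrow> 'l \<Rightarrow> 'h op \<Rightarrow> complex"
  where
  "L1_pair M \<tau> \<iota> x a =
     (THE f. continuous_on UNIV f \<and> (\<forall>b\<in>M. f (\<iota> b) = \<tau> (b o\<^sub>L a))) x"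

definition L1_trace ::
  "'h::chilbert_space op set \<Rightarrow> ('h op \<Rightarrow> complex) \<Rightarrow> ('h op \<Rightarrow> 'l::cbanach) \<Rightarrow> 'l \<Rightarrow> complex" where
  "L1_trace M \<tau> \<iota> x = L1_pair M \<tau> \<iota> x id_blinfun"

text \<open>An element \<open>x\<close> of \<open>L\<^sup>1(M,\<tau>)\<close> is positive if it is positive as an element \<open>\<tau>(x \<cdot>)\<close> of the predual.
  Writing the positive \<open>a\<close> as \<open>b b\<^sup>*\<close>, \<open>\<tau>(x a) = \<tau>(b\<^sup>* x b)\<close> is the quadratic form of \<open>x\<close>, viewed as an
  operator on the completion of \<open>M\<close> in the 2-norm, at \<open>b\<close>.\<close>

definition L1_pos ::
  "'h::chilbert_space op set \<Rightarrow> ('h op \<Rightarrow> complex) \<Rightarrow> ('h op \<Rightarrow> 'l::cbanach) \<Rightarrow> 'l set" where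
  "L1_pos M \<tau> \<iota> = {x. \<forall>a\<in>M. pos_op a \<longrightarrow> L1_pair M \<tau> \<iota> x a \<in> nonneg_Reals}"

definition L1_le ::
  "'h::chilbert_space op set \<Rightarrow> ('h op \<Rightarrow> complex) \<Rightarrow> ('h op \<Rightarrow> 'l::cbanach) \<Rightarrow> 'l \<Rightarrow> 'l \<Rightarrow> bool" where
  "L1_le M \<tau> \<iota> x y \<longleftrightarrow> y - x \<in> L1_pos M \<tau> \<iota>"

definition L1_states ::
  "'h::chilbert_space op set \<Rightarrow> ('h op \<Rightarrow> complex) \<Rightarrow> ('h op \<Rightarrow> 'l::cbanach) \<Rightarrow> 'l set" where
  "L1_states M \<tau> \<iota> = {x \<in> L1_pos M \<tau> \<iota>. L1_trace M \<tau> \<iota> x = 1}"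

section \<open>Hennion's metric and the contraction constant\<close>

definition hennion_m ::
  "'h::chilbert_space op set \<Rightarrow> ('h op \<Rightarrow> complex) \<Rightarrow> ('h op \<Rightarrow> 'l::cbanach) \<Rightarrow> 'l \<Rightarrow> 'l \<Rightarrow> real" where
  "hennion_m M \<tau> \<iota> x y = (GREATEST r. L1_le M \<tau> \<iota> (scaleR r y) x)"

definition hennion_dist ::
  "'h::chilbert_space op set \<Rightarrow> ('h op \<Rightarrow> complex) \<Rightarrow> ('h op \<Rightarrow> 'l::cbanach) \<Rightarrow> 'l \<Rightarrow> 'l \<Rightarrow> real" where
  "hennion_dist M \<tau> \<iota> x y =
     (1 - hennion_m M \<tau> \<iota> x y * hennion_m M \<tau> \<iota> y x) /
     (1 + hennion_m M \<tau> \<iota> x y * hennion_m M \<tau> \<iota> y x)"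

definition bounded_map :: "('l::cbanach \<Rightarrow> 'l) \<Rightarrow> bool" where
  "bounded_map g \<longleftrightarrow> (\<exists>K. \<forall>x. norm (g x) \<le> K * norm x)"

definition positive_map ::
  "'h::chilbert_space op set \<Rightarrow> ('h op \<Rightarrow> complex) \<Rightarrow> ('h op \<Rightarrow> 'l::cbanach) \<Rightarrow> ('l \<Rightarrow> 'l) \<Rightarrow> bool" where
  "positive_map M \<tau> \<iota> g \<longleftrightarrow> g ` L1_pos M \<tau> \<iota> \<subseteq> L1_pos M \<tau> \<iota>"

definition faithful_map ::
  "'h::chilbert_space op set \<Rightarrow> ('h op \<Rightarrow> complex) \<Rightarrow> ('h op \<Rightarrow> 'l::cbanach) \<Rightarrow> ('l \<Rightarrow> 'l) \<Rightarrow> bool" where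
  "faithful_map M \<tau> \<iota> g \<longleftrightarrow> (\<forall>x\<in>L1_pos M \<tau> \<iota>. x \<noteq> 0 \<longrightarrow> g x \<noteq> 0)"

definition proj_action ::
  "'h::chilbert_space op set \<Rightarrow> ('h op \<Rightarrow> complex) \<Rightarrow> ('h op \<Rightarrow> 'l::cbanach) \<Rightarrow> ('l \<Rightarrow> 'l) \<Rightarrow> 'l \<Rightarrow> 'l"
  where
  "proj_action M \<tau> \<iota> g x = (1 / L1_trace M \<tau> \<iota> (g x)) *\<^sub>C g x"

text \<open>The ratios are nonnegative, so inserting 0 only serves to make the supremum of the empty set
  equal to 0.\<close>

definition hennion_const ::
  "'h::chilbert_space op set \<Rightarrow> ('h op \<Rightarrow> complex) \<Rightarrow> ('h op \<Rightarrow> 'l::cbanach) \<Rightarrow> ('l \<Rightarrow> 'l) \<Rightarrow> real" where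
  "hennion_const M \<tau> \<iota> g =
     Sup (insert 0
       {hennion_dist M \<tau> \<iota> (proj_action M \<tau> \<iota> g x) (proj_action M \<tau> \<iota> g y) / hennion_dist M \<tau> \<iota> x y
         | x y. x \<in> L1_states M \<tau> \<iota> \<and> y \<in> L1_states M \<tau> \<iota> \<and> x \<noteq> y})"

section \<open>Random operators over an invertible transformation\<close>

definition automorphism :: "'w measure \<Rightarrow> ('w \<Rightarrow> 'w) \<Rightarrow> bool" where
  "automorphism P T \<longleftrightarrow>
     bij_betw T (space P) (space P) \<and>
     T \<in> measurable P P \<and> distr P P T = P \<and>
     inv_into (space P) T \<in> measurable P P \<and> distr P P (inv_into (space P) T) = P"

definition ergodic :: "'w measure \<Rightarrow> ('w \<Rightarrow> 'w) \<Rightarrow> bool" where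
  "ergodic P T \<longleftrightarrow>
     (\<forall>A\<in>sets P. T -` A \<inter> space P \<subseteq> A \<longrightarrow> measure P A = 0 \<or> measure P A = 1)"

definition int_iterate :: "'w measure \<Rightarrow> ('w \<Rightarrow> 'w) \<Rightarrow> int \<Rightarrow> 'w \<Rightarrow> 'w" where
  "int_iterate P T n =
     (if n \<ge> 0 then T ^^ nat n else inv_into (space P) T ^^ nat (- n))"

definition random_variable_in :: "'w measure \<Rightarrow> ('w \<Rightarrow> 'b::real_normed_vector) \<Rightarrow> bool" where
  "random_variable_in P f \<longleftrightarrow>
     (\<exists>s. (\<forall>i::nat. simple_function P (s i)) \<and> (AE \<omega> in P. (\<lambda>i. s i \<omega>) \<longlonglongrightarrow> f \<omega>))"

definition random_linear_operator :: "'w measure \<Rightarrow> ('w \<Rightarrow> 'b::cbanach \<Rightarrow> 'b) \<Rightarrow> bool" where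
  "random_linear_operator P \<gamma> \<longleftrightarrow>
     (\<forall>x. random_variable_in P (\<lambda>\<omega>. \<gamma> \<omega> x)) \<and> (AE \<omega> in P. clinear (\<gamma> \<omega>))"

primrec ordered_comp :: "(int \<Rightarrow> 'b \<Rightarrow> 'b) \<Rightarrow> int \<Rightarrow> nat \<Rightarrow> 'b \<Rightarrow> 'b" where
  "ordered_comp g m 0 = g m"
| "ordered_comp g m (Suc k) = g (m + int (Suc k)) \<circ> ordered_comp g m k"

text \<open>\<open>cocycle P T \<gamma> n m \<omega>\<close> is the composition of \<open>\<gamma>\<close> at \<open>T\<^sup>n \<omega>, \<dots>, T\<^sup>m \<omega>\<close>, with the latter applied first.
  It is meant for \<open>m \<le> n\<close> only.\<close>

definition cocycle ::
  "'w measure \<Rightarrow> ('w \<Rightarrow> 'w) \<Rightarrow> ('w \<Rightarrow> 'b \<Rightarrow> 'b) \<Rightarrow> int \<Rightarrow> int \<Rightarrow> 'w \<Rightarrow> 'b \<Rightarrow> 'b" where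
  "cocycle P T \<gamma> n m \<omega> = ordered_comp (\<lambda>k. \<gamma> (int_iterate P T k \<omega>)) m (nat (n - m))"

end

theory Submission
  imports Defs
begin

text \<open>Hennion's argument for products of random matrices. If \<open>l y \<le> x\<close> and \<open>m x \<le> y\<close>, call \<open>l m\<close> a
  closeness of \<open>x\<close> and \<open>y\<close>; it is invariant under scaling, is preserved by positive maps, and closeness
  near 1 of two states forces them to be close in norm because the norm is controlled by the trace
  on the positive cone. If \<open>c(\<Gamma>) < 1\<close>, then \<open>\<Gamma> \<cdot> x \<ge> \<delta> (\<Gamma> \<cdot> y)\<close> for some \<open>\<delta> > 0\<close> and all states \<open>x\<close>, \<open>y\<close>,
  and applying \<open>\<Gamma>\<close> multiplies the defect \<open>1 - l m\<close> by at most \<open>1 - \<delta>\<^sup>2\<close>. For fixed \<open>n\<close>, \<open>m\<close>, \<open>\<delta>\<close> this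
  condition on \<open>\<Gamma>\<^bsub>n,m\<^esub>\<close> is an event, because by separability it suffices to test it on countably many
  states. By ergodicity an event of positive probability of this kind occurs infinitely often in
  the past of almost every orbit, so \<open>\<Gamma>\<^bsub>n,m\<^esub> \<cdot> x\<close> is Cauchy as \<open>m\<close> tends to \<open>-\<infinity>\<close>, with a limit that
  does not depend on \<open>x\<close>.

  The norm is \<open>\<tau>(|x|)\<close>, so duality between \<open>L\<^sup>1(M,\<tau>)\<close> and \<open>M\<close> rests on the absolute value: square
  roots of positive operators are constructed from scratch, and the polar decomposition is replaced
  by the contractions \<open>b (|b| + \<epsilon>)\<^sup>-\<^sup>1\<close>, which belong to \<open>M\<close>.\<close>

section \<open>Bounded operators on a complex Hilbert space\<close>

text \<open>Limits are taken in norm, where the space is complete and the set of states is closed,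
  so completeness of Hennion's metric never enters; the order is only used to produce and transport
  the bounds l and m. The assumption c < 1 is used once, through d = (1 - q) / (1 + q) with q =
  m(x,y) m(y,x). Since d <= 1 on states, c bounds d after one application of the map, hence q >= (1
  - c) / (1 + c) there, and m(y,x) <= 1 leaves the same lower bound for m(x,y). The rates are
  rounded down to 1 / (j + 1), so that countably many events cover the contracting event up to a
  null set and one of them has positive probability. The blocks found in the past are chosen
  disjoint, each ending before the previous choice begins, so that their factors 1 - \<delta>^2
  multiply. The constants 2 and 4 in the norm estimates come from splitting an operator into real
  and imaginary parts when a positive functional is bounded.\<close>

lemma scaleC_zero_left [simp]: "0 *\<^sub>C (x::'a::cbanach) = 0"
  using norm_scaleC[of 0 x] by simp

lemma scaleC_zero_right [simp]: "c *\<^sub>C (0::'a::cbanach) = 0"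
  using norm_scaleC[of c 0] by simp

lemma scaleC_one [simp]: "1 *\<^sub>C (x::'a::cbanach) = x"
  using scaleR_scaleC[of 1 x] by simp

lemma scaleC_minus_right: "c *\<^sub>C (- x::'a::cbanach) = - (c *\<^sub>C x)"
  using scaleC_add_right[of c x "-x"] by (simp add: eq_neg_iff_add_eq_0 add.commute)

lemma scaleC_diff_right: "c *\<^sub>C (x - y::'a::cbanach) = c *\<^sub>C x - c *\<^sub>C y"
  using scaleC_add_right[of c x "-y"] by (simp add: scaleC_minus_right)

lemma scaleC_scaleR: "c *\<^sub>C (r *\<^sub>R (x::'a::cbanach)) = r *\<^sub>R (c *\<^sub>C x)"
  by (simp add: scaleR_scaleC scaleC_scaleC mult.commute)

lemma scaleC_scaleR_left: "(r *\<^sub>R c) *\<^sub>C (x::'a::cbanach) = r *\<^sub>R (c *\<^sub>C x)"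
  by (simp add: scaleR_scaleC scaleC_scaleC scaleR_conv_of_real)

lemma bounded_bilinear_scaleC:
  "bounded_bilinear (\<lambda>c (x::'a::cbanach). c *\<^sub>C x)"
  by (rule bounded_bilinear.intro)
    (auto simp: scaleC_add_left scaleC_add_right scaleC_scaleR scaleC_scaleR_left norm_scaleC
      intro!: exI[of _ 1])

lemma bounded_linear_scaleC: "bounded_linear (\<lambda>x::'a::cbanach. c *\<^sub>C x)"
  by (rule bounded_bilinear.bounded_linear_right[OF bounded_bilinear_scaleC])

lemma cinner_add_left: "cinner (x + y) z = cinner x z + cinner y (z::'h::chilbert_space)"
  by (metis cinner_commute cinner_add_right complex_cnj_add)

lemma cinner_scaleC_left: "cinner (c *\<^sub>C x) y = cnj c * cinner x (y::'h::chilbert_space)"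
  by (metis cinner_commute cinner_scaleC_right complex_cnj_mult)

lemma cinner_zero_right [simp]: "cinner x (0::'h::chilbert_space) = 0"
  using cinner_scaleC_right[of x 0 0] by simp

lemma cinner_zero_left [simp]: "cinner (0::'h::chilbert_space) x = 0"
  using cinner_scaleC_left[of 0 0 x] by simp

lemma cinner_minus_right: "cinner x (- y::'h::chilbert_space) = - cinner x y"
  using cinner_add_right[of x y "-y"] by (simp add: eq_neg_iff_add_eq_0 add.commute)

lemma cinner_minus_left: "cinner (- x) (y::'h::chilbert_space) = - cinner x y"
  using cinner_add_left[of x "-x" y] by (simp add: eq_neg_iff_add_eq_0 add.commute)

lemma cinner_diff_right: "cinner x (y - z::'h::chilbert_space) = cinner x y - cinner x z"
  using cinner_add_right[of x y "-z"] by (simp add: cinner_minus_right)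

lemma cinner_diff_left: "cinner (x - y) (z::'h::chilbert_space) = cinner x z - cinner y z"
  using cinner_add_left[of x "-y" z] by (simp add: cinner_minus_left)

lemma cinner_scaleR_right: "cinner x (r *\<^sub>R y::'h::chilbert_space) = r *\<^sub>R cinner x y"
  by (simp add: scaleR_scaleC cinner_scaleC_right scaleR_conv_of_real)

lemma cinner_scaleR_left: "cinner (r *\<^sub>R x) (y::'h::chilbert_space) = r *\<^sub>R cinner x y"
  by (simp add: scaleR_scaleC cinner_scaleC_left scaleR_conv_of_real)

lemmas cinner_simps = cinner_add_left cinner_add_right cinner_diff_left cinner_diff_right
  cinner_minus_left cinner_minus_right cinner_scaleC_left cinner_scaleC_right
  cinner_scaleR_left cinner_scaleR_right

lemma cinner_eqI:
  fixes x y :: "'h::chilbert_space"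
  assumes "\<And>z. cinner z x = cinner z y"
  shows "x = y"
proof -
  have "cinner (x - y) (x - y) = 0"
    using assms[of "x - y"] by (simp add: cinner_diff_right)
  then show ?thesis by (simp add: cinner_self)
qed

lemma Re_cinner_commute: "Re (cinner x y) = Re (cinner y (x::'h::chilbert_space))"
  by (subst cinner_commute) simp

lemma norm_add_sq:
  "(norm (x + y::'h::chilbert_space))\<^sup>2 = (norm x)\<^sup>2 + (norm y)\<^sup>2 + 2 * Re (cinner x y)"
proof -
  have "cinner (x + y) (x + y) = cinner x x + cinner y y + (cinner x y + cinner y x)"
    by (simp add: cinner_add_left cinner_add_right)
  from arg_cong[OF this, of Re] show ?thesis
    by (simp add: cinner_self Re_cinner_commute[of y x])
qed

lemma quadratic_nonneg_discriminant:
  fixes a b c :: real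
  assumes nn: "\<And>t. 0 \<le> a + 2 * t * b + t\<^sup>2 * c" and "0 \<le> c"
  shows "b\<^sup>2 \<le> a * c"
proof (cases "c = 0")
  case True
  have "b = 0"
  proof (rule ccontr)
    assume "b \<noteq> 0"
    \<comment> \<open>This \<open>t\<close> makes \<open>a + 2 * t * b\<close> equal to -1.\<close>
    with nn[of "- (a + 1) / (2 * b)"] True show False by (simp add: field_simps)
  qed
  with True show ?thesis by simp
next
  case False
  with assms(2) have "c > 0" by simp
  have "0 \<le> a + 2 * (- b / c) * b + (- b / c)\<^sup>2 * c" by (rule nn)
  also have "\<dots> = (a * c - b\<^sup>2) / c"
    using \<open>c > 0\<close> by (simp add: field_simps power2_eq_square)
  finally show ?thesis using \<open>c > 0\<close> by (simp add: zero_le_divide_iff)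
qed

text \<open>Rotating one argument by this phase turns a bound on a real part into a bound on a
  modulus.\<close>

lemma phase_exists: "\<exists>c. cmod c = 1 \<and> c * q = complex_of_real (cmod q)"
proof (cases "q = 0")
  case False
  have "cnj q / cmod q * q = of_real ((cmod q)\<^sup>2) / cmod q"
    using complex_norm_square[of q] by (simp add: mult.commute)
  also have "\<dots> = cmod q" using False by (simp add: power2_eq_square)
  finally show ?thesis using False by (intro exI[of _ "cnj q / cmod q"]) (simp add: norm_divide)
qed (auto intro: exI[of _ 1])

section \<open>Complex linear and positive operators, adjoints\<close>

lemma pos_opD:
  assumes "pos_op a"
  shows "a \<in> bounded_ops" "cinner x (blinfun_apply a x) = complex_of_real (Re (cinner x (blinfun_apply a x)))"
    "0 \<le> Re (cinner x (blinfun_apply a x))"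
  using assms unfolding pos_op_def by (auto simp: complex_nonneg_Reals_iff complex_eq_iff)

lemma bounded_ops_scaleC:
  "a \<in> bounded_ops \<Longrightarrow> blinfun_apply a (c *\<^sub>C x) = c *\<^sub>C blinfun_apply a x"
  by (auto simp: bounded_ops_def clinear_def)

lemma bounded_ops_id [simp]: "id_blinfun \<in> bounded_ops"
  by (auto simp: bounded_ops_def clinear_def)

lemma bounded_ops_zero [simp]: "0 \<in> bounded_ops"
  by (auto simp: bounded_ops_def clinear_def)

lemma bounded_ops_add: "a \<in> bounded_ops \<Longrightarrow> b \<in> bounded_ops \<Longrightarrow> a + b \<in> bounded_ops"
  by (auto simp: bounded_ops_def clinear_def blinfun.bilinear_simps scaleC_add_right)

lemma bounded_ops_diff: "a \<in> bounded_ops \<Longrightarrow> b \<in> bounded_ops \<Longrightarrow> a - b \<in> bounded_ops"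
  by (auto simp: bounded_ops_def clinear_def blinfun.bilinear_simps scaleC_diff_right)

lemma bounded_ops_scaleR: "a \<in> bounded_ops \<Longrightarrow> r *\<^sub>R a \<in> bounded_ops"
  by (auto simp: bounded_ops_def clinear_def blinfun.bilinear_simps scaleC_scaleR scaleR_add_right)

lemma bounded_ops_comp: "a \<in> bounded_ops \<Longrightarrow> b \<in> bounded_ops \<Longrightarrow> a o\<^sub>L b \<in> bounded_ops"
  by (auto simp: bounded_ops_def clinear_def blinfun.bilinear_simps)

lemma bounded_linear_scale_op: "bounded_linear (\<lambda>x::'h::chilbert_space. c *\<^sub>C blinfun_apply a x)"
  using bounded_linear_compose[OF bounded_linear_scaleC blinfun.bounded_linear_right] .

lemma scale_op_apply [simp]: "blinfun_apply (scale_op c a) x = c *\<^sub>C blinfun_apply a (x::'h::chilbert_space)"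
  unfolding scale_op_def by (simp add: bounded_linear_Blinfun_apply[OF bounded_linear_scale_op])

lemma bounded_ops_scale_op: "a \<in> bounded_ops \<Longrightarrow> scale_op c a \<in> bounded_ops"
  by (auto simp: bounded_ops_def clinear_def blinfun.bilinear_simps scaleC_scaleC scaleC_add_right
      mult.commute)

lemma scale_op_of_real: "scale_op (complex_of_real r) a = r *\<^sub>R a"
  by (rule blinfun_eqI) (simp add: blinfun.bilinear_simps scaleR_scaleC)

lemma norm_scale_op: "norm (scale_op c a) \<le> cmod c * norm a"
  by (rule norm_blinfun_bound)
    (auto simp: norm_scaleC mult.assoc intro!: mult_left_mono norm_blinfun)

text \<open>The operator type contains all real linear operators, so complex linearity of norm
  limits, such as Neumann series, has to be supplied by closedness.\<close>

lemma bounded_ops_closed: "closed (bounded_ops :: 'h::chilbert_space op set)"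
proof -
  have "bounded_ops = (\<Inter>c. \<Inter>x. {a::'h op. blinfun_apply a (c *\<^sub>C x) = c *\<^sub>C blinfun_apply a x})"
    by (auto simp: bounded_ops_def clinear_def blinfun.bilinear_simps)
  also have "closed \<dots>"
    by (intro closed_INT ballI closed_Collect_eq continuous_intros
        bounded_linear.continuous_on[OF bounded_linear_scaleC])
  finally show ?thesis .
qed

text \<open>Discriminant of the form \<open>t \<mapsto> <x + t z, a (x + t z)>\<close>, where
  \<open>z\<close> is \<open>y\<close> rotated so that \<open><x, a z>\<close> is real. Symmetry is
  a separate hypothesis so that the case of the identity already yields the ordinary Cauchy-Schwarz
  inequality below.\<close>

lemma pos_op_cauchy_schwarz:
  fixes a :: "'h::chilbert_space op"
  assumes a: "pos_op a" and sa: "\<And>x y. cinner (blinfun_apply a x) y = cinner x (blinfun_apply a y)"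
  shows "(cmod (cinner x (blinfun_apply a y)))\<^sup>2 \<le>
    Re (cinner x (blinfun_apply a x)) * Re (cinner y (blinfun_apply a y))"
proof -
  obtain c where c: "cmod c = 1"
    and cq: "c * cinner x (blinfun_apply a y) = of_real (cmod (cinner x (blinfun_apply a y)))"
    using phase_exists by blast
  define z where "z = c *\<^sub>C y"
  have az: "blinfun_apply a z = c *\<^sub>C blinfun_apply a y"
    using pos_opD(1)[OF a] by (simp add: z_def bounded_ops_scaleC)
  have xz: "cinner x (blinfun_apply a z) = of_real (cmod (cinner x (blinfun_apply a y)))"
    by (simp add: az cinner_scaleC_right cq)
  have "cinner z (blinfun_apply a z) = (c * cnj c) * cinner y (blinfun_apply a y)"
    by (simp add: az, simp add: z_def cinner_scaleC_right cinner_scaleC_left)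
  also have "c * cnj c = 1" using c by (simp flip: complex_norm_square)
  finally have zz: "cinner z (blinfun_apply a z) = cinner y (blinfun_apply a y)" by simp
  have zx: "Re (cinner z (blinfun_apply a x)) = Re (cinner x (blinfun_apply a z))"
    by (metis sa Re_cinner_commute)
  have "(Re (cinner x (blinfun_apply a z)))\<^sup>2 \<le>
    Re (cinner x (blinfun_apply a x)) * Re (cinner z (blinfun_apply a z))"
  proof (rule quadratic_nonneg_discriminant)
    fix t :: real
    have "0 \<le> Re (cinner (x + t *\<^sub>R z) (blinfun_apply a (x + t *\<^sub>R z)))"
      using pos_opD(3)[OF a] .
    also have "\<dots> = Re (cinner x (blinfun_apply a x)) + 2 * t * Re (cinner x (blinfun_apply a z))
        + t\<^sup>2 * Re (cinner z (blinfun_apply a z))"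
      by (simp add: blinfun.bilinear_simps cinner_simps zx algebra_simps power2_eq_square)
    finally show "0 \<le> \<dots>" .
  qed (use pos_opD(3)[OF a] in auto)
  then show ?thesis by (simp add: xz zz)
qed

lemma pos_op_id [simp]: "pos_op id_blinfun"
  by (auto simp: pos_op_def cinner_self)

lemma cinner_cauchy_schwarz: "cmod (cinner x y) \<le> norm x * norm (y::'h::chilbert_space)"
proof -
  have "(cmod (cinner x y))\<^sup>2 \<le> (norm x * norm y)\<^sup>2"
    using pos_op_cauchy_schwarz[of id_blinfun x y] by (simp add: cinner_self power_mult_distrib)
  then show ?thesis by (rule power2_le_imp_le) simp
qed

lemma bounded_bilinear_cinner: "bounded_bilinear (cinner :: 'h::chilbert_space \<Rightarrow> _)"
  by (rule bounded_bilinear.intro) (auto simp: cinner_simps intro!: exI[of _ 1] cinner_cauchy_schwarz)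

lemma parallelogram:
  "(norm (x - y::'h::chilbert_space))\<^sup>2 + (norm (x + y))\<^sup>2 = 2 * (norm x)\<^sup>2 + 2 * (norm y)\<^sup>2"
  using norm_add_sq[of x y] norm_add_sq[of x "-y"] by (simp add: cinner_minus_right)

text \<open>The representing vector minimises \<open>\<parallel>x\<parallel>\<^sup>2 - 2 Re (f x)\<close>; by the parallelogram law minimising
  sequences are Cauchy.\<close>

lemma riesz_representation:
  fixes f :: "'h::chilbert_space \<Rightarrow> complex"
  assumes bl: "bounded_linear f" and sc: "\<And>c x. f (c *\<^sub>C x) = c * f x"
  shows "\<exists>u. \<forall>x. f x = cinner u x"
proof -
  interpret f: bounded_linear f by fact
  obtain K where K: "\<And>x. cmod (f x) \<le> norm x * K" "K \<ge> 0"
    using f.nonneg_bounded by auto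
  define J where "J x = (norm x)\<^sup>2 - 2 * Re (f x)" for x
  have J_lower: "J x \<ge> - K\<^sup>2" for x
  proof -
    have "Re (f x) \<le> norm x * K" using K(1)[of x] complex_Re_le_cmod order_trans by blast
    moreover have "0 \<le> (norm x - K)\<^sup>2" by simp
    ultimately show ?thesis unfolding J_def power2_diff by (simp add: power2_eq_square algebra_simps)
  qed
  define d where "d = Inf (range J)"
  have bdd: "bdd_below (range J)" using J_lower by (auto intro!: bdd_belowI[of _ "- K\<^sup>2"])
  have d_le: "d \<le> J x" for x unfolding d_def using bdd by (intro cInf_lower) auto
  have mid: "(norm (x - y))\<^sup>2 \<le> 2 * (J x - d) + 2 * (J y - d)" for x y
  proof -
    have "d \<le> J ((1/2) *\<^sub>R (x + y))" by (rule d_le)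
    also have "\<dots> = (norm (x + y))\<^sup>2 / 4 - (Re (f x) + Re (f y))"
      by (simp add: J_def f.scaleR f.add power_divide add_divide_distrib)
    finally show ?thesis using parallelogram[of x y] by (simp add: J_def)
  qed
  have "\<exists>x. J x < d + 1 / Suc n" for n
  proof -
    have "Inf (range J) < d + 1 / Suc n" by (simp add: d_def)
    then show ?thesis using cInf_lessD[of "range J"] by auto
  qed
  then obtain s where s: "\<And>n. J (s n) < d + 1 / Suc n" by metis
  have "Cauchy s"
  proof (rule metric_CauchyI)
    fix e :: real assume e: "e > 0"
    obtain N where N: "4 / e\<^sup>2 < Suc N" using reals_Archimedean2
      by (metis less_Suc_eq of_nat_less_iff order_less_trans)
    show "\<exists>M. \<forall>m\<ge>M. \<forall>n\<ge>M. dist (s m) (s n) < e"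
    proof (intro exI[of _ N] allI impI)
      fix m n assume "m \<ge> N" "n \<ge> N"
      then have "1 / Suc m \<le> 1 / Suc N" "1 / Suc n \<le> 1 / Suc N" by (auto intro: divide_left_mono)
      then have "(norm (s m - s n))\<^sup>2 < 4 * (1 / Suc N)"
        using mid[of "s m" "s n"] s[of m] s[of n] by argo
      also have "\<dots> < e\<^sup>2" using N e by (simp add: field_simps)
      finally show "dist (s m) (s n) < e"
        using e by (simp add: dist_norm power2_less_imp_less)
    qed
  qed
  then obtain u where u: "s \<longlonglongrightarrow> u" using Cauchy_convergent convergent_def by blast
  have "(\<lambda>n. J (s n)) \<longlonglongrightarrow> J u" unfolding J_def by (intro tendsto_intros u f.tendsto)
  moreover have "(\<lambda>n. d + 1 / Suc n) \<longlonglongrightarrow> d + 0"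
    by (intro tendsto_intros LIMSEQ_inverse_real_of_nat[unfolded inverse_eq_divide])
  ultimately have "J u \<le> d + 0"
    by (rule LIMSEQ_le) (intro exI allI impI less_imp_le s)
  then have "J u \<le> d" by simp
  have min: "J u \<le> J x" for x using \<open>J u \<le> d\<close> d_le[of x] by simp
  \<comment> \<open>First variation at the minimiser: \<open>J (u + t v) - J u\<close> is a
    nonnegative quadratic in \<open>t\<close> without constant term, so its linear coefficient
    vanishes.\<close>
  have re: "Re (f v) = Re (cinner u v)" for v
  proof -
    have "(Re (cinner u v) - Re (f v))\<^sup>2 \<le> 0 * (norm v)\<^sup>2"
    proof (rule quadratic_nonneg_discriminant)
      fix t :: real
      have "J (u + t *\<^sub>R v) = J u + 2 * t * (Re (cinner u v) - Re (f v)) + t\<^sup>2 * (norm v)\<^sup>2"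
        by (simp add: J_def norm_add_sq f.add f.scaleR cinner_scaleR_right power_mult_distrib
            algebra_simps)
      with min[of "u + t *\<^sub>R v"]
      show "0 \<le> 0 + 2 * t * (Re (cinner u v) - Re (f v)) + t\<^sup>2 * (norm v)\<^sup>2" by simp
    qed simp
    then show ?thesis by simp
  qed
  have "f v = cinner u v" for v
  proof (rule complex_eqI)
    show "Im (f v) = Im (cinner u v)"
      using re[of "\<i> *\<^sub>C v"] by (simp add: sc cinner_scaleC_right)
  qed (rule re)
  then show ?thesis by blast
qed

text \<open>Riesz representation of \<open>y \<mapsto> <x, a y>\<close> for each \<open>x\<close>.
  The norm bound follows from testing with \<open>y = g x\<close>, where the functional takes the
  value |g x|^2.\<close>

lemma adjoint_exists:
  fixes a :: "'h::chilbert_space op"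
  assumes a: "a \<in> bounded_ops"
  shows "\<exists>b\<in>bounded_ops. norm b \<le> norm a \<and>
    (\<forall>x y. cinner (blinfun_apply b x) y = cinner x (blinfun_apply a y))"
proof -
  have "\<exists>u. \<forall>y. cinner x (blinfun_apply a y) = cinner u y" for x
    by (rule riesz_representation)
      (auto simp: bounded_ops_scaleC[OF a] cinner_scaleC_right intro!: bounded_linear_compose[OF
        bounded_bilinear.bounded_linear_right[OF bounded_bilinear_cinner] blinfun.bounded_linear_right])
  then obtain g where g: "\<And>x y. cinner x (blinfun_apply a y) = cinner (g x) y" by metis
  have eq: "u = v" if "\<And>y. cinner u y = cinner v y" for u v :: 'h
    by (rule cinner_eqI) (metis that cinner_commute)
  have add: "g (x + y) = g x + g y" for x y
    by (rule eq) (simp add: cinner_add_left flip: g)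
  have sc: "g (c *\<^sub>C x) = c *\<^sub>C g x" for c x
    by (rule eq) (simp add: cinner_scaleC_left flip: g)
  have bound: "norm (g x) \<le> norm a * norm x" for x
  proof (cases "g x = 0")
    case False
    have "(norm (g x))\<^sup>2 = cmod (cinner x (blinfun_apply a (g x)))"
      by (simp add: g cinner_self norm_power)
    also have "\<dots> \<le> norm x * (norm a * norm (g x))"
      by (intro order_trans[OF cinner_cauchy_schwarz] mult_left_mono norm_blinfun) auto
    finally have "norm (g x) * norm (g x) \<le> (norm a * norm x) * norm (g x)"
      by (simp add: power2_eq_square mult_ac)
    with False show ?thesis by (simp add: mult_le_cancel_right)
  qed simp
  have bl: "bounded_linear g"
    by (rule bounded_linear_intro[of _ "norm a"])
      (use bound in \<open>auto simp: add scaleR_scaleC sc mult.commute\<close>)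
  show ?thesis
    by (rule bexI[of _ "Blinfun g"])
      (auto simp: bounded_linear_Blinfun_apply[OF bl] g bounded_ops_def clinear_def add sc bound
        intro!: norm_blinfun_bound)
qed

lemma adj_op_unique:
  assumes "\<And>x y. cinner (blinfun_apply b x) y = cinner x (blinfun_apply a y)"
  shows "adj_op a = b"
  unfolding adj_op_def
proof (rule the_equality)
  fix c assume c: "\<forall>x y. cinner (blinfun_apply c x) y = cinner x (blinfun_apply a y)"
  show "c = b"
    by (intro blinfun_eqI cinner_eqI) (metis assms c cinner_commute)
qed (use assms in blast)

lemma adj_op:
  assumes "a \<in> bounded_ops"
  shows "adj_op a \<in> bounded_ops" "norm (adj_op a) \<le> norm a"
    "cinner (blinfun_apply (adj_op a) x) y = cinner x (blinfun_apply a y)"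
    "cinner x (blinfun_apply (adj_op a) y) = cinner (blinfun_apply a x) y"
proof -
  obtain b where b: "b \<in> bounded_ops" "norm b \<le> norm a"
    "\<And>x y. cinner (blinfun_apply b x) y = cinner x (blinfun_apply a y)"
    using adjoint_exists[OF assms] by blast
  then have "adj_op a = b" by (intro adj_op_unique) auto
  with b show "adj_op a \<in> bounded_ops" "norm (adj_op a) \<le> norm a"
    "cinner (blinfun_apply (adj_op a) x) y = cinner x (blinfun_apply a y)"
    "cinner x (blinfun_apply (adj_op a) y) = cinner (blinfun_apply a x) y"
    by (auto, metis cinner_commute)
qed

text \<open>Polarization: the quadratic form is real on the diagonal, and its values at
  \<open>x + y\<close> and \<open>x + \<i> y\<close> determine the off-diagonal terms.\<close>

lemma pos_op_selfadjoint:
  fixes a :: "'h::chilbert_space op"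
  assumes a: "pos_op a"
  shows "cinner (blinfun_apply a x) y = cinner x (blinfun_apply a y)"
proof -
  have re: "cinner (blinfun_apply a x) x = cinner x (blinfun_apply a x)" for x
    using pos_opD(2)[OF a, of x] by (metis cinner_commute complex_cnj_complex_of_real)
  have p: "cinner (blinfun_apply a x) y + cinner (blinfun_apply a y) x =
      cinner x (blinfun_apply a y) + cinner y (blinfun_apply a x)" for x y
    using re[of "x + y"] re[of x] re[of y]
    by (simp add: blinfun.bilinear_simps cinner_simps algebra_simps)
  have "\<i> * cinner (blinfun_apply a x) y - \<i> * cinner (blinfun_apply a y) x =
      \<i> * cinner x (blinfun_apply a y) - \<i> * cinner y (blinfun_apply a x)"
    using p[of x "\<i> *\<^sub>C y"] bounded_ops_scaleC[OF pos_opD(1)[OF a]]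
    by (simp add: cinner_scaleC_left cinner_scaleC_right)
  then have "\<i> * (cinner (blinfun_apply a x) y - cinner (blinfun_apply a y) x) =
      \<i> * (cinner x (blinfun_apply a y) - cinner y (blinfun_apply a x))"
    by (simp add: right_diff_distrib)
  then have "cinner (blinfun_apply a x) y - cinner (blinfun_apply a y) x =
      cinner x (blinfun_apply a y) - cinner y (blinfun_apply a x)"
    by simp
  with p[of x y] show ?thesis by algebra
qed

text \<open>Phrased through the inner product and not as \<open>adj_op a = a\<close>, which makes
  closedness under norm limits and real combinations immediate without going through the definite
  description.\<close>

definition self_adjoint_op :: "'h::chilbert_space op \<Rightarrow> bool" where
  "self_adjoint_op a \<longleftrightarrow> a \<in> bounded_ops \<and>
     (\<forall>x y. cinner (blinfun_apply a x) y = cinner x (blinfun_apply a y))"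

lemma self_adjoint_opD:
  assumes "self_adjoint_op a"
  shows "a \<in> bounded_ops" "cinner (blinfun_apply a x) y = cinner x (blinfun_apply a y)"
    "cinner x (blinfun_apply a x) = complex_of_real (Re (cinner x (blinfun_apply a x)))"
proof -
  show 1: "a \<in> bounded_ops" "\<And>x y. cinner (blinfun_apply a x) y = cinner x (blinfun_apply a y)"
    using assms by (auto simp: self_adjoint_op_def)
  have "cnj (cinner x (blinfun_apply a x)) = cinner x (blinfun_apply a x)"
    by (metis 1(2) cinner_commute)
  then show "cinner x (blinfun_apply a x) = complex_of_real (Re (cinner x (blinfun_apply a x)))"
    by (simp add: complex_eq_iff)
qed

lemma pos_op_iff:
  "pos_op a \<longleftrightarrow> self_adjoint_op a \<and> (\<forall>x. 0 \<le> Re (cinner x (blinfun_apply a x)))"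
proof
  assume "pos_op a"
  then show "self_adjoint_op a \<and> (\<forall>x. 0 \<le> Re (cinner x (blinfun_apply a x)))"
    by (auto simp: self_adjoint_op_def pos_op_selfadjoint dest: pos_opD)
next
  assume "self_adjoint_op a \<and> (\<forall>x. 0 \<le> Re (cinner x (blinfun_apply a x)))"
  then show "pos_op a"
    unfolding pos_op_def complex_nonneg_Reals_iff
    using self_adjoint_opD(1)[of a] arg_cong[OF self_adjoint_opD(3)[of a], of Im] by auto
qed

text \<open>Cauchy-Schwarz for the form of \<open>a\<close> at the vectors \<open>a x\<close> and
  \<open>x\<close> gives |a x|^4 <= r |a x|^2 r |x|^2.\<close>

lemma pos_op_norm_le:
  fixes a :: "'h::chilbert_space op"
  assumes a: "pos_op a" and r: "r \<ge> 0" "\<And>x. Re (cinner x (blinfun_apply a x)) \<le> r * (norm x)\<^sup>2"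
  shows "norm a \<le> r"
proof (rule norm_blinfun_bound[OF r(1)])
  fix x
  let ?y = "blinfun_apply a x"
  show "norm ?y \<le> r * norm x"
  proof (cases "?y = 0")
    case False
    have "((norm ?y)\<^sup>2)\<^sup>2 = (cmod (cinner ?y (blinfun_apply a x)))\<^sup>2"
      by (simp add: cinner_self norm_power)
    also have "\<dots> \<le> Re (cinner ?y (blinfun_apply a ?y)) * Re (cinner x (blinfun_apply a x))"
      by (rule pos_op_cauchy_schwarz[OF a pos_op_selfadjoint[OF a]])
    also have "\<dots> \<le> (r * (norm ?y)\<^sup>2) * (r * (norm x)\<^sup>2)"
      by (intro mult_mono r pos_opD(3)[OF a]) (use r in auto)
    finally have "(norm ?y)\<^sup>2 * (norm ?y)\<^sup>2 \<le> (r * norm x)\<^sup>2 * (norm ?y)\<^sup>2"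
      by (simp add: power2_eq_square mult_ac)
    then have "(norm ?y)\<^sup>2 \<le> (r * norm x)\<^sup>2"
      by (rule mult_right_le_imp_le) (use False in simp)
    then show ?thesis by (rule power2_le_imp_le) (use r in simp)
  qed (use r in simp)
qed

lemma self_adjoint_op_norm_minus:
  assumes a: "self_adjoint_op a"
  shows "pos_op (norm a *\<^sub>R id_blinfun - a)" "pos_op (norm a *\<^sub>R id_blinfun + a)"
proof -
  have "cmod (cinner x (blinfun_apply a x)) \<le> norm x * (norm a * norm x)" for x
    by (intro order_trans[OF cinner_cauchy_schwarz] mult_left_mono norm_blinfun) auto
  then have "\<bar>Re (cinner x (blinfun_apply a x))\<bar> \<le> norm a * (norm x)\<^sup>2" for x
    by (metis abs_Re_le_cmod order_trans power2_eq_square mult.assoc mult.commute)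
  then have *: "Re (cinner x (blinfun_apply a x)) \<le> norm a * (norm x)\<^sup>2"
    "0 \<le> norm a * (norm x)\<^sup>2 + Re (cinner x (blinfun_apply a x))" for x
    by (smt (verit))+
  show "pos_op (norm a *\<^sub>R id_blinfun - a)" "pos_op (norm a *\<^sub>R id_blinfun + a)"
    using *  self_adjoint_opD(1,2)[OF a]
    by (auto simp: pos_op_iff self_adjoint_op_def blinfun.bilinear_simps cinner_simps cinner_self
        intro!: bounded_ops_add bounded_ops_diff bounded_ops_scaleR)
qed

lemma self_adjoint_op_eqI:
  assumes a: "self_adjoint_op a" and 0: "\<And>x. Re (cinner x (blinfun_apply a x)) = 0"
  shows "a = 0"
proof -
  have "pos_op a" using a 0 by (simp add: pos_op_iff)
  from pos_op_norm_le[OF this, of 0] 0 show ?thesis by simp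
qed

section \<open>Square roots, absolute values and resolvents\<close>

lemma pos_op_comp_adj:
  assumes "b \<in> bounded_ops"
  shows "pos_op (adj_op b o\<^sub>L b)"
  unfolding pos_op_iff self_adjoint_op_def
  by (auto simp: adj_op[OF assms] bounded_ops_comp assms cinner_self)

lemma blinfun_compose_assoc: "(a o\<^sub>L b) o\<^sub>L c = a o\<^sub>L (b o\<^sub>L c)"
  by (rule blinfun_eqI) simp

lemma blinfun_compose_id [simp]: "a o\<^sub>L id_blinfun = a" "id_blinfun o\<^sub>L a = a"
  by (rule blinfun_eqI, simp)+

lemmas comp_simps = bounded_bilinear.add_left[OF bounded_bilinear_blinfun_compose]
  bounded_bilinear.add_right[OF bounded_bilinear_blinfun_compose]
  bounded_bilinear.diff_left[OF bounded_bilinear_blinfun_compose]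
  bounded_bilinear.diff_right[OF bounded_bilinear_blinfun_compose]
  bounded_bilinear.minus_left[OF bounded_bilinear_blinfun_compose]
  bounded_bilinear.minus_right[OF bounded_bilinear_blinfun_compose]
  bounded_bilinear.scaleR_left[OF bounded_bilinear_blinfun_compose]
  bounded_bilinear.scaleR_right[OF bounded_bilinear_blinfun_compose]
  blinfun_compose_assoc

text \<open>The iteration \<open>y \<mapsto> (x + y\<^sup>2) / 2\<close> for \<open>1 - sqrt (1 - x)\<close>. The increments are polynomials in
  \<open>x\<close> with nonnegative coefficients, so they are dominated in norm by those of the same iteration
  for the number 1.\<close>

primrec sqrt_iter :: "'h::chilbert_space op \<Rightarrow> nat \<Rightarrow> 'h op" where
  "sqrt_iter x 0 = 0"
| "sqrt_iter x (Suc n) = (1/2) *\<^sub>R (x + (sqrt_iter x n o\<^sub>L sqrt_iter x n))"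

primrec sqrt_iter_real :: "nat \<Rightarrow> real" where
  "sqrt_iter_real 0 = 0"
| "sqrt_iter_real (Suc n) = (1 + (sqrt_iter_real n)\<^sup>2) / 2"

lemma sqrt_iter_real_bounds: "0 \<le> sqrt_iter_real n \<and> sqrt_iter_real n \<le> 1"
  by (induction n) (auto simp: power_le_one)

lemma sqrt_iter_real_mono: "sqrt_iter_real n \<le> sqrt_iter_real (Suc n)"
proof -
  have "0 \<le> (1 - sqrt_iter_real n)\<^sup>2" by simp
  then show ?thesis unfolding power2_diff by simp
qed

lemma sqrt_iter_commute:
  assumes "c o\<^sub>L x = x o\<^sub>L c"
  shows "c o\<^sub>L sqrt_iter x n = sqrt_iter x n o\<^sub>L c"
proof (induction n)
  case (Suc n)
  have "c o\<^sub>L (sqrt_iter x n o\<^sub>L sqrt_iter x n) = (sqrt_iter x n o\<^sub>L sqrt_iter x n) o\<^sub>L c"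
    by (simp only: blinfun_compose_assoc[symmetric] Suc) (simp only: blinfun_compose_assoc Suc)
  then show ?case using assms by (simp add: comp_simps)
qed simp

lemma sqrt_iter_self_adjoint:
  assumes "self_adjoint_op x"
  shows "self_adjoint_op (sqrt_iter x n)"
  by (induction n)
    (use assms in \<open>auto simp: self_adjoint_op_def blinfun.bilinear_simps cinner_simps
      intro!: bounded_ops_add bounded_ops_scaleR bounded_ops_comp\<close>)

lemma norm_sqrt_iter:
  assumes "norm x \<le> 1"
  shows "norm (sqrt_iter x n) \<le> sqrt_iter_real n"
proof (induction n)
  case (Suc n)
  have "norm (sqrt_iter x n o\<^sub>L sqrt_iter x n) \<le> norm (sqrt_iter x n) * norm (sqrt_iter x n)"
    by (rule norm_blinfun_compose)
  also have "\<dots> \<le> (sqrt_iter_real n)\<^sup>2"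
    unfolding power2_eq_square by (intro mult_mono Suc) (use sqrt_iter_real_bounds in auto)
  finally show ?case
    using norm_triangle_ineq[of x "sqrt_iter x n o\<^sub>L sqrt_iter x n"] assms by simp
qed simp

text \<open>Consecutive iterates commute, so with a, b the iterates the next increment is (a - b)(a
  + b) / 2; the scalar recursion satisfies the same identity, and norms are
  submultiplicative.\<close>

lemma norm_sqrt_iter_diff:
  assumes x: "norm x \<le> 1"
  shows "norm (sqrt_iter x (Suc n) - sqrt_iter x n) \<le> sqrt_iter_real (Suc n) - sqrt_iter_real n"
proof (induction n)
  case 0
  then show ?case using x by simp
next
  case (Suc n)
  let ?a = "sqrt_iter x (Suc n)" and ?b = "sqrt_iter x n"
  let ?s = "sqrt_iter_real (Suc n)" and ?t = "sqrt_iter_real n"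
  have xb: "x o\<^sub>L ?b = ?b o\<^sub>L x" by (rule sqrt_iter_commute) simp
  have com: "?a o\<^sub>L ?b = ?b o\<^sub>L ?a" by (rule sqrt_iter_commute[OF xb[symmetric], symmetric])
  have "sqrt_iter x (Suc (Suc n)) - ?a = (1/2) *\<^sub>R (x + (?a o\<^sub>L ?a)) - (1/2) *\<^sub>R (x + (?b o\<^sub>L ?b))"
    by (rule arg_cong2[of _ _ _ _ minus]; rule sqrt_iter.simps(2))
  also have "\<dots> = (1/2) *\<^sub>R ((?a o\<^sub>L ?a) - (?b o\<^sub>L ?b))"
    by (simp only: scaleR_diff_right[symmetric] add_diff_cancel_left)
  also have "(?a o\<^sub>L ?a) - (?b o\<^sub>L ?b) = (?a - ?b) o\<^sub>L (?a + ?b)"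
    by (simp only: comp_simps com) simp
  finally have "norm (sqrt_iter x (Suc (Suc n)) - ?a) = norm ((?a - ?b) o\<^sub>L (?a + ?b)) / 2" by simp
  also have "\<dots> \<le> norm (?a - ?b) * norm (?a + ?b) / 2"
    using norm_blinfun_compose by (rule divide_right_mono) simp
  also have "\<dots> \<le> (?s - ?t) * (?s + ?t) / 2"
    by (intro divide_right_mono mult_mono Suc.IH order_trans[OF norm_triangle_ineq] add_mono
        norm_sqrt_iter x) (use sqrt_iter_real_mono[of n] in auto)
  also have "\<dots> = sqrt_iter_real (Suc (Suc n)) - ?s"
    unfolding sqrt_iter_real.simps(2)[of "Suc n"]
    by (subst (4) sqrt_iter_real.simps(2)) (simp add: field_simps power2_eq_square)
  finally show ?case .
qed

lemma sqrt_iter_convergent: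
  assumes x: "norm x \<le> 1"
  shows "convergent (sqrt_iter x)"
proof -
  have "summable (\<lambda>n. sqrt_iter_real (Suc n) - sqrt_iter_real n)"
  proof -
    have "convergent sqrt_iter_real"
      using Bseq_mono_convergent[of sqrt_iter_real] sqrt_iter_real_mono sqrt_iter_real_bounds
      by (metis BseqI' abs_of_nonneg lift_Suc_mono_le real_norm_def)
    then obtain l where "sqrt_iter_real \<longlonglongrightarrow> l" by (auto simp: convergent_def)
    then show ?thesis by (rule telescope_summable)
  qed
  then have "summable (\<lambda>n. sqrt_iter x (Suc n) - sqrt_iter x n)"
    by (rule summable_comparison_test'[where N = 0]) (use norm_sqrt_iter_diff[OF x] in auto)
  then have "convergent (\<lambda>n. \<Sum>k<n. sqrt_iter x (Suc k) - sqrt_iter x k)"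
    by (simp add: summable_iff_convergent)
  then show ?thesis by (simp del: sqrt_iter.simps(2) add: sum_lessThan_telescope)
qed

lemma self_adjoint_op_closed: "closed (Collect (self_adjoint_op :: 'h::chilbert_space op \<Rightarrow> bool))"
proof -
  have "Collect self_adjoint_op = (bounded_ops :: 'h op set) \<inter>
      (\<Inter>x. \<Inter>y. {a. cinner (blinfun_apply a x) y = cinner x (blinfun_apply a y)})"
    by (auto simp: self_adjoint_op_def)
  also have "closed \<dots>"
    by (intro closed_Int bounded_ops_closed closed_INT ballI closed_Collect_eq
        bounded_bilinear.continuous_on[OF bounded_bilinear_cinner] continuous_intros)
  finally show ?thesis .
qed

lemma pos_op_scaleR: "pos_op a \<Longrightarrow> 0 \<le> r \<Longrightarrow> pos_op (r *\<^sub>R a)"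
  by (auto simp: pos_op_iff self_adjoint_op_def blinfun.bilinear_simps cinner_simps bounded_ops_scaleR)

lemma pos_op_add: "pos_op a \<Longrightarrow> pos_op b \<Longrightarrow> pos_op (a + b)"
  by (auto simp: pos_op_iff self_adjoint_op_def blinfun.bilinear_simps cinner_simps bounded_ops_add)

text \<open>After scaling, x = 1 - a / |a| has norm at most 1, and the limit satisfies 2 y = x +
  y^2, that is, (1 - y)^2 = 1 - x = a / |a|. The commutation clause is what later places the root in
  \<open>M\<close>.\<close>

lemma pos_op_sqrt_exists:
  fixes a :: "'h::chilbert_space op"
  assumes a: "pos_op a"
  shows "\<exists>b. pos_op b \<and> b o\<^sub>L b = a \<and> (\<forall>c. c o\<^sub>L a = a o\<^sub>L c \<longrightarrow> c o\<^sub>L b = b o\<^sub>L c)"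
proof (cases "a = 0")
  case True
  then show ?thesis by (intro exI[of _ 0]) (use a in auto)
next
  case False
  define r where "r = norm a"
  have r: "r > 0" using False by (simp add: r_def)
  define x where "x = id_blinfun - (1 / r) *\<^sub>R a"
  have sa: "self_adjoint_op a" using a by (simp add: pos_op_iff)
  have "x = (1 / r) *\<^sub>R (r *\<^sub>R id_blinfun - a)" using r by (simp add: x_def scaleR_diff_right)
  then have x_pos: "pos_op x"
    using pos_op_scaleR[OF self_adjoint_op_norm_minus(1)[OF sa], of "1 / r"] r by (simp add: r_def)
  have x_norm: "norm x \<le> 1"
    by (rule pos_op_norm_le[OF x_pos])
      (use r pos_opD(3)[OF a] in \<open>auto simp: x_def blinfun.bilinear_simps cinner_simps cinner_self\<close>)
  obtain y where y: "sqrt_iter x \<longlonglongrightarrow> y"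
    using sqrt_iter_convergent[OF x_norm] by (auto simp: convergent_def)
  have fix_y: "y = (1/2) *\<^sub>R (x + (y o\<^sub>L y))"
  proof (rule LIMSEQ_unique)
    show "(\<lambda>n. sqrt_iter x (Suc n)) \<longlonglongrightarrow> y" using y by (rule LIMSEQ_Suc)
    show "(\<lambda>n. sqrt_iter x (Suc n)) \<longlonglongrightarrow> (1/2) *\<^sub>R (x + (y o\<^sub>L y))"
      unfolding sqrt_iter.simps
      by (intro tendsto_intros y bounded_bilinear.tendsto[OF bounded_bilinear_blinfun_compose])
  qed
  have y_sa: "self_adjoint_op y"
    using closed_sequentially[OF self_adjoint_op_closed _ y] sqrt_iter_self_adjoint x_pos
    by (auto simp: pos_op_iff)
  have y_norm: "norm y \<le> 1"
  proof (rule LIMSEQ_le_const2[OF tendsto_norm[OF y]])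
    show "\<exists>N. \<forall>n\<ge>N. norm (sqrt_iter x n) \<le> 1"
      using norm_sqrt_iter[OF x_norm] sqrt_iter_real_bounds order_trans by blast
  qed
  define b where "b = sqrt r *\<^sub>R (id_blinfun - y)"
  have "pos_op (id_blinfun - y)"
  proof -
    have "pos_op ((norm y *\<^sub>R id_blinfun - y) + (1 - norm y) *\<^sub>R id_blinfun)"
      by (intro pos_op_add self_adjoint_op_norm_minus y_sa pos_op_scaleR) (use y_norm in auto)
    then show ?thesis by (simp add: algebra_simps)
  qed
  then have "pos_op b" unfolding b_def by (rule pos_op_scaleR) (use r in simp)
  moreover have "b o\<^sub>L b = a"
  proof -
    have 2: "2 *\<^sub>R y = x + (y o\<^sub>L y)" by (subst fix_y) simp
    have "b o\<^sub>L b = (sqrt r * sqrt r) *\<^sub>R ((id_blinfun - y) o\<^sub>L (id_blinfun - y))"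
      by (simp only: b_def comp_simps(7,8) scaleR_scaleR)
    also have "(id_blinfun - y) o\<^sub>L (id_blinfun - y) = id_blinfun - 2 *\<^sub>R y + (y o\<^sub>L y)"
      by (simp add: comp_simps scaleR_2)
    also have "\<dots> = (1 / r) *\<^sub>R a" by (simp add: 2 x_def)
    finally show ?thesis using r by simp
  qed
  moreover have "c o\<^sub>L b = b o\<^sub>L c" if c: "c o\<^sub>L a = a o\<^sub>L c" for c
  proof -
    have "c o\<^sub>L x = x o\<^sub>L c" using c by (simp add: x_def comp_simps)
    then have eq: "c o\<^sub>L sqrt_iter x n = sqrt_iter x n o\<^sub>L c" for n by (rule sqrt_iter_commute)
    have "(\<lambda>n. c o\<^sub>L sqrt_iter x n) \<longlonglongrightarrow> (c o\<^sub>L y)" "(\<lambda>n. sqrt_iter x n o\<^sub>L c) \<longlonglongrightarrow> (y o\<^sub>L c)"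
      by (intro bounded_bilinear.tendsto[OF bounded_bilinear_blinfun_compose] y tendsto_const)+
    then have "c o\<^sub>L y = y o\<^sub>L c" unfolding eq by (rule LIMSEQ_unique)
    then show ?thesis by (simp add: b_def comp_simps)
  qed
  ultimately show ?thesis by blast
qed

lemma pos_op_sandwich:
  assumes p: "pos_op p" and d: "self_adjoint_op d"
  shows "pos_op (d o\<^sub>L (p o\<^sub>L d))"
  using p self_adjoint_opD[OF d]
  by (auto simp: pos_op_iff self_adjoint_op_def bounded_ops_comp) (metis)

text \<open>For d = b - c one has (b + c) d = 0, so the positive operators d b d and d c d add up to
  0 and both vanish. Their difference is d^3, and a self-adjoint operator with zero cube is
  zero.\<close>

lemma pos_op_sqrt_unique:
  fixes b c :: "'h::chilbert_space op"
  assumes b: "pos_op b" and c: "pos_op c" and eq: "b o\<^sub>L b = c o\<^sub>L c" and com: "b o\<^sub>L c = c o\<^sub>L b"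
  shows "b = c"
proof -
  define d where "d = b - c"
  have sa: "self_adjoint_op b" "self_adjoint_op c" using b c by (simp_all add: pos_op_iff)
  have d: "self_adjoint_op d"
    using sa by (auto simp: d_def self_adjoint_op_def bounded_ops_diff blinfun.bilinear_simps cinner_simps)
  have "(b + c) o\<^sub>L d = 0" by (simp add: d_def comp_simps eq com)
  then have sum0: "(d o\<^sub>L (b o\<^sub>L d)) + (d o\<^sub>L (c o\<^sub>L d)) = 0"
    by (metis comp_simps(1,2) blinfun_compose_zero(2))
  have pos: "pos_op (d o\<^sub>L (b o\<^sub>L d))" "pos_op (d o\<^sub>L (c o\<^sub>L d))"
    by (intro pos_op_sandwich b c d)+
  have z: "d o\<^sub>L (b o\<^sub>L d) = 0"
  proof (rule self_adjoint_op_eqI)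
    fix x
    have "Re (cinner x (blinfun_apply ((d o\<^sub>L (b o\<^sub>L d)) + (d o\<^sub>L (c o\<^sub>L d))) x)) = 0"
      unfolding sum0 by simp
    then show "Re (cinner x (blinfun_apply (d o\<^sub>L (b o\<^sub>L d)) x)) = 0"
      using pos_opD(3)[OF pos(1), of x] pos_opD(3)[OF pos(2), of x]
      unfolding blinfun.add_left cinner_add_right by simp
  qed (use pos in \<open>simp add: pos_op_iff\<close>)
  with sum0 have z': "d o\<^sub>L (c o\<^sub>L d) = 0" by simp
  have "d o\<^sub>L (d o\<^sub>L d) = (d o\<^sub>L (b o\<^sub>L d)) - (d o\<^sub>L (c o\<^sub>L d))"
    by (subst (2) d_def) (simp add: comp_simps)
  with z z' have d3: "d o\<^sub>L (d o\<^sub>L d) = 0" by simp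
  have dd: "blinfun_apply d (blinfun_apply d x) = 0" for x
  proof -
    have "cinner (blinfun_apply d (blinfun_apply d x)) (blinfun_apply d (blinfun_apply d x)) =
      cinner (blinfun_apply d x) (blinfun_apply (d o\<^sub>L (d o\<^sub>L d)) x)"
      using self_adjoint_opD(2)[OF d] by simp
    then show ?thesis by (simp add: d3 cinner_self)
  qed
  have "blinfun_apply d x = 0" for x
  proof -
    have "cinner (blinfun_apply d x) (blinfun_apply d x) = cinner x (blinfun_apply d (blinfun_apply d x))"
      using self_adjoint_opD(2)[OF d] by simp
    then show ?thesis by (simp add: dd cinner_self)
  qed
  then have "d = 0" by (intro blinfun_eqI) simp
  then show ?thesis by (simp add: d_def)
qed

text \<open>Any root \<open>b'\<close> commutes with its own square \<open>a\<close>, hence with the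
  constructed root \<open>b\<close>, so uniqueness among commuting roots is enough.\<close>

lemma pos_op_sqrt:
  fixes a :: "'h::chilbert_space op"
  assumes a: "pos_op a"
  shows "\<exists>b. pos_op b \<and> b o\<^sub>L b = a \<and> (\<forall>c. c o\<^sub>L a = a o\<^sub>L c \<longrightarrow> c o\<^sub>L b = b o\<^sub>L c) \<and>
    (\<forall>b'. pos_op b' \<and> b' o\<^sub>L b' = a \<longrightarrow> b' = b)"
proof -
  obtain b where b: "pos_op b" "b o\<^sub>L b = a" "\<forall>c. c o\<^sub>L a = a o\<^sub>L c \<longrightarrow> c o\<^sub>L b = b o\<^sub>L c"
    using pos_op_sqrt_exists[OF a] by (elim exE conjE) (rule that)
  have uniq: "b' = b" if b': "pos_op b' \<and> b' o\<^sub>L b' = a" for b'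
  proof (rule pos_op_sqrt_unique[OF conjunct1[OF b'] b(1)])
    have "b' o\<^sub>L a = a o\<^sub>L b'" unfolding conjunct2[OF b', symmetric] by (rule blinfun_compose_assoc[symmetric])
    then show "b' o\<^sub>L b = b o\<^sub>L b'" using b(3) by (elim allE impE)
  qed (simp only: conjunct2[OF b'] b(2))
  show ?thesis
    by (rule exI[of _ b], intro conjI b) (intro allI impI, erule uniq)
qed

lemma abs_op:
  assumes a: "a \<in> bounded_ops"
  shows "pos_op (abs_op a)" "abs_op a o\<^sub>L abs_op a = adj_op a o\<^sub>L a"
    "\<And>c. c o\<^sub>L (adj_op a o\<^sub>L a) = (adj_op a o\<^sub>L a) o\<^sub>L c \<Longrightarrow> c o\<^sub>L abs_op a = abs_op a o\<^sub>L c"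
proof -
  obtain b where b: "pos_op b" "b o\<^sub>L b = adj_op a o\<^sub>L a"
    "\<forall>c. c o\<^sub>L (adj_op a o\<^sub>L a) = (adj_op a o\<^sub>L a) o\<^sub>L c \<longrightarrow> c o\<^sub>L b = b o\<^sub>L c"
    "\<forall>b'. pos_op b' \<and> b' o\<^sub>L b' = adj_op a o\<^sub>L a \<longrightarrow> b' = b"
    using pos_op_sqrt[OF pos_op_comp_adj[OF a]] by (elim exE conjE) (rule that)
  have "abs_op a = b"
    unfolding abs_op_def by (rule the_equality, rule conjI[OF b(1,2)], erule b(4)[rule_format])
  with b(1,2) show "pos_op (abs_op a)" "abs_op a o\<^sub>L abs_op a = adj_op a o\<^sub>L a" by simp_all
  show "c o\<^sub>L abs_op a = abs_op a o\<^sub>L c" if "c o\<^sub>L (adj_op a o\<^sub>L a) = (adj_op a o\<^sub>L a) o\<^sub>L c" for c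
    unfolding \<open>abs_op a = b\<close> using that by (rule b(3)[rule_format])
qed

primrec op_power :: "'h::chilbert_space op \<Rightarrow> nat \<Rightarrow> 'h op" where
  "op_power x 0 = id_blinfun"
| "op_power x (Suc n) = x o\<^sub>L op_power x n"

lemma neumann_series:
  fixes x :: "'h::chilbert_space op"
  assumes x: "x \<in> bounded_ops" "norm x < 1"
  obtains q where "q \<in> bounded_ops" "(id_blinfun - x) o\<^sub>L q = id_blinfun" "q o\<^sub>L (id_blinfun - x) = id_blinfun"
proof -
  have le: "norm (op_power x n) \<le> norm x ^ n" for n
  proof (induction n)
    case 0
    show ?case by (simp add: norm_blinfun_id_le)
  next
    case (Suc n)
    then show ?case
      by (auto intro!: order_trans[OF norm_blinfun_compose] mult_left_mono)
  qed
  have com: "x o\<^sub>L op_power x n = op_power x n o\<^sub>L x" for n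
  proof (induction n)
    case (Suc n)
    have "x o\<^sub>L (x o\<^sub>L op_power x n) = x o\<^sub>L (op_power x n o\<^sub>L x)" by (simp only: Suc)
    then show ?case by (simp only: op_power.simps blinfun_compose_assoc)
  qed simp
  have "summable (op_power x)"
    by (rule summable_comparison_test'[where N = 0 and g = "\<lambda>n. norm x ^ n"])
      (use x le in \<open>auto intro: summable_geometric\<close>)
  then obtain q where q: "op_power x sums q" by (auto simp: summable_def)
  have "(\<lambda>n. op_power x (Suc n)) sums (q - id_blinfun)"
    using sums_split_initial_segment[OF q, of 1] by simp
  moreover have "(\<lambda>n. x o\<^sub>L op_power x n) sums (x o\<^sub>L q)" "(\<lambda>n. op_power x n o\<^sub>L x) sums (q o\<^sub>L x)"
    using bounded_linear.sums[OF bounded_bilinear.bounded_linear_right[OF bounded_bilinear_blinfun_compose] q]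
      bounded_linear.sums[OF bounded_bilinear.bounded_linear_left[OF bounded_bilinear_blinfun_compose] q]
    by auto
  ultimately have "x o\<^sub>L q = q - id_blinfun" "q o\<^sub>L x = q - id_blinfun"
    unfolding com[symmetric] by (auto intro: sums_unique2)
  then have "(id_blinfun - x) o\<^sub>L q = id_blinfun" "q o\<^sub>L (id_blinfun - x) = id_blinfun"
    by (simp_all add: comp_simps)
  moreover have "q \<in> bounded_ops"
  proof (rule closed_sequentially[OF bounded_ops_closed _ q[unfolded sums_def]])
    have "op_power x n \<in> bounded_ops" for n by (induction n) (use x in \<open>auto intro: bounded_ops_comp\<close>)
    then show "(\<Sum>i<n. op_power x i) \<in> bounded_ops" for n
      by (induction n) (auto intro: bounded_ops_add)
  qed
  ultimately show thesis using that by blast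
qed

text \<open>With c = |p| + e one can write p + e = c (1 - x) for the positive operator x = (|p| - p)
  / c, whose norm is at most |p| / c < 1; the Neumann series inverts 1 - x.\<close>

lemma pos_op_add_id_invertible:
  fixes p :: "'h::chilbert_space op"
  assumes p: "pos_op p" and e: "e > 0"
  obtains q where "q \<in> bounded_ops" "(p + e *\<^sub>R id_blinfun) o\<^sub>L q = id_blinfun"
    "q o\<^sub>L (p + e *\<^sub>R id_blinfun) = id_blinfun"
proof -
  define c where "c = norm p + e"
  have c: "c > 0" using e by (simp add: c_def add_nonneg_pos)
  define x where "x = (1 / c) *\<^sub>R (norm p *\<^sub>R id_blinfun - p)"
  have x_pos: "pos_op x" unfolding x_def
    by (intro pos_op_scaleR self_adjoint_op_norm_minus) (use p c in \<open>auto simp: pos_op_iff\<close>)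
  have "norm x \<le> norm p / c"
  proof (rule pos_op_norm_le[OF x_pos])
    fix z
    have "Re (cinner z (blinfun_apply x z)) = (norm p * (norm z)\<^sup>2 - Re (cinner z (blinfun_apply p z))) / c"
      by (simp add: x_def blinfun.bilinear_simps cinner_simps cinner_self)
    also have "\<dots> \<le> norm p * (norm z)\<^sup>2 / c"
      using pos_opD(3)[OF p, of z] c by (intro divide_right_mono) auto
    finally show "Re (cinner z (blinfun_apply x z)) \<le> norm p / c * (norm z)\<^sup>2" by simp
  qed (use c in simp)
  also have "\<dots> < 1" using e c by (simp add: c_def)
  finally have "norm x < 1" .
  then obtain q where q: "q \<in> bounded_ops" "(id_blinfun - x) o\<^sub>L q = id_blinfun"
    "q o\<^sub>L (id_blinfun - x) = id_blinfun"
    using neumann_series pos_opD(1)[OF x_pos] by blast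
  have "p + e *\<^sub>R id_blinfun = c *\<^sub>R (id_blinfun - x)"
    using c by (simp add: x_def scaleR_diff_right) (simp add: c_def scaleR_add_left)
  with q c show thesis
    by (intro that[of "(1 / c) *\<^sub>R q"]) (simp_all add: bounded_ops_scaleR comp_simps flip: scaleR_diff_right)
qed

section \<open>The predual of a tracial von Neumann algebra\<close>

locale L1_space =
  fixes M :: "'h::chilbert_space op set"
    and \<tau> :: "'h op \<Rightarrow> complex"
    and \<iota> :: "'h op \<Rightarrow> 'l::cbanach"
  assumes tracial: "tracial_von_neumann_algebra M \<tau>"
    and completion: "L1_completion M \<tau> \<iota>"
begin

section \<open>Stability of \<open>M\<close> under algebraic operations, roots and inverses\<close>

lemma M_bounded_ops: "a \<in> M \<Longrightarrow> a \<in> bounded_ops"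
  using tracial by (auto simp: tracial_von_neumann_algebra_def von_neumann_algebra_def)

lemma M_adj: "a \<in> M \<Longrightarrow> adj_op a \<in> M"
  using tracial by (auto simp: tracial_von_neumann_algebra_def von_neumann_algebra_def)

lemma bicommutant: "commutant (commutant M) = M"
  using tracial by (auto simp: tracial_von_neumann_algebra_def von_neumann_algebra_def)

text \<open>Since \<open>M\<close> is its own bicommutant, each closure property becomes a
  computation with an arbitrary element of the commutant.\<close>

lemma M_I:
  assumes "a \<in> bounded_ops" "\<And>c. c \<in> commutant M \<Longrightarrow> c o\<^sub>L a = a o\<^sub>L c"
  shows "a \<in> M"
proof -
  have "a \<in> commutant (commutant M)" using assms unfolding commutant_def[of "commutant M"] by simp
  then show ?thesis by (simp only: bicommutant)
qed

lemma M_commute: "c \<in> commutant M \<Longrightarrow> a \<in> M \<Longrightarrow> c o\<^sub>L a = a o\<^sub>L c"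
  unfolding commutant_def by simp

lemma commutant_bounded_ops: "c \<in> commutant A \<Longrightarrow> c \<in> bounded_ops"
  unfolding commutant_def by simp

lemma M_id [simp]: "id_blinfun \<in> M"
  by (rule M_I) simp_all

lemma M_zero [simp]: "0 \<in> M"
  by (rule M_I) simp_all

lemma M_add:
  assumes a: "a \<in> M" and b: "b \<in> M"
  shows "a + b \<in> M"
proof (rule M_I)
  fix c assume c: "c \<in> commutant M"
  show "c o\<^sub>L (a + b) = (a + b) o\<^sub>L c"
    by (simp only: comp_simps M_commute[OF c a] M_commute[OF c b])
qed (intro bounded_ops_add M_bounded_ops a b)

lemma M_diff:
  assumes a: "a \<in> M" and b: "b \<in> M"
  shows "a - b \<in> M"
proof (rule M_I)
  fix c assume c: "c \<in> commutant M"
  show "c o\<^sub>L (a - b) = (a - b) o\<^sub>L c"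
    by (simp only: comp_simps M_commute[OF c a] M_commute[OF c b])
qed (intro bounded_ops_diff M_bounded_ops a b)

lemma M_scaleR:
  assumes a: "a \<in> M"
  shows "r *\<^sub>R a \<in> M"
proof (rule M_I)
  fix c assume c: "c \<in> commutant M"
  show "c o\<^sub>L (r *\<^sub>R a) = (r *\<^sub>R a) o\<^sub>L c"
    by (simp only: comp_simps M_commute[OF c a])
qed (intro bounded_ops_scaleR M_bounded_ops a)

lemma M_scale_op:
  assumes a: "a \<in> M"
  shows "scale_op c a \<in> M"
proof (rule M_I)
  fix d assume d: "d \<in> commutant M"
  show "d o\<^sub>L scale_op c a = scale_op c a o\<^sub>L d"
  proof (rule blinfun_eqI)
    fix x
    have "blinfun_apply (d o\<^sub>L a) x = blinfun_apply (a o\<^sub>L d) x" by (simp only: M_commute[OF d a])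
    then show "blinfun_apply (d o\<^sub>L scale_op c a) x = blinfun_apply (scale_op c a o\<^sub>L d) x"
      by (simp add: bounded_ops_scaleC[OF commutant_bounded_ops[OF d]])
  qed
qed (use a in \<open>simp add: bounded_ops_scale_op M_bounded_ops\<close>)

lemma M_comp:
  assumes a: "a \<in> M" and b: "b \<in> M"
  shows "a o\<^sub>L b \<in> M"
proof (rule M_I)
  fix c assume c: "c \<in> commutant M"
  have "c o\<^sub>L (a o\<^sub>L b) = (a o\<^sub>L c) o\<^sub>L b"
    by (simp only: blinfun_compose_assoc[symmetric] M_commute[OF c a])
  also have "\<dots> = (a o\<^sub>L b) o\<^sub>L c"
    by (simp only: blinfun_compose_assoc M_commute[OF c b])
  finally show "c o\<^sub>L (a o\<^sub>L b) = (a o\<^sub>L b) o\<^sub>L c" .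
qed (intro bounded_ops_comp M_bounded_ops a b)

lemma M_sqrt:
  assumes a: "a \<in> M" "pos_op a"
  shows "\<exists>s\<in>M. pos_op s \<and> s o\<^sub>L s = a"
proof -
  obtain s where s: "pos_op s" "s o\<^sub>L s = a" "\<forall>c. c o\<^sub>L a = a o\<^sub>L c \<longrightarrow> c o\<^sub>L s = s o\<^sub>L c"
    using pos_op_sqrt_exists[OF a(2)] by (elim exE conjE) (rule that)
  have "s \<in> M"
    by (rule M_I[OF pos_opD(1)[OF s(1)]], rule s(3)[rule_format]) (rule M_commute[OF _ a(1)])
  with s(1,2) show ?thesis by (intro bexI conjI)
qed

lemma M_abs:
  assumes a: "a \<in> M"
  shows "abs_op a \<in> M"
proof (rule M_I)
  show "abs_op a \<in> bounded_ops" by (rule pos_opD(1)[OF abs_op(1)[OF M_bounded_ops[OF a]]])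
  fix c assume "c \<in> commutant M"
  then show "c o\<^sub>L abs_op a = abs_op a o\<^sub>L c"
    by (intro abs_op(3) M_commute M_comp M_adj a M_bounded_ops)
qed

lemma M_inverse:
  assumes p: "p \<in> M" and q: "q \<in> bounded_ops" "p o\<^sub>L q = id_blinfun" "q o\<^sub>L p = id_blinfun"
  shows "q \<in> M"
proof (rule M_I[OF q(1)])
  fix c assume c: "c \<in> commutant M"
  have "c o\<^sub>L q = (q o\<^sub>L p) o\<^sub>L (c o\<^sub>L q)" by (simp only: q blinfun_compose_id)
  also have "\<dots> = q o\<^sub>L ((c o\<^sub>L p) o\<^sub>L q)" by (simp only: M_commute[OF c p] blinfun_compose_assoc)
  also have "\<dots> = q o\<^sub>L c" by (simp only: q blinfun_compose_assoc blinfun_compose_id)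
  finally show "c o\<^sub>L q = q o\<^sub>L c" .
qed

section \<open>The trace and positive functionals on \<open>M\<close>\<close>

lemma trace_linear: "linear_functional_on M \<tau>"
  using tracial by (simp add: tracial_von_neumann_algebra_def normal_functional_def)

lemma trace_pos: "a \<in> M \<Longrightarrow> pos_op a \<Longrightarrow> \<tau> a \<in> nonneg_Reals"
  using tracial by (simp add: tracial_von_neumann_algebra_def)

lemma trace_id [simp]: "\<tau> id_blinfun = 1"
  using tracial by (simp add: tracial_von_neumann_algebra_def)

lemma trace_commute: "a \<in> M \<Longrightarrow> b \<in> M \<Longrightarrow> \<tau> (a o\<^sub>L b) = \<tau> (b o\<^sub>L a)"
  using tracial by (simp add: tracial_von_neumann_algebra_def)

lemma linear_functional_onD:
  assumes "linear_functional_on M \<phi>"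
  shows "a \<in> M \<Longrightarrow> b \<in> M \<Longrightarrow> \<phi> (a + b) = \<phi> a + \<phi> b"
    "a \<in> M \<Longrightarrow> \<phi> (scale_op c a) = c * \<phi> a"
    "a \<in> M \<Longrightarrow> \<phi> (r *\<^sub>R a) = r *\<^sub>R \<phi> a"
    "a \<in> M \<Longrightarrow> b \<in> M \<Longrightarrow> \<phi> (a - b) = \<phi> a - \<phi> b"
proof -
  show add: "a \<in> M \<Longrightarrow> b \<in> M \<Longrightarrow> \<phi> (a + b) = \<phi> a + \<phi> b" for a b
    using assms by (auto simp: linear_functional_on_def)
  show sc: "a \<in> M \<Longrightarrow> \<phi> (scale_op c a) = c * \<phi> a" for a c
    using assms by (auto simp: linear_functional_on_def)
  show r: "a \<in> M \<Longrightarrow> \<phi> (r *\<^sub>R a) = r *\<^sub>R \<phi> a" for a r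
    using sc[of a "of_real r"] by (simp add: scale_op_of_real scaleR_conv_of_real)
  show "a \<in> M \<Longrightarrow> b \<in> M \<Longrightarrow> \<phi> (a - b) = \<phi> a - \<phi> b" for a b
    using add[of a "(-1) *\<^sub>R b"] r[of b "-1"] M_scaleR[of b "-1"] by simp
qed

lemmas trace_simps = linear_functional_onD[OF trace_linear]

text \<open>Evaluate the functional at the positive operators |c| - c and |c| + c, where |c| is the
  norm times the identity.\<close>

lemma positive_functional_self_adjoint_bound:
  assumes lin: "linear_functional_on M \<phi>" and pos: "\<And>a. a \<in> M \<Longrightarrow> pos_op a \<Longrightarrow> \<phi> a \<in> nonneg_Reals"
    and c: "c \<in> M" "self_adjoint_op c"
  shows "cmod (\<phi> c) \<le> norm c * Re (\<phi> id_blinfun)"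
proof -
  note l = linear_functional_onD[OF lin]
  have id: "Im (\<phi> id_blinfun) = 0" using pos[of id_blinfun] by (simp add: complex_nonneg_Reals_iff)
  have "\<phi> (norm c *\<^sub>R id_blinfun - c) \<in> nonneg_Reals" "\<phi> (norm c *\<^sub>R id_blinfun + c) \<in> nonneg_Reals"
    by (intro pos self_adjoint_op_norm_minus c M_add M_diff M_scaleR M_id)+
  then have "Im (\<phi> c) = 0" "\<bar>Re (\<phi> c)\<bar> \<le> norm c * Re (\<phi> id_blinfun)"
    using id by (auto simp: l c M_scaleR complex_nonneg_Reals_iff)
  then show ?thesis by (simp add: cmod_eq_Re)
qed

text \<open>Write a = b + \<i> c with self-adjoint \<open>b\<close>, \<open>c\<close> of norm at
  most that of \<open>a\<close>, and add the two self-adjoint bounds; this is the origin of the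
  factor 2.\<close>

lemma positive_functional_bound:
  assumes lin: "linear_functional_on M \<phi>" and pos: "\<And>a. a \<in> M \<Longrightarrow> pos_op a \<Longrightarrow> \<phi> a \<in> nonneg_Reals"
    and a: "a \<in> M"
  shows "cmod (\<phi> a) \<le> 2 * norm a * Re (\<phi> id_blinfun)"
proof -
  note l = linear_functional_onD[OF lin]
  note ab = M_bounded_ops[OF a]
  define b where "b = (1/2) *\<^sub>R (a + adj_op a)"
  define c where "c = scale_op (- \<i> / 2) (a - adj_op a)"
  have M: "b \<in> M" "c \<in> M" unfolding b_def c_def by (intro M_scaleR M_scale_op M_add M_diff M_adj a)+
  have "self_adjoint_op b" "self_adjoint_op c"
    using M_bounded_ops[OF M(1)] M_bounded_ops[OF M(2)]
    unfolding self_adjoint_op_def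
    by (auto simp: b_def c_def blinfun.bilinear_simps cinner_simps adj_op[OF ab] algebra_simps)
  moreover have "norm b \<le> norm a"
    using norm_triangle_ineq[of a "adj_op a"] adj_op(2)[OF ab] by (simp add: b_def)
  moreover have "norm c \<le> norm a"
    using norm_scale_op[of "- \<i> / 2" "a - adj_op a"] norm_triangle_ineq4[of a "adj_op a"] adj_op(2)[OF ab]
    by (simp add: c_def norm_divide)
  moreover have "0 \<le> Re (\<phi> id_blinfun)" using pos[of id_blinfun] by (simp add: complex_nonneg_Reals_iff)
  ultimately have "cmod (\<phi> b) \<le> norm a * Re (\<phi> id_blinfun)" "cmod (\<phi> c) \<le> norm a * Re (\<phi> id_blinfun)"
    using positive_functional_self_adjoint_bound[OF lin pos M(1)]
      positive_functional_self_adjoint_bound[OF lin pos M(2)]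
    by (meson mult_right_mono order_trans)+
  moreover have "a = b + scale_op \<i> c"
  proof (rule blinfun_eqI)
    fix x
    have "(1/2) *\<^sub>R y = (1/2) *\<^sub>C y" for y :: 'h by (simp add: scaleR_scaleC)
    then show "blinfun_apply a x = blinfun_apply (b + scale_op \<i> c) x"
      by (simp add: b_def c_def blinfun.bilinear_simps scaleC_scaleC)
        (simp add: scaleC_diff_right scaleC_add_right flip: scaleC_add_left)
  qed
  then have "\<phi> a = \<phi> b + \<i> * \<phi> c" by (simp add: l M M_scale_op)
  then have "cmod (\<phi> a) \<le> cmod (\<phi> b) + cmod (\<phi> c)"
    using norm_triangle_ineq[of "\<phi> b" "\<i> * \<phi> c"] by (simp add: norm_mult)
  ultimately show ?thesis by simp
qed

lemma trace_bound: "a \<in> M \<Longrightarrow> cmod (\<tau> a) \<le> 2 * norm a"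
  using positive_functional_bound[OF trace_linear trace_pos] by simp

text \<open>The contractions \<open>u\<close> approximate the partial isometry of the polar decomposition of \<open>b\<close>.\<close>

lemma approximate_polar_decomposition:
  assumes b: "b \<in> M" and e: "e > 0"
  obtains u q where "u \<in> M" "norm u \<le> 1" "adj_op u \<in> M" "norm (adj_op u) \<le> 1"
    "b = (u o\<^sub>L abs_op b) + e *\<^sub>R u"
    "q \<in> M" "norm (q o\<^sub>L abs_op b) \<le> 1" "abs_op b = (adj_op u o\<^sub>L b) + e *\<^sub>R (q o\<^sub>L abs_op b)"
proof -
  note bb = M_bounded_ops[OF b]
  define p where "p = abs_op b"
  have p: "pos_op p" "p \<in> M" and pp: "p o\<^sub>L p = adj_op b o\<^sub>L b"
    unfolding p_def by (rule abs_op[OF bb] M_abs[OF b])+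
  obtain q where q: "q \<in> bounded_ops" "(p + e *\<^sub>R id_blinfun) o\<^sub>L q = id_blinfun"
    "q o\<^sub>L (p + e *\<^sub>R id_blinfun) = id_blinfun"
    by (rule pos_op_add_id_invertible[OF p(1) e])
  have qM: "q \<in> M" by (rule M_inverse[OF _ q]) (intro M_add M_scaleR p M_id)
  have qx: "x = blinfun_apply p (blinfun_apply q x) + e *\<^sub>R blinfun_apply q x" for x
    using arg_cong[OF q(2), of "\<lambda>a. blinfun_apply a x"] by (simp add: blinfun.bilinear_simps)
  have p_sa: "cinner (blinfun_apply p x) y = cinner x (blinfun_apply p y)" for x y
    by (rule pos_op_selfadjoint[OF p(1)])
  have q_sa: "cinner (blinfun_apply q x) y = cinner x (blinfun_apply q y)" for x y
  proof -
    have "cinner (blinfun_apply q x) (blinfun_apply p (blinfun_apply q y) + e *\<^sub>R blinfun_apply q y) =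
        cinner (blinfun_apply p (blinfun_apply q x) + e *\<^sub>R blinfun_apply q x) (blinfun_apply q y)"
      by (simp add: cinner_simps p_sa)
    then show ?thesis by (simp only: qx[symmetric])
  qed
  \<comment> \<open>With y = q x, x = p y + e y, and <y, p y> >= 0 makes all terms of the expanded
    |x|^2 nonnegative, so |p y| <= |x|.\<close>
  have contr: "norm (blinfun_apply p (blinfun_apply q x)) \<le> norm x" for x
  proof -
    let ?y = "blinfun_apply q x"
    have "(norm x)\<^sup>2 = (norm (blinfun_apply p ?y + e *\<^sub>R ?y))\<^sup>2"
      by (subst qx) (rule refl)
    also have "\<dots> = (norm (blinfun_apply p ?y))\<^sup>2 + (e * norm ?y)\<^sup>2 + 2 * e * Re (cinner ?y (blinfun_apply p ?y))"
      using e by (simp add: norm_add_sq cinner_scaleR_right p_sa)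
    finally have "(norm (blinfun_apply p ?y))\<^sup>2 \<le> (norm x)\<^sup>2"
      using pos_opD(3)[OF p(1), of ?y] e by simp
    then show ?thesis by (rule power2_le_imp_le) simp
  qed
  define u where "u = b o\<^sub>L q"
  have uM: "u \<in> M" unfolding u_def by (rule M_comp[OF b qM])
  \<comment> \<open>|b y| = |p y| because \<open>b\<close> and \<open>p\<close> have the same square
    \<open>adj_op b o\<^sub>L b\<close>, so the contraction bound for \<open>p q\<close> passes to
    \<open>u = b q\<close>.\<close>
  have u_norm: "norm u \<le> 1"
  proof (rule norm_blinfun_bound)
    fix x
    let ?y = "blinfun_apply q x"
    have "complex_of_real ((norm (blinfun_apply u x))\<^sup>2) = cinner ?y (blinfun_apply (adj_op b o\<^sub>L b) ?y)"
      by (simp add: u_def adj_op[OF bb] cinner_self)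
    also have "\<dots> = complex_of_real ((norm (blinfun_apply p ?y))\<^sup>2)"
      by (simp add: pp[symmetric] p_sa[symmetric] cinner_self)
    finally have "(norm (blinfun_apply u x))\<^sup>2 = (norm (blinfun_apply p ?y))\<^sup>2"
      by (simp only: of_real_eq_iff)
    then have "norm (blinfun_apply u x) = norm (blinfun_apply p ?y)" by simp
    then show "norm (blinfun_apply u x) \<le> 1 * norm x" using contr[of x] by simp
  qed simp
  have adj_u: "adj_op u = q o\<^sub>L adj_op b"
    by (rule adj_op_unique) (simp add: u_def q_sa adj_op[OF bb])
  have pq: "p o\<^sub>L q = q o\<^sub>L p"
  proof -
    have "(p o\<^sub>L q) + e *\<^sub>R q = (q o\<^sub>L p) + e *\<^sub>R q"
      using q(2,3) by (simp add: comp_simps)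
    then show ?thesis by simp
  qed
  \<comment> \<open>Both decompositions come from q (p + e) = 1: multiply by \<open>b\<close> on the
    left, respectively by \<open>p\<close> on the right, and use p^2 = b* b.\<close>
  show thesis
  proof (rule that[of u q])
    show "norm (adj_op u) \<le> 1" using adj_op(2)[OF M_bounded_ops[OF uM]] u_norm by simp
    show "b = (u o\<^sub>L abs_op b) + e *\<^sub>R u"
      using arg_cong[OF q(3), of "\<lambda>a. b o\<^sub>L a"] by (simp add: u_def comp_simps flip: p_def)
    show "norm (q o\<^sub>L abs_op b) \<le> 1"
      unfolding p_def[symmetric] pq[symmetric] by (rule norm_blinfun_bound) (use contr in auto)
    show "abs_op b = (adj_op u o\<^sub>L b) + e *\<^sub>R (q o\<^sub>L abs_op b)"
      using arg_cong[OF q(3), of "\<lambda>a. a o\<^sub>L p"]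
      by (simp add: adj_u comp_simps flip: p_def pp)
  qed (use uM u_norm qM M_adj in auto)
qed

section \<open>Duality between the 1-norm and \<open>M\<close> on the dense subspace\<close>

lemma norm_iota: "b \<in> M \<Longrightarrow> complex_of_real (norm (\<iota> b)) = \<tau> (abs_op b)"
  using completion by (simp add: L1_completion_def)

lemma iota_add: "a \<in> M \<Longrightarrow> b \<in> M \<Longrightarrow> \<iota> (a + b) = \<iota> a + \<iota> b"
  using completion by (simp add: L1_completion_def)

lemma iota_scale_op: "a \<in> M \<Longrightarrow> \<iota> (scale_op c a) = c *\<^sub>C \<iota> a"
  using completion by (simp add: L1_completion_def)

lemma iota_diff:
  assumes "a \<in> M" "b \<in> M"
  shows "\<iota> (a - b) = \<iota> a - \<iota> b"
  using iota_add[of "a - b" b] assms by (simp add: M_diff)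

lemma iota_dense: "\<exists>b. (\<forall>n. b n \<in> M) \<and> (\<lambda>n. \<iota> (b n)) \<longlonglongrightarrow> x"
proof -
  have "x \<in> closure (\<iota> ` M)" using completion by (simp add: L1_completion_def)
  then obtain y where y: "\<forall>n. y n \<in> \<iota> ` M" "y \<longlonglongrightarrow> x" by (auto simp: closure_sequential)
  have "\<forall>n. \<exists>b. b \<in> M \<and> y n = \<iota> b" using y(1) by blast
  then obtain b where b: "\<forall>n. b n \<in> M \<and> y n = \<iota> (b n)" by (rule choice[THEN exE])
  with y(2) have "(\<lambda>n. \<iota> (b n)) \<longlonglongrightarrow> x" by (simp flip: b)
  with b show ?thesis by blast
qed

text \<open>Replace \<open>b\<close> by u |b| and factor |b| = s^2. By traciality \<tau>(u s s a) =
  \<tau>(s a u s), and c \<mapsto> \<tau>(s c s) is a positive functional whose value at the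
  identity is \<tau>(|b|), the norm of \<open>\<iota> b\<close>.\<close>

lemma trace_comp_bound:
  assumes a: "a \<in> M" and b: "b \<in> M"
  shows "cmod (\<tau> (b o\<^sub>L a)) \<le> 2 * norm a * norm (\<iota> b)"
proof (rule field_le_epsilon)
  fix e :: real assume e: "e > 0"
  \<comment> \<open>Chosen so that the polar error \<open>d * (2 * norm a)\<close> is at most
    \<open>e\<close>; the summand 1 avoids division by 0.\<close>
  define d where "d = e / (2 * norm a + 1)"
  have d: "d > 0" using e by (simp add: d_def add_nonneg_pos)
  obtain u where u: "u \<in> M" "norm u \<le> 1" "b = (u o\<^sub>L abs_op b) + d *\<^sub>R u"
    by (rule approximate_polar_decomposition[OF b d])
  let ?p = "abs_op b"
  have p: "?p \<in> M" "pos_op ?p" using M_abs[OF b] abs_op(1)[OF M_bounded_ops[OF b]] .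
  obtain s where s: "s \<in> M" "pos_op s" "s o\<^sub>L s = ?p" using M_sqrt[OF p] by blast
  have au: "norm (a o\<^sub>L u) \<le> norm a"
    using norm_blinfun_compose[of a u] mult_left_mono[OF u(2), of "norm a"] by simp
  have "cmod (\<tau> (s o\<^sub>L ((a o\<^sub>L u) o\<^sub>L s))) \<le> 2 * norm (a o\<^sub>L u) * Re (\<tau> (s o\<^sub>L (id_blinfun o\<^sub>L s)))"
  proof (rule positive_functional_bound)
    show "linear_functional_on M (\<lambda>c. \<tau> (s o\<^sub>L (c o\<^sub>L s)))"
      unfolding linear_functional_on_def
    proof (intro conjI ballI allI)
      fix c x assume x: "x \<in> M"
      have "s o\<^sub>L (scale_op c x o\<^sub>L s) = scale_op c (s o\<^sub>L (x o\<^sub>L s))"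
        by (rule blinfun_eqI) (simp add: bounded_ops_scaleC M_bounded_ops s)
      then show "\<tau> (s o\<^sub>L (scale_op c x o\<^sub>L s)) = c * \<tau> (s o\<^sub>L (x o\<^sub>L s))"
        using x by (simp add: trace_simps M_comp s)
    qed (simp add: comp_simps(1,2) trace_simps M_comp s)
    show "\<tau> (s o\<^sub>L (x o\<^sub>L s)) \<in> nonneg_Reals" if "x \<in> M" "pos_op x" for x
      by (intro trace_pos M_comp s that pos_op_sandwich) (use s in \<open>simp add: pos_op_iff\<close>)
  qed (intro M_comp a u)
  also have "\<dots> = 2 * norm (a o\<^sub>L u) * norm (\<iota> b)"
    by (simp add: s flip: norm_iota[OF b])
  also have "\<dots> \<le> 2 * norm a * norm (\<iota> b)" using au by (intro mult_right_mono) auto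
  also have "\<tau> (s o\<^sub>L ((a o\<^sub>L u) o\<^sub>L s)) = \<tau> (((a o\<^sub>L u) o\<^sub>L s) o\<^sub>L s)"
    by (intro trace_commute M_comp a u s)
  also have "((a o\<^sub>L u) o\<^sub>L s) o\<^sub>L s = a o\<^sub>L (u o\<^sub>L ?p)"
    by (simp only: blinfun_compose_assoc s)
  also have "\<tau> \<dots> = \<tau> ((u o\<^sub>L ?p) o\<^sub>L a)" by (intro trace_commute M_comp a u p)
  finally have 1: "cmod (\<tau> ((u o\<^sub>L ?p) o\<^sub>L a)) \<le> 2 * norm a * norm (\<iota> b)" .
  have "norm (u o\<^sub>L a) \<le> norm a"
    using norm_blinfun_compose[of u a] mult_right_mono[OF u(2), of "norm a"] by simp
  then have 2: "cmod (\<tau> (u o\<^sub>L a)) \<le> 2 * norm a" using trace_bound[OF M_comp[OF u(1) a]] by simp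
  have "b o\<^sub>L a = ((u o\<^sub>L ?p) o\<^sub>L a) + d *\<^sub>R (u o\<^sub>L a)"
    by (subst u(3)) (simp only: comp_simps(1,7))
  then have "\<tau> (b o\<^sub>L a) = \<tau> ((u o\<^sub>L ?p) o\<^sub>L a) + d *\<^sub>R \<tau> (u o\<^sub>L a)"
    by (simp add: trace_simps M_comp M_scaleR u(1) p a)
  then have "cmod (\<tau> (b o\<^sub>L a)) \<le> cmod (\<tau> ((u o\<^sub>L ?p) o\<^sub>L a)) + d * cmod (\<tau> (u o\<^sub>L a))"
    using norm_triangle_ineq[of "\<tau> ((u o\<^sub>L ?p) o\<^sub>L a)" "d *\<^sub>R \<tau> (u o\<^sub>L a)"] d by simp
  also have "\<dots> \<le> 2 * norm a * norm (\<iota> b) + d * (2 * norm a)"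
    by (intro add_mono mult_left_mono 1 2) (use d in simp)
  also have "d * (2 * norm a) \<le> e"
    using e by (simp add: d_def divide_simps add_nonneg_pos mult_left_mono)
  finally show "cmod (\<tau> (b o\<^sub>L a)) \<le> 2 * norm a * norm (\<iota> b) + e" by simp
qed

lemma norm_iota_attained:
  assumes b: "b \<in> M" and e: "e > 0"
  shows "\<exists>a\<in>M. norm a \<le> 1 \<and> norm (\<iota> b) \<le> cmod (\<tau> (b o\<^sub>L a)) + e"
proof -
  obtain u q where u: "adj_op u \<in> M" "norm (adj_op u) \<le> 1" and q: "q \<in> M" "norm (q o\<^sub>L abs_op b) \<le> 1"
    and eq: "abs_op b = (adj_op u o\<^sub>L b) + (e / 2) *\<^sub>R (q o\<^sub>L abs_op b)"
    by (rule approximate_polar_decomposition[OF b half_gt_zero[OF e]])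
  have "complex_of_real (norm (\<iota> b)) = \<tau> (abs_op b)" by (rule norm_iota[OF b])
  also have "\<dots> = \<tau> (adj_op u o\<^sub>L b) + (e / 2) *\<^sub>R \<tau> (q o\<^sub>L abs_op b)"
    by (subst eq) (simp add: trace_simps M_comp M_scaleR M_abs u q b)
  also have "\<tau> (adj_op u o\<^sub>L b) = \<tau> (b o\<^sub>L adj_op u)" by (intro trace_commute u b)
  finally have "norm (\<iota> b) = cmod (\<tau> (b o\<^sub>L adj_op u) + (e / 2) *\<^sub>R \<tau> (q o\<^sub>L abs_op b))"
    by (metis norm_of_real abs_norm_cancel)
  also have "\<dots> \<le> cmod (\<tau> (b o\<^sub>L adj_op u)) + (e / 2) * cmod (\<tau> (q o\<^sub>L abs_op b))"
    using norm_triangle_ineq[of "\<tau> (b o\<^sub>L adj_op u)" "(e / 2) *\<^sub>R \<tau> (q o\<^sub>L abs_op b)"] e by simp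
  also have "cmod (\<tau> (q o\<^sub>L abs_op b)) \<le> 2"
    using trace_bound[OF M_comp[OF q(1) M_abs[OF b]]] q(2) by simp
  finally have "norm (\<iota> b) \<le> cmod (\<tau> (b o\<^sub>L adj_op u)) + e" using e by simp
  with u show ?thesis by blast
qed

section \<open>Extension of the pairing to the completion\<close>

abbreviation "pair \<equiv> L1_pair M \<tau> \<iota>"
abbreviation "tr \<equiv> L1_trace M \<tau> \<iota>"
abbreviation "pos_cone \<equiv> L1_pos M \<tau> \<iota>"
abbreviation "states \<equiv> L1_states M \<tau> \<iota>"

text \<open>On the range of \<open>\<iota>\<close> the functional is defined through an arbitrary
  preimage. The Lipschitz bound from \<open>trace_comp_bound\<close> makes the choice irrelevant and
  allows extension to the closure.\<close>

lemma pair_extension_exists: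
  assumes a: "a \<in> M"
  shows "\<exists>f. continuous_on UNIV f \<and> (\<forall>b\<in>M. f (\<iota> b) = \<tau> (b o\<^sub>L a))"
proof -
  define g where "g y = \<tau> ((SOME b. b \<in> M \<and> \<iota> b = y) o\<^sub>L a)" for y
  have diff: "cmod (\<tau> (b o\<^sub>L a) - \<tau> (c o\<^sub>L a)) \<le> 2 * norm a * norm (\<iota> b - \<iota> c)" if "b \<in> M" "c \<in> M" for b c
    using trace_comp_bound[OF a M_diff[OF that]] that
    by (simp add: comp_simps(3) trace_simps M_comp a iota_diff)
  have g: "g (\<iota> b) = \<tau> (b o\<^sub>L a)" if b: "b \<in> M" for b
  proof -
    define c where "c = (SOME c. c \<in> M \<and> \<iota> c = \<iota> b)"
    have "c \<in> M \<and> \<iota> c = \<iota> b" unfolding c_def by (rule someI[of _ b]) (use b in simp)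
    with diff[of c b] b show ?thesis unfolding g_def c_def[symmetric] by simp
  qed
  have "uniformly_continuous_on (\<iota> ` M) g"
    unfolding uniformly_continuous_on_def
  proof (intro allI impI)
    fix e :: real assume e: "e > 0"
    have K: "2 * norm a + 1 > 0" by (simp add: add_nonneg_pos)
    show "\<exists>d>0. \<forall>x\<in>\<iota> ` M. \<forall>x'\<in>\<iota> ` M. dist x' x < d \<longrightarrow> dist (g x') (g x) < e"
    proof (intro exI[of _ "e / (2 * norm a + 1)"] conjI ballI impI)
      fix x x' assume "x \<in> \<iota> ` M" "x' \<in> \<iota> ` M" and d: "dist x' x < e / (2 * norm a + 1)"
      then have "dist (g x') (g x) \<le> 2 * norm a * dist x' x"
        using diff by (auto simp: g dist_norm)
      also have "\<dots> \<le> (2 * norm a + 1) * dist x' x" by (intro mult_right_mono) auto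
      also have "\<dots> < e" using d K by (simp add: pos_less_divide_eq mult.commute)
      finally show "dist (g x') (g x) < e" .
    qed (use e K in simp)
  qed
  then obtain f where "uniformly_continuous_on (closure (\<iota> ` M)) f" "\<And>x. x \<in> \<iota> ` M \<Longrightarrow> g x = f x"
    by (rule uniformly_continuous_on_extension_on_closure) (rule that, assumption+)
  then show ?thesis
    using completion g uniformly_continuous_imp_continuous[of UNIV f] by (auto simp: L1_completion_def)
qed

text \<open>Two continuous functions that agree on the dense range of \<open>\<iota>\<close> are
  equal, which gives the definite description in \<open>L1_pair\<close> its meaning.\<close>

lemma pair:
  assumes a: "a \<in> M"
  shows "continuous_on UNIV (\<lambda>x. pair x a)" "b \<in> M \<Longrightarrow> pair (\<iota> b) a = \<tau> (b o\<^sub>L a)"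
proof -
  let ?P = "\<lambda>f. continuous_on UNIV f \<and> (\<forall>b\<in>M. f (\<iota> b) = \<tau> (b o\<^sub>L a))"
  obtain f where f: "?P f" using pair_extension_exists[OF a] by blast
  have uniq: "g = f" if g: "?P g" for g
  proof
    fix x
    obtain b where b: "\<forall>n. b n \<in> M" "(\<lambda>n. \<iota> (b n)) \<longlonglongrightarrow> x" using iota_dense by blast
    have "(\<lambda>n. g (\<iota> (b n))) \<longlonglongrightarrow> g x" "(\<lambda>n. f (\<iota> (b n))) \<longlonglongrightarrow> f x"
      using continuous_on_tendsto_compose[OF conjunct1[OF g] b(2)]
        continuous_on_tendsto_compose[OF conjunct1[OF f] b(2)] by simp_all
    moreover have "g (\<iota> (b n)) = f (\<iota> (b n))" for n using f g b(1) by simp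
    ultimately show "g x = f x" by (simp add: LIMSEQ_unique)
  qed
  have "(THE f. ?P f) = f" by (rule the_equality[where P = ?P, OF f uniq])
  then have "(\<lambda>x. pair x a) = f" unfolding L1_pair_def by simp
  with f show "continuous_on UNIV (\<lambda>x. pair x a)" "b \<in> M \<Longrightarrow> pair (\<iota> b) a = \<tau> (b o\<^sub>L a)"
    by (auto simp: fun_eq_iff)
qed

lemma pair_tendsto:
  assumes "a \<in> M" "(f \<longlongrightarrow> x) F"
  shows "((\<lambda>n. pair (f n) a) \<longlongrightarrow> pair x a) F"
  using continuous_on_tendsto_compose[OF pair(1)[OF assms(1)] assms(2)] by simp

lemma pair_linear:
  assumes a: "a \<in> M"
  shows "pair (x + y) a = pair x a + pair y a" "pair (c *\<^sub>C x) a = c * pair x a"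
    "cmod (pair x a) \<le> 2 * norm a * norm x"
proof -
  obtain b where b: "\<forall>n. b n \<in> M" "(\<lambda>n. \<iota> (b n)) \<longlonglongrightarrow> x" using iota_dense by blast
  obtain d where d: "\<forall>n. d n \<in> M" "(\<lambda>n. \<iota> (d n)) \<longlonglongrightarrow> y" using iota_dense by blast
  note lim = pair_tendsto[OF a]
  show "pair (x + y) a = pair x a + pair y a"
  proof (rule LIMSEQ_unique)
    show "(\<lambda>n. pair (\<iota> (b n) + \<iota> (d n)) a) \<longlonglongrightarrow> pair (x + y) a" by (intro lim tendsto_intros b d)
    have "pair (\<iota> (b n) + \<iota> (d n)) a = pair (\<iota> (b n)) a + pair (\<iota> (d n)) a" for n
      using b(1) d(1) a
      by (simp add: pair(2) comp_simps(1) trace_simps M_comp M_add flip: iota_add)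
    then show "(\<lambda>n. pair (\<iota> (b n) + \<iota> (d n)) a) \<longlonglongrightarrow> pair x a + pair y a"
      by (simp only:) (intro lim tendsto_intros b d)
  qed
  show "pair (c *\<^sub>C x) a = c * pair x a"
  proof (rule LIMSEQ_unique)
    show "(\<lambda>n. pair (c *\<^sub>C \<iota> (b n)) a) \<longlonglongrightarrow> pair (c *\<^sub>C x) a"
      by (intro lim bounded_linear.tendsto[OF bounded_linear_scaleC] b)
    have "pair (c *\<^sub>C \<iota> (b n)) a = c * pair (\<iota> (b n)) a" for n
    proof -
      have "scale_op c (b n) o\<^sub>L a = scale_op c (b n o\<^sub>L a)" by (rule blinfun_eqI) simp
      then show ?thesis
        using b(1) a by (simp add: pair(2) trace_simps M_comp M_scale_op flip: iota_scale_op)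
    qed
    then show "(\<lambda>n. pair (c *\<^sub>C \<iota> (b n)) a) \<longlonglongrightarrow> c * pair x a"
      by (simp only:) (intro lim tendsto_intros b)
  qed
  show "cmod (pair x a) \<le> 2 * norm a * norm x"
  proof (rule LIMSEQ_le)
    show "(\<lambda>n. cmod (pair (\<iota> (b n)) a)) \<longlonglongrightarrow> cmod (pair x a)" by (intro tendsto_intros lim b)
    show "(\<lambda>n. 2 * norm a * norm (\<iota> (b n))) \<longlonglongrightarrow> 2 * norm a * norm x" by (intro tendsto_intros b)
    show "\<exists>N. \<forall>n\<ge>N. cmod (pair (\<iota> (b n)) a) \<le> 2 * norm a * norm (\<iota> (b n))"
      using trace_comp_bound[OF a] b(1) by (simp add: pair(2)[OF a])
  qed
qed

lemma pair_scaleR: "a \<in> M \<Longrightarrow> pair (r *\<^sub>R x) a = r *\<^sub>R pair x a"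
  by (simp add: scaleR_scaleC pair_linear(2) scaleR_conv_of_real)

lemma pair_diff: "a \<in> M \<Longrightarrow> pair (x - y) a = pair x a - pair y a"
  using pair_linear(1)[of a x "(-1) *\<^sub>R y"] pair_scaleR[of a "-1" y] by simp

lemma pair_linear_functional: "linear_functional_on M (pair x)"
  unfolding linear_functional_on_def
proof (intro conjI ballI allI)
  obtain b where b: "\<forall>n. b n \<in> M" "(\<lambda>n. \<iota> (b n)) \<longlonglongrightarrow> x" using iota_dense by blast
  show "pair x (a + d) = pair x a + pair x d" if a: "a \<in> M" and d: "d \<in> M" for a d
  proof (rule LIMSEQ_unique)
    show "(\<lambda>n. pair (\<iota> (b n)) (a + d)) \<longlonglongrightarrow> pair x (a + d)" by (intro pair_tendsto M_add a d b)
    have "pair (\<iota> (b n)) (a + d) = pair (\<iota> (b n)) a + pair (\<iota> (b n)) d" for n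
      using a d b(1) by (simp add: pair(2) M_add comp_simps(2) trace_simps M_comp)
    then show "(\<lambda>n. pair (\<iota> (b n)) (a + d)) \<longlonglongrightarrow> pair x a + pair x d"
      by (simp only:) (intro tendsto_intros pair_tendsto a d b)
  qed
  show "pair x (scale_op c a) = c * pair x a" if a: "a \<in> M" for c a
  proof (rule LIMSEQ_unique)
    show "(\<lambda>n. pair (\<iota> (b n)) (scale_op c a)) \<longlonglongrightarrow> pair x (scale_op c a)"
      by (intro pair_tendsto M_scale_op a b)
    have "pair (\<iota> (b n)) (scale_op c a) = c * pair (\<iota> (b n)) a" for n
    proof -
      have bn: "b n \<in> M" using b(1) by simp
      have "b n o\<^sub>L scale_op c a = scale_op c (b n o\<^sub>L a)"
        by (rule blinfun_eqI) (simp add: bounded_ops_scaleC[OF M_bounded_ops[OF bn]])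
      then show ?thesis using a bn by (simp add: pair(2) M_scale_op trace_simps M_comp)
    qed
    then show "(\<lambda>n. pair (\<iota> (b n)) (scale_op c a)) \<longlonglongrightarrow> c * pair x a"
      by (simp only:) (intro tendsto_intros pair_tendsto a b)
  qed
qed

lemma norm_attained:
  assumes e: "e > 0"
  shows "\<exists>a\<in>M. norm a \<le> 1 \<and> norm x \<le> cmod (pair x a) + e"
proof -
  obtain b where b: "\<forall>n. b n \<in> M" "(\<lambda>n. \<iota> (b n)) \<longlonglongrightarrow> x" using iota_dense by blast
  \<comment> \<open>Replacing \<open>x\<close> by \<open>\<iota> (b n)\<close> costs the distance
    once in the norm and twice in the pairing, hence e / 6; the other e / 2 is the defect of
    \<open>a\<close>.\<close>
  obtain n where "dist (\<iota> (b n)) x < e / 6"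
    using b(2) e by (metis divide_pos_pos less_numeral_extra(1) metric_LIMSEQ_D order_refl zero_less_numeral)
  then have n: "norm (x - \<iota> (b n)) < e / 6" by (simp add: dist_norm norm_minus_commute)
  have bn: "b n \<in> M" using b(1) by simp
  obtain a where a: "a \<in> M" "norm a \<le> 1" "norm (\<iota> (b n)) \<le> cmod (\<tau> (b n o\<^sub>L a)) + e / 2"
    using norm_iota_attained[OF bn half_gt_zero[OF e]] by blast
  have "cmod (pair x a - \<tau> (b n o\<^sub>L a)) = cmod (pair (x - \<iota> (b n)) a)"
    using a bn by (simp add: pair_diff pair(2))
  also have "\<dots> \<le> 2 * norm a * norm (x - \<iota> (b n))" using a by (intro pair_linear)
  also have "\<dots> \<le> 2 * 1 * norm (x - \<iota> (b n))" using a by (intro mult_right_mono mult_left_mono) auto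
  finally have "cmod (\<tau> (b n o\<^sub>L a)) \<le> cmod (pair x a) + 2 * norm (x - \<iota> (b n))"
    using norm_triangle_ineq2[of "\<tau> (b n o\<^sub>L a)" "pair x a"] by (simp add: norm_minus_commute)
  moreover have "norm x \<le> norm (\<iota> (b n)) + norm (x - \<iota> (b n))"
    using norm_triangle_ineq[of "\<iota> (b n)" "x - \<iota> (b n)"] by simp
  ultimately have "norm x \<le> cmod (pair x a) + e" using a n by simp
  with a show ?thesis by blast
qed

section \<open>The positive cone, the trace and separability\<close>

lemma cone_iff: "x \<in> pos_cone \<longleftrightarrow> (\<forall>a\<in>M. pos_op a \<longrightarrow> pair x a \<in> nonneg_Reals)"
  by (simp add: L1_pos_def)

lemma cone_closed: "closed pos_cone"
proof -
  have "pos_cone = (\<Inter>a\<in>{a\<in>M. pos_op a}. (\<lambda>x. pair x a) -` nonneg_Reals)"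
    by (auto simp: cone_iff)
  also have "closed \<dots>"
    by (intro closed_INT ballI closed_vimage closed_nonneg_Reals_complex pair(1)) auto
  finally show ?thesis .
qed

lemma cone_add: "x \<in> pos_cone \<Longrightarrow> y \<in> pos_cone \<Longrightarrow> x + y \<in> pos_cone"
  by (auto simp: cone_iff pair_linear intro: nonneg_Reals_add_I)

lemma cone_scaleR: "x \<in> pos_cone \<Longrightarrow> 0 \<le> r \<Longrightarrow> r *\<^sub>R x \<in> pos_cone"
  by (auto simp: cone_iff pair_scaleR complex_nonneg_Reals_iff)

lemma cone_zero [simp]: "0 \<in> pos_cone"
  using pair_scaleR[of _ 0 0] by (auto simp: cone_iff)

lemma tr_linear: "tr (x + y) = tr x + tr y" "tr (c *\<^sub>C x) = c * tr x" "tr (r *\<^sub>R x) = r *\<^sub>R tr x"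
  "tr (x - y) = tr x - tr y"
  by (simp_all add: L1_trace_def pair_linear pair_scaleR pair_diff)

lemma tr_tendsto: "(f \<longlongrightarrow> x) F \<Longrightarrow> ((\<lambda>n. tr (f n)) \<longlongrightarrow> tr x) F"
  unfolding L1_trace_def by (intro pair_tendsto M_id)

lemma tr_continuous: "continuous_on UNIV tr"
  unfolding L1_trace_def using pair(1)[OF M_id] .

lemma tr_cone:
  assumes "x \<in> pos_cone"
  shows "tr x = complex_of_real (Re (tr x))" "0 \<le> Re (tr x)"
  using assms by (auto simp: cone_iff L1_trace_def complex_nonneg_Reals_iff complex_eq_iff)

text \<open>Pairing with a positive \<open>x\<close> is a positive functional on \<open>M\<close>,
  hence bounded by twice its value at the identity, which is the trace. This is the passage from
  order estimates to norm estimates.\<close>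

lemma norm_le_tr:
  assumes x: "x \<in> pos_cone"
  shows "norm x \<le> 2 * Re (tr x)"
proof (rule field_le_epsilon)
  fix e :: real assume "e > 0"
  then obtain a where a: "a \<in> M" "norm a \<le> 1" "norm x \<le> cmod (pair x a) + e"
    using norm_attained by blast
  have "cmod (pair x a) \<le> 2 * norm a * Re (pair x id_blinfun)"
    by (rule positive_functional_bound[OF pair_linear_functional _ a(1)]) (use x in \<open>simp add: cone_iff\<close>)
  also have "\<dots> \<le> 2 * 1 * Re (pair x id_blinfun)"
    using a tr_cone(2)[OF x] by (intro mult_right_mono mult_left_mono) (auto simp: L1_trace_def)
  finally show "norm x \<le> 2 * Re (tr x) + e" using a by (simp add: L1_trace_def)
qed

lemma iota_id_state: "\<iota> id_blinfun \<in> states"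
  by (auto simp: L1_states_def cone_iff L1_trace_def pair(2) intro: trace_pos)

lemma trace_comp_normal:
  assumes b: "b \<in> M"
  shows "normal_functional M (\<lambda>a. \<tau> (b o\<^sub>L a))"
  unfolding normal_functional_def
proof
  show "linear_functional_on M (\<lambda>a. \<tau> (b o\<^sub>L a))"
    using pair_linear_functional[of "\<iota> b"] b
    unfolding linear_functional_on_def by (simp add: pair(2) M_add M_scale_op)
  let ?G = "{{a \<in> M. \<phi> a \<in> U} | \<phi> U. \<phi> \<in> ultraweak_functionals \<and> open U}"
  \<comment> \<open>The zero functional makes \<open>M\<close> itself a generating set, so the
    topology lives on exactly \<open>M\<close>.\<close>
  have zero: "(\<lambda>a. \<Sum>n. cinner (0 :: 'h) (blinfun_apply a (0 :: 'h))) \<in> (ultraweak_functionals :: ('h op \<Rightarrow> complex) set)"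
    unfolding ultraweak_functionals_def
    by (rule CollectI, rule exI[of _ "\<lambda>_. 0"], rule exI[of _ "\<lambda>_. 0"]) simp
  have "M \<in> ?G"
    by (rule CollectI, intro exI[of _ UNIV] exI[of _ "\<lambda>a. \<Sum>n. cinner (0 :: 'h) (blinfun_apply a (0 :: 'h))"])
      (use zero in simp)
  then have top: "topspace (topology_generated_by ?G) = M"
    unfolding topology_generated_by_topspace by blast
  have "continuous_map (ultraweak_topology M) (ultraweak_topology M) (\<lambda>a. b o\<^sub>L a)"
    unfolding ultraweak_topology_def[of M]
  proof (rule continuous_on_generated_topo)
    fix V assume "V \<in> ?G"
    then obtain \<phi> U where V: "V = {a \<in> M. \<phi> a \<in> U}" "\<phi> \<in> ultraweak_functionals" "open U" by auto
    then obtain \<xi> \<eta> :: "nat \<Rightarrow> 'h" where \<phi>: "\<phi> = (\<lambda>a. \<Sum>n. cinner (\<eta> n) (blinfun_apply a (\<xi> n)))"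
      and sm: "summable (\<lambda>n. (norm (\<xi> n))\<^sup>2)" "summable (\<lambda>n. (norm (\<eta> n))\<^sup>2)"
      by (auto simp: ultraweak_functionals_def)
    have "(\<lambda>a. \<phi> (b o\<^sub>L a)) = (\<lambda>a. \<Sum>n. cinner (blinfun_apply (adj_op b) (\<eta> n)) (blinfun_apply a (\<xi> n)))"
      by (simp add: \<phi> adj_op[OF M_bounded_ops[OF b]])
    moreover have "summable (\<lambda>n. (norm (blinfun_apply (adj_op b) (\<eta> n)))\<^sup>2)"
    proof (rule summable_comparison_test'[OF summable_mult[OF sm(2), of "(norm (adj_op b))\<^sup>2"]])
      fix n
      have "(norm (blinfun_apply (adj_op b) (\<eta> n)))\<^sup>2 \<le> (norm (adj_op b) * norm (\<eta> n))\<^sup>2"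
        by (intro power_mono norm_blinfun) simp
      then show "norm ((norm (blinfun_apply (adj_op b) (\<eta> n)))\<^sup>2) \<le> (norm (adj_op b))\<^sup>2 * (norm (\<eta> n))\<^sup>2"
        by (simp add: power_mult_distrib)
    qed
    ultimately have "(\<lambda>a. \<phi> (b o\<^sub>L a)) \<in> ultraweak_functionals"
      unfolding ultraweak_functionals_def
      by (intro CollectI exI[of _ \<xi>] exI[of _ "\<lambda>n. blinfun_apply (adj_op b) (\<eta> n)"] conjI sm(1))
    then have "{a \<in> M. \<phi> (b o\<^sub>L a) \<in> U} \<in> ?G"
      using V(3) by (intro CollectI exI[of _ "\<lambda>a. \<phi> (b o\<^sub>L a)"] exI[of _ U] conjI refl)
    moreover have "(\<lambda>a. b o\<^sub>L a) -` V \<inter> topspace (topology_generated_by ?G) = {a \<in> M. \<phi> (b o\<^sub>L a) \<in> U}"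
      by (subst top) (use b in \<open>auto simp: V(1) M_comp\<close>)
    ultimately show "openin (topology_generated_by ?G) ((\<lambda>a. b o\<^sub>L a) -` V \<inter> topspace (topology_generated_by ?G))"
      by (simp only: topology_generated_by_Basis)
  next
    show "(\<lambda>a. b o\<^sub>L a) ` topspace (topology_generated_by ?G) \<subseteq> \<Union> ?G"
      unfolding top using M_comp[OF b] Union_upper[OF \<open>M \<in> ?G\<close>] by (meson image_subsetI subsetD)
  qed
  moreover have "continuous_map (ultraweak_topology M) euclidean \<tau>"
    using tracial by (simp add: tracial_von_neumann_algebra_def normal_functional_def)
  ultimately show "continuous_map (ultraweak_topology M) euclidean (\<lambda>a. \<tau> (b o\<^sub>L a))"
    using continuous_map_compose[of _ _ "\<lambda>a. b o\<^sub>L a" _ \<tau>] by (simp add: comp_def)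
qed

text \<open>By \<open>norm_iota_attained\<close>, closeness of functionals on the unit ball of
  \<open>M\<close> bounds the distance in L^1. The dense functionals may not come from
  \<open>M\<close>, so for each of them and each tolerance one nearby element of \<open>M\<close> is
  selected.\<close>

lemma separable:
  assumes "separable_predual M"
  shows "\<exists>D :: 'l set. countable D \<and> closure D = UNIV"
proof -
  obtain D0 where D0: "countable D0"
    and dense: "\<And>\<phi> e. normal_functional M \<phi> \<Longrightarrow> e > 0 \<Longrightarrow>
      \<exists>\<psi>\<in>D0. \<forall>a\<in>M. norm a \<le> 1 \<longrightarrow> cmod (\<phi> a - \<psi> a) \<le> e"
    using assms unfolding separable_predual_def by blast
  define near where
    "near \<psi> (n::nat) b \<longleftrightarrow> b \<in> M \<and> (\<forall>a\<in>M. norm a \<le> 1 \<longrightarrow> cmod (\<tau> (b o\<^sub>L a) - \<psi> a) \<le> 1 / Suc n)" for \<psi> n b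
  define pick where "pick = (\<lambda>(\<psi>, n). \<iota> (SOME b. near \<psi> n b))"
  define D where "D = pick ` (D0 \<times> UNIV)"
  have "x \<in> closure D" for x
    unfolding closure_approachable
  proof (intro allI impI)
    fix e :: real assume e: "e > 0"
    obtain b where b: "\<forall>n. b n \<in> M" "(\<lambda>n. \<iota> (b n)) \<longlonglongrightarrow> x" using iota_dense by blast
    obtain k where k: "dist (\<iota> (b k)) x < e / 2"
      using b(2) half_gt_zero[OF e] by (meson metric_LIMSEQ_D order_refl)
    have bk: "b k \<in> M" using b(1) by simp
    \<comment> \<open>Comparing \<open>b k\<close> and \<open>c\<close> through \<psi> costs
      \<open>1 / Suc n\<close> twice, less than e / 4; \<open>norm_iota_attained\<close> takes the
      remaining e / 4 of e / 2.\<close>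
    obtain n where n: "1 / Suc n < e / 8"
      using nat_approx_posE[of "e / 8"] e by auto
    obtain \<psi> where \<psi>: "\<psi> \<in> D0" "\<forall>a\<in>M. norm a \<le> 1 \<longrightarrow> cmod (\<tau> (b k o\<^sub>L a) - \<psi> a) \<le> 1 / Suc n"
      using dense[OF trace_comp_normal[OF bk], of "1 / Suc n"] by auto
    then have "near \<psi> n (b k)" using bk by (simp add: near_def)
    then have c: "near \<psi> n (SOME b. near \<psi> n b)" by (rule someI)
    define c where "c = (SOME b. near \<psi> n b)"
    have cM: "c \<in> M" using c by (simp add: near_def c_def)
    obtain a where a: "a \<in> M" "norm a \<le> 1"
      "norm (\<iota> (c - b k)) \<le> cmod (\<tau> ((c - b k) o\<^sub>L a)) + e / 4"
      using norm_iota_attained[OF M_diff[OF cM bk], of "e / 4"] e by auto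
    have "\<tau> ((c - b k) o\<^sub>L a) = (\<tau> (c o\<^sub>L a) - \<psi> a) - (\<tau> (b k o\<^sub>L a) - \<psi> a)"
      using a cM bk by (simp add: comp_simps(3) trace_simps M_comp)
    then have "cmod (\<tau> ((c - b k) o\<^sub>L a)) \<le> cmod (\<tau> (c o\<^sub>L a) - \<psi> a) + cmod (\<tau> (b k o\<^sub>L a) - \<psi> a)"
      by (simp only: norm_triangle_ineq4)
    also have "\<dots> \<le> 1 / Suc n + 1 / Suc n"
      using c \<psi>(2) a by (intro add_mono) (auto simp: near_def c_def)
    finally have "dist (\<iota> c) (\<iota> (b k)) < e / 2"
      using a(3) n cM bk by (simp add: dist_norm iota_diff)
    then have "dist (\<iota> c) x < e" using k dist_triangle[of "\<iota> c" x "\<iota> (b k)"] by simp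
    moreover have "\<iota> c \<in> D" using \<psi>(1) by (force simp: D_def pick_def c_def)
    ultimately show "\<exists>y\<in>D. dist y x < e" by blast
  qed
  moreover have "countable D" unfolding D_def using D0 by (intro countable_image countable_SIGMA) auto
  ultimately show ?thesis by blast
qed

end

section \<open>Hennion's metric and contraction\<close>

context L1_space
begin

section \<open>States, normalization and closeness\<close>

abbreviation rtr :: "'l \<Rightarrow> real" where "rtr x \<equiv> Re (tr x)"

lemma rtr_linear: "rtr (x + y) = rtr x + rtr y" "rtr (r *\<^sub>R x) = r * rtr x" "rtr (x - y) = rtr x - rtr y"
  by (simp_all add: tr_linear)

lemma rtr_nonneg: "x \<in> pos_cone \<Longrightarrow> 0 \<le> rtr x"
  by (rule tr_cone)

lemma rtr_pos: "x \<in> pos_cone \<Longrightarrow> x \<noteq> 0 \<Longrightarrow> 0 < rtr x"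
  using norm_le_tr[of x] by (smt (verit) zero_less_norm_iff)

lemma states_iff: "x \<in> states \<longleftrightarrow> x \<in> pos_cone \<and> rtr x = 1"
  using tr_cone(1)[of x] by (auto simp: L1_states_def)

lemma states_nonzero: "x \<in> states \<Longrightarrow> x \<noteq> 0"
  using tr_linear(3)[of 0 0] by (auto simp: states_iff)

lemma states_closed: "closed states"
proof -
  have "states = pos_cone \<inter> {x. rtr x = 1}" by (auto simp: states_iff)
  also have "closed \<dots>"
    by (intro closed_Int cone_closed closed_Collect_eq continuous_on_Re tr_continuous continuous_on_const)
  finally show ?thesis .
qed

text \<open>The projective action in real form: on the cone the trace is real, so the complex
  quotient becomes a real scaling, which fits the order.\<close>

definition normalize :: "'l \<Rightarrow> 'l" where
  "normalize x = (1 / rtr x) *\<^sub>R x"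

lemma normalize_state: "x \<in> pos_cone \<Longrightarrow> x \<noteq> 0 \<Longrightarrow> normalize x \<in> states"
  using rtr_pos[of x] by (simp add: states_iff normalize_def cone_scaleR rtr_linear)

lemma scaleR_normalize: "x \<in> pos_cone \<Longrightarrow> x \<noteq> 0 \<Longrightarrow> rtr x *\<^sub>R normalize x = x"
  using rtr_pos[of x] by (simp add: normalize_def)

definition good_map :: "('l \<Rightarrow> 'l) \<Rightarrow> bool" where
  "good_map g \<longleftrightarrow> clinear g \<and> bounded_map g \<and> positive_map M \<tau> \<iota> g \<and> faithful_map M \<tau> \<iota> g"

lemma good_mapD:
  assumes "good_map g"
  shows "bounded_linear g" "x \<in> pos_cone \<Longrightarrow> g x \<in> pos_cone" "x \<in> pos_cone \<Longrightarrow> x \<noteq> 0 \<Longrightarrow> g x \<noteq> 0"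
proof -
  obtain K where "\<forall>x. norm (g x) \<le> K * norm x" using assms by (auto simp: good_map_def bounded_map_def)
  then show "bounded_linear g"
    using assms
    by (intro bounded_linear_intro[of _ K]) (auto simp: good_map_def clinear_def scaleR_scaleC mult.commute)
qed (use assms in \<open>auto simp: good_map_def positive_map_def faithful_map_def\<close>)

lemma good_map_comp:
  assumes f: "good_map f" and g: "good_map g"
  shows "good_map (f \<circ> g)"
  unfolding good_map_def
proof (intro conjI)
  show "clinear (f \<circ> g)" using f g by (auto simp: good_map_def clinear_def)
  have "bounded_linear (\<lambda>x. f (g x))" by (rule bounded_linear_compose[OF good_mapD(1)[OF f] good_mapD(1)[OF g]])
  then obtain K where "\<forall>x. norm (f (g x)) \<le> norm x * K"
    using bounded_linear.bounded by blast
  then show "bounded_map (f \<circ> g)" by (auto simp: bounded_map_def mult.commute)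
  show "positive_map M \<tau> \<iota> (f \<circ> g)" using good_mapD(2)[OF f] good_mapD(2)[OF g]
    unfolding positive_map_def by (intro image_subsetI) (simp add: comp_def)
  show "faithful_map M \<tau> \<iota> (f \<circ> g)"
    using good_mapD(3)[OF f] good_mapD(2,3)[OF g] unfolding faithful_map_def comp_def by blast
qed

lemma proj_action_eq:
  assumes "good_map g" "x \<in> pos_cone"
  shows "proj_action M \<tau> \<iota> g x = normalize (g x)"
  unfolding proj_action_def normalize_def
  using tr_cone(1)[OF good_mapD(2)[OF assms]]
  by (subst scaleR_scaleC) (metis of_real_1 of_real_divide)

text \<open>Up to scaling of its arguments, \<open>close \<rho> x y\<close> says that \<open>m(x,y) m(y,x) \<ge> \<rho>\<close>.\<close>

definition close :: "real \<Rightarrow> 'l \<Rightarrow> 'l \<Rightarrow> bool" where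
  "close \<rho> x y \<longleftrightarrow> (\<exists>l m. 0 \<le> l \<and> 0 \<le> m \<and> \<rho> \<le> l * m \<and> x - l *\<^sub>R y \<in> pos_cone \<and> y - m *\<^sub>R x \<in> pos_cone)"

lemma closeI:
  "0 \<le> l \<Longrightarrow> 0 \<le> m \<Longrightarrow> \<rho> \<le> l * m \<Longrightarrow> x - l *\<^sub>R y \<in> pos_cone \<Longrightarrow> y - m *\<^sub>R x \<in> pos_cone \<Longrightarrow> close \<rho> x y"
  unfolding close_def by blast

lemma close_0: "x \<in> pos_cone \<Longrightarrow> y \<in> pos_cone \<Longrightarrow> close 0 x y"
  by (rule closeI[of 0 0]) auto

lemma close_map:
  assumes "close \<rho> x y" and g: "good_map g"
  shows "close \<rho> (g x) (g y)"
proof -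
  interpret g: bounded_linear g by (rule good_mapD[OF g])
  show ?thesis using assms(1) good_mapD(2)[OF g] unfolding close_def by (metis g.diff g.scaleR)
qed

lemma close_scaleR:
  assumes "close \<rho> x y" and a: "a > 0" and b: "b > 0"
  shows "close \<rho> (a *\<^sub>R x) (b *\<^sub>R y)"
proof -
  obtain l m where lm: "0 \<le> l" "0 \<le> m" "\<rho> \<le> l * m" "x - l *\<^sub>R y \<in> pos_cone" "y - m *\<^sub>R x \<in> pos_cone"
    using assms(1) by (auto simp: close_def)
  have "a *\<^sub>R x - (l * a / b) *\<^sub>R b *\<^sub>R y = a *\<^sub>R (x - l *\<^sub>R y)"
    "b *\<^sub>R y - (m * b / a) *\<^sub>R a *\<^sub>R x = b *\<^sub>R (y - m *\<^sub>R x)"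
    using a b by (simp_all add: scaleR_diff_right mult.commute)
  then show ?thesis
    using a b lm
    by (intro closeI[of "l * a / b" "m * b / a"]) (auto intro: cone_scaleR)
qed

lemma close_normalize:
  assumes "close \<rho> x y" "x \<in> pos_cone" "x \<noteq> 0" "y \<in> pos_cone" "y \<noteq> 0"
  shows "close \<rho> (normalize x) (normalize y)"
  unfolding normalize_def using assms by (intro close_scaleR) (auto intro: rtr_pos)

text \<open>The positive element (x - l y) + l (y - m x) equals (1 - l m) x; take traces.\<close>

lemma cone_product_le_1:
  assumes x: "x \<in> pos_cone" "x \<noteq> 0" and l: "0 \<le> l" and lm: "x - l *\<^sub>R y \<in> pos_cone" "y - m *\<^sub>R x \<in> pos_cone"
  shows "l * m \<le> 1"
proof -
  have "0 \<le> rtr (x - l *\<^sub>R y) + l * rtr (y - m *\<^sub>R x)"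
    by (intro add_nonneg_nonneg mult_nonneg_nonneg rtr_nonneg lm l)
  also have "\<dots> = (1 - l * m) * rtr x" by (simp add: rtr_linear algebra_simps)
  finally show ?thesis using rtr_pos[OF x] by (simp add: zero_le_mult_iff)
qed

text \<open>x - y = (x - l y) - (1 - l) y is a difference of two positive elements of trace 1 - l,
  each of norm at most 2 (1 - l). Traces also give m <= 1, so l >= l m >= \<rho>.\<close>

lemma norm_diff_le_close:
  assumes "close \<rho> x y" and x: "x \<in> states" and y: "y \<in> states"
  shows "norm (x - y) \<le> 4 * (1 - \<rho>)"
proof -
  obtain l m where lm: "0 \<le> l" "0 \<le> m" "\<rho> \<le> l * m" "x - l *\<^sub>R y \<in> pos_cone" "y - m *\<^sub>R x \<in> pos_cone"
    using assms(1) by (auto simp: close_def)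
  have l1: "l \<le> 1" and m1: "m \<le> 1"
    using rtr_nonneg[OF lm(4)] rtr_nonneg[OF lm(5)] x y by (simp_all add: states_iff rtr_linear)
  have "norm (x - y) = norm ((x - l *\<^sub>R y) - (1 - l) *\<^sub>R y)" by (simp add: algebra_simps)
  also have "\<dots> \<le> norm (x - l *\<^sub>R y) + (1 - l) * norm y"
    using l1 norm_triangle_ineq4[of "x - l *\<^sub>R y" "(1 - l) *\<^sub>R y"] by simp
  also have "\<dots> \<le> 2 * rtr (x - l *\<^sub>R y) + (1 - l) * (2 * rtr y)"
    using l1 y by (intro add_mono mult_left_mono norm_le_tr lm) (auto simp: states_iff)
  also have "\<dots> = 4 * (1 - l)" using x y by (simp add: states_iff rtr_linear)
  also have "\<dots> \<le> 4 * (1 - \<rho>)" using lm(3) mult_left_mono[OF m1 lm(1)] by simp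
  finally show ?thesis .
qed

text \<open>The comparison of the normalized images by the factor \<delta>, multiplied by both
  traces. This removes the division: the condition is homogeneous in \<open>x\<close> and
  \<open>y\<close> and closed under limits.\<close>

definition block :: "real \<Rightarrow> ('l \<Rightarrow> 'l) \<Rightarrow> bool" where
  "block \<delta> g \<longleftrightarrow> (\<forall>x\<in>pos_cone. \<forall>y\<in>pos_cone. rtr (g y) *\<^sub>R g x - (\<delta> * rtr (g x)) *\<^sub>R g y \<in> pos_cone)"

text \<open>With \<open>A = g (x - l y)\<close> and \<open>B = g (y - m x)\<close> one has
  \<open>(1 + s m) g x - (s + l) g y = A - s B\<close>, so lower bounds of \<open>A\<close> and \<open>B\<close> by each other improve
  the constants \<open>l\<close> and \<open>m\<close>.\<close>

lemma close_block:
  assumes c: "close \<rho> x y" and g: "good_map g" and b: "block \<delta> g" and \<delta>: "0 \<le> \<delta>" "\<delta> \<le> 1"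
    and x: "x \<in> pos_cone" "x \<noteq> 0" and y: "y \<in> pos_cone" "y \<noteq> 0"
  shows "close (1 - (1 - \<delta>\<^sup>2) * (1 - \<rho>)) (g x) (g y)"
proof -
  interpret g: bounded_linear g by (rule good_mapD[OF g])
  obtain l m where lm: "0 \<le> l" "0 \<le> m" "\<rho> \<le> l * m" "x - l *\<^sub>R y \<in> pos_cone" "y - m *\<^sub>R x \<in> pos_cone"
    using c by (auto simp: close_def)
  have lm1: "l * m \<le> 1" by (rule cone_product_le_1[OF x lm(1,4,5)])
  have gx: "g x \<in> pos_cone" "g x \<noteq> 0" and gy: "g y \<in> pos_cone" "g y \<noteq> 0"
    by (intro good_mapD[OF g] x y)+
  define A where "A = g (x - l *\<^sub>R y)"
  define B where "B = g (y - m *\<^sub>R x)"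
  have A: "A \<in> pos_cone" "A = g x - l *\<^sub>R g y" and B: "B \<in> pos_cone" "B = g y - m *\<^sub>R g x"
    unfolding A_def B_def by (intro good_mapD(2)[OF g] lm | simp add: g.diff g.scaleR)+
  have d1: "\<delta>\<^sup>2 \<le> 1" using \<delta> by (simp add: power_le_one)
  have "\<rho> \<le> 1" using lm lm1 by simp
  then have le1: "1 - (1 - \<delta>\<^sup>2) * (1 - \<rho>) \<le> 1" using d1 by simp
  \<comment> \<open>If \<open>A\<close> or \<open>B\<close> vanishes, the images are proportional
    and have closeness 1; otherwise the traces of both can be divided by.\<close>
  consider "A = 0" | "B = 0" | "A \<noteq> 0" "B \<noteq> 0" by blast
  then show ?thesis
  proof cases
    case 1
    then have eq: "g x = l *\<^sub>R g y" using A by simp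
    with gx have "l \<noteq> 0" by auto
    with eq le1 lm(1) show ?thesis by (intro closeI[of l "1 / l"]) auto
  next
    case 2
    then have eq: "g y = m *\<^sub>R g x" using B by simp
    with gy have "m \<noteq> 0" by auto
    with eq le1 lm(2) show ?thesis by (intro closeI[of "1 / m" m]) auto
  next
    case 3
    then have tA: "rtr A > 0" and tB: "rtr B > 0" using rtr_pos A B by auto
    \<comment> \<open>The rates at which \<open>block\<close> compares the images \<open>A\<close>
      and \<open>B\<close>, with the traces moved into the coefficients.\<close>
    define s where "s = \<delta> * rtr A / rtr B"
    define t where "t = \<delta> * rtr B / rtr A"
    have s: "0 \<le> s" and t: "0 \<le> t" and st: "s * t = \<delta>\<^sup>2"
      using tA tB \<delta> by (auto simp: s_def t_def power2_eq_square)
    have "(1 / rtr B) *\<^sub>R (rtr B *\<^sub>R A - (\<delta> * rtr A) *\<^sub>R B) \<in> pos_cone"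
      using b lm tB unfolding block_def A_def B_def by (intro cone_scaleR) auto
    then have sB: "A - s *\<^sub>R B \<in> pos_cone" using tB by (simp add: s_def scaleR_diff_right)
    have "(1 / rtr A) *\<^sub>R (rtr A *\<^sub>R B - (\<delta> * rtr B) *\<^sub>R A) \<in> pos_cone"
      using b lm tA unfolding block_def A_def B_def by (intro cone_scaleR) auto
    then have tA': "B - t *\<^sub>R A \<in> pos_cone" using tA by (simp add: t_def scaleR_diff_right)
    have p: "1 + s * m > 0" "1 + t * l > 0" using s t lm by (auto intro: add_pos_nonneg)
    have "(1 / (1 + s * m)) *\<^sub>R (A - s *\<^sub>R B) = g x - ((s + l) / (1 + s * m)) *\<^sub>R g y"
    proof -
      have "A - s *\<^sub>R B = (1 + s * m) *\<^sub>R g x - (s + l) *\<^sub>R g y"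
        by (simp add: A(2) B(2) algebra_simps)
      then show ?thesis using p by (simp add: scaleR_diff_right)
    qed
    then have 1: "g x - ((s + l) / (1 + s * m)) *\<^sub>R g y \<in> pos_cone"
      using cone_scaleR[OF sB, of "1 / (1 + s * m)"] p by simp
    have "(1 / (1 + t * l)) *\<^sub>R (B - t *\<^sub>R A) = g y - ((t + m) / (1 + t * l)) *\<^sub>R g x"
    proof -
      have "B - t *\<^sub>R A = (1 + t * l) *\<^sub>R g y - (t + m) *\<^sub>R g x"
        by (simp add: A(2) B(2) algebra_simps)
      then show ?thesis using p by (simp add: scaleR_diff_right)
    qed
    then have 2: "g y - ((t + m) / (1 + t * l)) *\<^sub>R g x \<in> pos_cone"
      using cone_scaleR[OF tA', of "1 / (1 + t * l)"] p by simp
    show ?thesis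
    proof (rule closeI[OF _ _ _ 1 2])
      let ?N = "(1 + s * m) * (1 + t * l)"
      have N: "1 \<le> ?N" using s t lm by (simp add: algebra_simps)
      have "?N - (s + l) * (t + m) = (1 - s * t) * (1 - l * m)" by (simp add: algebra_simps)
      moreover have "1 - (s + l) / (1 + s * m) * ((t + m) / (1 + t * l)) = (?N - (s + l) * (t + m)) / ?N"
        using p by (simp only: times_divide_times_eq diff_divide_distrib) simp
      ultimately have "1 - (s + l) / (1 + s * m) * ((t + m) / (1 + t * l)) = (1 - \<delta>\<^sup>2) * (1 - l * m) / ?N"
        by (simp only: st)
      also have "\<dots> \<le> (1 - \<delta>\<^sup>2) * (1 - l * m) / 1"
        using N d1 lm1 by (intro divide_left_mono) auto
      also have "\<dots> \<le> (1 - \<delta>\<^sup>2) * (1 - \<rho>)" using d1 lm(3) by (simp add: mult_left_mono)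
      finally show "1 - (1 - \<delta>\<^sup>2) * (1 - \<rho>) \<le> (s + l) / (1 + s * m) * ((t + m) / (1 + t * l))" by simp
    qed (use s t lm p in auto)
  qed
qed

section \<open>From Hennion's contraction constant to blocks\<close>

abbreviation "hmin \<equiv> hennion_m M \<tau> \<iota>"
abbreviation "hdist \<equiv> hennion_dist M \<tau> \<iota>"
abbreviation "hconst \<equiv> hennion_const M \<tau> \<iota>"
abbreviation "pact \<equiv> proj_action M \<tau> \<iota>"

text \<open>The maximum exists: the admissible \<open>r\<close> form a closed set because the cone
  is closed, it contains 0, and traces bound it by 1.\<close>

lemma hennion_m:
  assumes x: "x \<in> states" and y: "y \<in> states"
  shows "x - hmin x y *\<^sub>R y \<in> pos_cone" "\<And>r. x - r *\<^sub>R y \<in> pos_cone \<Longrightarrow> r \<le> hmin x y" "0 \<le> hmin x y" "hmin x y \<le> 1"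
proof -
  define R where "R = {r. x - r *\<^sub>R y \<in> pos_cone}"
  have R1: "r \<le> 1" if "r \<in> R" for r
    using rtr_nonneg[of "x - r *\<^sub>R y"] that x y by (simp add: R_def rtr_linear states_iff)
  have R0: "0 \<in> R" using x by (simp add: R_def states_iff)
  have "closed R"
  proof -
    have "R = (\<lambda>r. x - r *\<^sub>R y) -` pos_cone" by (auto simp: R_def)
    then show ?thesis by (auto intro!: closed_vimage cone_closed continuous_intros)
  qed
  moreover have bdd: "bdd_above R" using R1 by (rule bdd_aboveI)
  ultimately have S: "Sup R \<in> R" using R0 by (intro closed_contains_Sup) auto
  have eq: "hmin x y = Sup R"
    unfolding hennion_m_def L1_le_def
    using S cSup_upper[OF _ bdd] by (intro Greatest_equality) (auto simp: R_def)
  show "x - hmin x y *\<^sub>R y \<in> pos_cone" using S by (simp add: eq R_def)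
  show "r \<le> hmin x y" if "x - r *\<^sub>R y \<in> pos_cone" for r
    using cSup_upper[OF _ bdd, of r] that by (simp add: eq R_def)
  show "0 \<le> hmin x y" using cSup_upper[OF R0 bdd] by (simp add: eq)
  show "hmin x y \<le> 1" using R1[OF S] by (simp add: eq)
qed

lemma hennion_product_bounds:
  assumes "x \<in> states" "y \<in> states"
  shows "0 \<le> hmin x y * hmin y x" "hmin x y * hmin y x \<le> 1"
  using hennion_m[OF assms] hennion_m[OF assms(2,1)] by (auto intro: mult_le_one)

lemma close_hennion: "x \<in> states \<Longrightarrow> y \<in> states \<Longrightarrow> close (hmin x y * hmin y x) x y"
  by (rule closeI[of "hmin x y" "hmin y x"]) (auto simp: hennion_m)

lemma hennion_product_ge:
  assumes c: "close \<rho> x y" and xy: "x \<in> states" "y \<in> states"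
  shows "\<rho> \<le> hmin x y * hmin y x"
proof -
  obtain l m where lm: "0 \<le> l" "0 \<le> m" "\<rho> \<le> l * m" "x - l *\<^sub>R y \<in> pos_cone" "y - m *\<^sub>R x \<in> pos_cone"
    using c by (auto simp: close_def)
  note lm(3)
  also have "l * m \<le> hmin x y * hmin y x"
    using lm hennion_m[OF xy] hennion_m[OF xy(2,1)] by (intro mult_mono) auto
  finally show ?thesis .
qed

text \<open>The map q \<mapsto> (1 - q) / (1 + q) is a decreasing involution, so an upper bound on
  the metric is a lower bound on the product of the two maxima.\<close>

lemma cayley_le_iff:
  fixes q c :: real
  assumes "0 \<le> q" "0 \<le> c"
  shows "(1 - q) / (1 + q) \<le> c \<longleftrightarrow> (1 - c) / (1 + c) \<le> q"
  using assms by (simp add: divide_simps algebra_simps)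

text \<open>Strict positivity comes from the norm estimate: a product of maxima equal to 1 would
  force \<open>x = y\<close>.\<close>

lemma hennion_dist_bounds:
  assumes x: "x \<in> states" and y: "y \<in> states"
  shows "0 \<le> hdist x y" "hdist x y \<le> 1" "x \<noteq> y \<Longrightarrow> 0 < hdist x y"
proof -
  note q = hennion_product_bounds[OF x y]
  show "0 \<le> hdist x y" "hdist x y \<le> 1" using q by (auto simp: hennion_dist_def)
  show "0 < hdist x y" if "x \<noteq> y"
  proof -
    have "norm (x - y) \<le> 4 * (1 - hmin x y * hmin y x)"
      by (rule norm_diff_le_close[OF close_hennion[OF x y] x y])
    then have "hmin x y * hmin y x < 1" using that by (smt (verit) zero_less_norm_iff right_minus_eq)
    with q show ?thesis by (auto simp: hennion_dist_def)
  qed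
qed

lemma proj_state:
  assumes g: "good_map g" and x: "x \<in> states"
  shows "pact g x \<in> states" "pact g x = normalize (g x)"
proof -
  have "x \<in> pos_cone" "x \<noteq> 0" using x states_nonzero by (auto simp: states_iff)
  then show "pact g x \<in> states" "pact g x = normalize (g x)"
    using good_mapD[OF g] proj_action_eq[OF g] by (auto intro: normalize_state)
qed

text \<open>Positive maps preserve closeness. This bounds the ratios by 1, so the supremum defining
  \<open>hconst\<close> really is an upper bound for them.\<close>

lemma hennion_dist_proj_le:
  assumes g: "good_map g" and x: "x \<in> states" and y: "y \<in> states"
  shows "hdist (pact g x) (pact g y) \<le> hdist x y"
proof -
  let ?q = "hmin x y * hmin y x" and ?r = "hmin (pact g x) (pact g y) * hmin (pact g y) (pact g x)"
  have xy: "x \<in> pos_cone" "x \<noteq> 0" "y \<in> pos_cone" "y \<noteq> 0" using x y states_nonzero by (auto simp: states_iff)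
  have "close ?q (normalize (g x)) (normalize (g y))"
    by (intro close_normalize close_map[OF _ g] close_hennion x y good_mapD[OF g] xy)
  then have "?q \<le> ?r"
    using hennion_product_ge proj_state[OF g] x y by metis
  moreover have "0 \<le> ?q" "?q \<le> 1" by (rule hennion_product_bounds[OF x y])+
  ultimately show ?thesis
    unfolding hennion_dist_def by (intro frac_le) auto
qed

lemma hennion_dist_proj_le_const:
  assumes g: "good_map g" and x: "x \<in> states" and y: "y \<in> states" and xy: "x \<noteq> y"
  shows "hdist (pact g x) (pact g y) \<le> hconst g * hdist x y" "0 \<le> hconst g"
proof -
  let ?S = "insert 0 {hdist (pact g x) (pact g y) / hdist x y | x y. x \<in> states \<and> y \<in> states \<and> x \<noteq> y}"
  have bdd: "bdd_above ?S"
  proof (rule bdd_aboveI)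
    fix r assume "r \<in> ?S"
    then show "r \<le> 1"
      using hennion_dist_bounds hennion_dist_proj_le[OF g] by (auto simp: divide_le_eq_1)
  qed
  have "hdist (pact g x) (pact g y) / hdist x y \<le> Sup ?S"
    by (rule cSup_upper[OF _ bdd]) (use x y xy in blast)
  then show "hdist (pact g x) (pact g y) \<le> hconst g * hdist x y"
    using hennion_dist_bounds(3)[OF x y xy] unfolding hennion_const_def by (simp add: pos_divide_le_eq)
  show "0 \<le> hconst g" unfolding hennion_const_def by (rule cSup_upper[OF _ bdd]) simp
qed

text \<open>The condition scales with the traces of both arguments; a zero argument makes the whole
  expression zero.\<close>

lemma blockI_states:
  assumes g: "good_map g"
    and st: "\<And>x y. x \<in> states \<Longrightarrow> y \<in> states \<Longrightarrow> rtr (g y) *\<^sub>R g x - (\<delta> * rtr (g x)) *\<^sub>R g y \<in> pos_cone"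
  shows "block \<delta> g"
  unfolding block_def
proof (intro ballI)
  interpret g: bounded_linear g by (rule good_mapD[OF g])
  fix x y assume x: "x \<in> pos_cone" and y: "y \<in> pos_cone"
  show "rtr (g y) *\<^sub>R g x - (\<delta> * rtr (g x)) *\<^sub>R g y \<in> pos_cone"
  proof (cases "x = 0 \<or> y = 0")
    case True
    then show ?thesis using rtr_linear(2)[of 0 0] by (auto simp: g.zero)
  next
    case False
    let ?x = "normalize x" and ?y = "normalize y"
    have "(rtr x * rtr y) *\<^sub>R (rtr (g ?y) *\<^sub>R g ?x - (\<delta> * rtr (g ?x)) *\<^sub>R g ?y) \<in> pos_cone"
      using x y False by (intro cone_scaleR st normalize_state mult_nonneg_nonneg rtr_nonneg) auto
    also have "(rtr x * rtr y) *\<^sub>R (rtr (g ?y) *\<^sub>R g ?x - (\<delta> * rtr (g ?x)) *\<^sub>R g ?y) =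
        rtr (g (rtr y *\<^sub>R ?y)) *\<^sub>R g (rtr x *\<^sub>R ?x) - (\<delta> * rtr (g (rtr x *\<^sub>R ?x))) *\<^sub>R g (rtr y *\<^sub>R ?y)"
      by (simp add: g.scaleR rtr_linear scaleR_diff_right mult_ac)
    finally show ?thesis using x y False by (simp add: scaleR_normalize)
  qed
qed

text \<open>Distances of states are at most 1, so those of images are at most
  \<open>hconst g\<close>. Inverting the metric bounds the product of maxima from below, and one
  factor is at most 1. A rate of the form \<open>1 / Suc n\<close> keeps the number of events
  countable.\<close>

lemma hennion_const_imp_block:
  assumes g: "good_map g" and c: "hconst g < 1"
  shows "\<exists>n::nat. block (1 / Suc n) g"
proof -
  \<comment> \<open>The product of maxima at which the metric equals the constant. The absolute
    value keeps the denominator positive: nonnegativity of \<open>hconst g\<close> is extracted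
    below only from two distinct states, and for equal states any rate up to 1 works.\<close>
  define \<delta> where "\<delta> = (1 - \<bar>hconst g\<bar>) / (1 + \<bar>hconst g\<bar>)"
  have \<delta>: "\<delta> > 0 \<and> \<delta> \<le> 1 \<or> hconst g < 0"
    using c by (auto simp: \<delta>_def)
  then have "0 < (if hconst g < 0 then 1 else \<delta>)" by auto
  then obtain n where n: "1 / Suc n < (if hconst g < 0 then 1 else \<delta>)"
    by (rule nat_approx_posE)
  have "block (1 / Suc n) g"
  proof (rule blockI_states[OF g])
    fix x y assume x: "x \<in> states" and y: "y \<in> states"
    have gx: "rtr (g x) > 0" and gy: "rtr (g y) > 0"
      using x y states_nonzero good_mapD[OF g] by (auto simp: states_iff intro!: rtr_pos)
    show "rtr (g y) *\<^sub>R g x - (1 / Suc n * rtr (g x)) *\<^sub>R g y \<in> pos_cone"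
    proof (cases "x = y")
      case True
      have "(rtr (g x) * (1 - 1 / Suc n)) *\<^sub>R g x \<in> pos_cone"
        using x gx good_mapD(2)[OF g] by (intro cone_scaleR) (auto simp: states_iff)
      with True show ?thesis by (simp add: algebra_simps)
    next
      case False
      let ?x = "pact g x" and ?y = "pact g y"
      note st = proj_state(1)[OF g x] proj_state(1)[OF g y]
      have c0: "0 \<le> hconst g" by (rule hennion_dist_proj_le_const[OF g x y False])
      have "hdist ?x ?y \<le> hconst g * hdist x y" by (rule hennion_dist_proj_le_const[OF g x y False])
      also have "\<dots> \<le> hconst g * 1" using c0 hennion_dist_bounds[OF x y] by (intro mult_left_mono) auto
      finally have "(1 - hmin ?x ?y * hmin ?y ?x) / (1 + hmin ?x ?y * hmin ?y ?x) \<le> hconst g"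
        by (simp add: hennion_dist_def)
      then have "\<delta> \<le> hmin ?x ?y * hmin ?y ?x"
        using cayley_le_iff[OF hennion_product_bounds(1)[OF st] c0] c0 by (simp add: \<delta>_def)
      also have "\<dots> \<le> hmin ?x ?y * 1"
        using hennion_m[OF st] hennion_m[OF st(2,1)] by (intro mult_left_mono) auto
      finally have "1 / Suc n \<le> hmin ?x ?y" using n c0 by simp
      then have "(?x - hmin ?x ?y *\<^sub>R ?y) + (hmin ?x ?y - 1 / Suc n) *\<^sub>R ?y \<in> pos_cone"
        using hennion_m(1)[OF st] st by (intro cone_add cone_scaleR) (auto simp: states_iff)
      then have "?x - (1 / Suc n) *\<^sub>R ?y \<in> pos_cone" by (simp add: algebra_simps)
      then have "(rtr (g x) * rtr (g y)) *\<^sub>R (?x - (1 / Suc n) *\<^sub>R ?y) \<in> pos_cone"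
        using gx gy by (intro cone_scaleR) auto
      then show ?thesis
        using gx gy unfolding proj_state(2)[OF g x] proj_state(2)[OF g y] normalize_def
        by (simp add: scaleR_diff_right mult.commute)
    qed
  qed
  then show ?thesis by blast
qed

text \<open>The expression is continuous in both arguments and the cone is closed. With a countable
  \<open>D\<close> this makes \<open>block\<close> a measurable condition.\<close>

lemma blockI_dense:
  assumes g: "good_map g" and D: "D \<subseteq> states" "states \<subseteq> closure D"
    and st: "\<And>x y. x \<in> D \<Longrightarrow> y \<in> D \<Longrightarrow> rtr (g y) *\<^sub>R g x - (\<delta> * rtr (g x)) *\<^sub>R g y \<in> pos_cone"
  shows "block \<delta> g"
proof (rule blockI_states[OF g])
  fix x y assume "x \<in> states" "y \<in> states"
  then obtain u v where u: "\<And>n. u n \<in> D" "u \<longlonglongrightarrow> x" and v: "\<And>n. v n \<in> D" "v \<longlonglongrightarrow> y"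
    using D(2) unfolding closure_sequential subset_iff by metis
  note lim = bounded_linear.tendsto[OF good_mapD(1)[OF g]]
  have "(\<lambda>n. rtr (g (v n)) *\<^sub>R g (u n) - (\<delta> * rtr (g (u n))) *\<^sub>R g (v n)) \<longlonglongrightarrow>
      rtr (g y) *\<^sub>R g x - (\<delta> * rtr (g x)) *\<^sub>R g y"
    by (intro tendsto_intros tr_tendsto lim u v)
  then show "rtr (g y) *\<^sub>R g x - (\<delta> * rtr (g x)) *\<^sub>R g y \<in> pos_cone"
    by (rule closed_sequentially[OF cone_closed, rotated]) (intro st u v)
qed

end

section \<open>Strongly measurable functions\<close>

text \<open>Random variables here are almost sure limits, so measurability is stated for the
  completion, where a change on a null set is harmless.\<close>

lemma measurable_completion_AE_eq:
  assumes f: "f \<in> borel_measurable (completion P)" and eq: "AE \<omega> in P. f \<omega> = g \<omega>"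
  shows "g \<in> borel_measurable (completion P)"
proof (rule measurableI)
  fix A :: "'b set" assume A: "A \<in> sets borel"
  have "AE \<omega> in P. \<omega> \<in> space P" by (rule AE_space)
  with eq have "AE \<omega> in P. \<omega> \<in> f -` A \<inter> space (completion P) \<longleftrightarrow> \<omega> \<in> g -` A \<inter> space (completion P)"
    by eventually_elim auto
  then have "AE \<omega> in completion P. \<omega> \<in> f -` A \<inter> space (completion P) \<longleftrightarrow> \<omega> \<in> g -` A \<inter> space (completion P)"
    by (rule AE_completion)
  then show "g -` A \<inter> space (completion P) \<in> sets (completion P)"
    by (rule completion.in_sets_AE) (use measurable_sets[OF f A] in auto)
qed simp

lemma measurable_completion_AE_limit:
  fixes h :: "nat \<Rightarrow> 'w \<Rightarrow> real"
  assumes h: "\<And>i. h i \<in> borel_measurable (completion P)" and lim: "AE \<omega> in P. (\<lambda>i. h i \<omega>) \<longlonglongrightarrow> g \<omega>"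
  shows "g \<in> borel_measurable (completion P)"
proof (rule measurable_completion_AE_eq)
  show "(\<lambda>\<omega>. lim (\<lambda>i. h i \<omega>)) \<in> borel_measurable (completion P)"
    using h by (rule borel_measurable_lim_metric)
  show "AE \<omega> in P. lim (\<lambda>i. h i \<omega>) = g \<omega>"
    using lim by eventually_elim (rule limI)
qed

lemma random_variable_measurable:
  fixes h :: "'b::real_normed_vector \<Rightarrow> real"
  assumes f: "random_variable_in P f" and h: "continuous_on UNIV h"
  shows "(\<lambda>\<omega>. h (f \<omega>)) \<in> borel_measurable (completion P)"
proof -
  obtain s where s: "\<And>i::nat. simple_function P (s i)" "AE \<omega> in P. (\<lambda>i. s i \<omega>) \<longlonglongrightarrow> f \<omega>"
    using f by (auto simp: random_variable_in_def)
  show ?thesis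
  proof (rule measurable_completion_AE_limit)
    show "(\<lambda>\<omega>. h (s i \<omega>)) \<in> borel_measurable (completion P)" for i
      by (rule measurable_completion[OF borel_measurable_simple_function[OF simple_function_compose1[OF s(1)]]])
    show "AE \<omega> in P. (\<lambda>i. h (s i \<omega>)) \<longlonglongrightarrow> h (f \<omega>)"
      using s(2) by eventually_elim (rule continuous_on_tendsto_compose[OF h], simp_all)
  qed
qed

text \<open>A nonempty closed set is the zero set of the continuous function \<open>infdist\<close>,
  which reduces the claim to real functions.\<close>

lemma random_variable_closed_vimage:
  fixes F :: "'b::real_normed_vector set"
  assumes f: "random_variable_in P f" and F: "closed F"
  shows "{\<omega> \<in> space P. f \<omega> \<in> F} \<in> sets (completion P)"
proof (cases "F = {}")
  case False
  have "(\<lambda>\<omega>. infdist (f \<omega>) F) \<in> borel_measurable (completion P)"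
    by (intro random_variable_measurable[OF f] continuous_intros)
  then have "{\<omega> \<in> space (completion P). infdist (f \<omega>) F = 0} \<in> sets (completion P)"
    by (rule borel_measurable_eq) simp
  then show ?thesis using in_closed_iff_infdist_zero[OF F False] by simp
qed simp

text \<open>Continuity is asked only at almost all values, since normalization is singular where the
  trace vanishes.\<close>

lemma random_variable_compose:
  fixes f :: "'w \<Rightarrow> 'b::real_normed_vector" and h :: "'b \<Rightarrow> 'c::real_normed_vector"
  assumes f: "random_variable_in P f" and h: "AE \<omega> in P. isCont h (f \<omega>)"
  shows "random_variable_in P (\<lambda>\<omega>. h (f \<omega>))"
proof -
  obtain s where s: "\<And>i::nat. simple_function P (s i)" "AE \<omega> in P. (\<lambda>i. s i \<omega>) \<longlonglongrightarrow> f \<omega>"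
    using f by (auto simp: random_variable_in_def)
  have "AE \<omega> in P. (\<lambda>i. h (s i \<omega>)) \<longlonglongrightarrow> h (f \<omega>)"
    using s(2) h by eventually_elim (rule isCont_tendsto_compose)
  moreover have "simple_function P (\<lambda>\<omega>. h (s i \<omega>))" for i
    by (rule simple_function_compose1[OF s(1)])
  ultimately show ?thesis unfolding random_variable_in_def by (intro exI[of _ "\<lambda>i \<omega>. h (s i \<omega>)"]) blast
qed

lemma random_variable_Pair:
  assumes "random_variable_in P f" "random_variable_in P g"
  shows "random_variable_in P (\<lambda>\<omega>. (f \<omega>, g \<omega>))"
proof -
  obtain s where s: "\<And>i::nat. simple_function P (s i)" "AE \<omega> in P. (\<lambda>i. s i \<omega>) \<longlonglongrightarrow> f \<omega>"
    using assms by (auto simp: random_variable_in_def)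
  obtain t where t: "\<And>i::nat. simple_function P (t i)" "AE \<omega> in P. (\<lambda>i. t i \<omega>) \<longlonglongrightarrow> g \<omega>"
    using assms by (auto simp: random_variable_in_def)
  have "AE \<omega> in P. (\<lambda>i. (s i \<omega>, t i \<omega>)) \<longlonglongrightarrow> (f \<omega>, g \<omega>)"
    using s(2) t(2) by eventually_elim (rule tendsto_Pair)
  moreover have "simple_function P (\<lambda>\<omega>. (s i \<omega>, t i \<omega>))" for i by (intro simple_function_Pair s t)
  ultimately show ?thesis unfolding random_variable_in_def by (intro exI[of _ "\<lambda>i \<omega>. (s i \<omega>, t i \<omega>)"]) blast
qed

lemma random_variable_measure_preserving:
  assumes f: "random_variable_in P f" and T: "T \<in> measurable P P" "distr P P T = P"
  shows "random_variable_in P (\<lambda>\<omega>. f (T \<omega>))"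
proof -
  obtain s where s: "\<And>i::nat. simple_function P (s i)" "AE \<omega> in P. (\<lambda>i. s i \<omega>) \<longlonglongrightarrow> f \<omega>"
    using f by (auto simp: random_variable_in_def)
  have "AE \<omega> in distr P P T. (\<lambda>i. s i \<omega>) \<longlonglongrightarrow> f \<omega>" using s(2) by (simp only: T(2))
  then have "AE \<omega> in P. (\<lambda>i. s i (T \<omega>)) \<longlonglongrightarrow> f (T \<omega>)" by (rule AE_distrD[OF T(1)])
  moreover have "simple_function P (\<lambda>\<omega>. s i (T \<omega>))" for i
    by (rule simple_function_comp[OF T(1) s(1), unfolded comp_def])
  ultimately show ?thesis unfolding random_variable_in_def by (intro exI[of _ "\<lambda>i \<omega>. s i (T \<omega>)"]) blast
qed

text \<open>The simple functions pick a nearest point among the first \<open>n\<close> points of the dense sequence.\<close>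

lemma random_variable_separableI:
  fixes f :: "'w \<Rightarrow> 'b::real_normed_vector"
  assumes D: "countable D" "closure D = (UNIV :: 'b set)"
    and f: "\<And>d. (\<lambda>\<omega>. dist (f \<omega>) d) \<in> borel_measurable (completion P)"
  shows "random_variable_in P f"
proof -
  define e where "e = from_nat_into D"
  have ne: "D \<noteq> {}" using D(2) by auto
  have e: "range e = D" unfolding e_def by (rule range_from_nat_into[OF ne D(1)])
  define t where "t = rec_nat (\<lambda>\<omega>. e 0) (\<lambda>i t \<omega>. if dist (f \<omega>) (e (Suc i)) < dist (f \<omega>) (t \<omega>) then e (Suc i) else t \<omega>)"
  have t0: "t 0 = (\<lambda>\<omega>. e 0)"
    and tS: "\<And>i. t (Suc i) = (\<lambda>\<omega>. if dist (f \<omega>) (e (Suc i)) < dist (f \<omega>) (t i \<omega>) then e (Suc i) else t i \<omega>)"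
    unfolding t_def by simp_all
  have meas: "simple_function (completion P) (t i) \<and> (\<lambda>\<omega>. dist (f \<omega>) (t i \<omega>)) \<in> borel_measurable (completion P)" for i
  proof (induction i)
    case 0
    show ?case using f by (simp add: t0)
  next
    case (Suc i)
    then have [measurable]: "(\<lambda>\<omega>. dist (f \<omega>) (t i \<omega>)) \<in> borel_measurable (completion P)" by simp
    note f[measurable]
    have "{\<omega> \<in> space (completion P). dist (f \<omega>) (e (Suc i)) < dist (f \<omega>) (t i \<omega>)} \<in> sets (completion P)"
      by measurable
    then have "simple_function (completion P) (t (Suc i))"
      unfolding tS using Suc by (intro simple_function_If) auto
    moreover have "(\<lambda>\<omega>. dist (f \<omega>) (t (Suc i) \<omega>)) = (\<lambda>\<omega>. min (dist (f \<omega>) (e (Suc i))) (dist (f \<omega>) (t i \<omega>)))"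
      by (auto simp: tS fun_eq_iff)
    then have "(\<lambda>\<omega>. dist (f \<omega>) (t (Suc i) \<omega>)) \<in> borel_measurable (completion P)" by simp
    ultimately show ?case by blast
  qed
  have near: "dist (f \<omega>) (t i \<omega>) \<le> dist (f \<omega>) (e j)" if "j \<le> i" for i j \<omega>
    using that
  proof (induction i)
    case 0
    then show ?case by (simp add: t0)
  next
    case (Suc i)
    then show ?case by (cases "j = Suc i") (auto simp: tS intro: order_trans less_imp_le)
  qed
  have lim: "(\<lambda>i. t i \<omega>) \<longlonglongrightarrow> f \<omega>" for \<omega>
  proof (rule metric_LIMSEQ_I)
    fix r :: real assume "r > 0"
    have "f \<omega> \<in> closure D" by (simp add: D)
    then obtain d where d: "d \<in> D" "dist d (f \<omega>) < r" using \<open>r > 0\<close> by (auto simp: closure_approachable)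
    then obtain j where "d = e j" using e by auto
    show "\<exists>N. \<forall>n\<ge>N. dist (t n \<omega>) (f \<omega>) < r"
      using near[of j] d(2) unfolding \<open>d = e j\<close> by (metis dist_commute order_le_less_trans)
  qed
  \<comment> \<open>The approximants are simple for the completion only; each agrees almost
    everywhere with one that is simple for \<open>P\<close>, and countably many exceptional sets are
    still null.\<close>
  have "\<forall>i. \<exists>s. simple_function P s \<and> (AE \<omega> in P. t i \<omega> = s \<omega>)"
    using completion_ex_simple_function meas by blast
  then obtain s where s: "\<And>i. simple_function P (s i)" "\<And>i. AE \<omega> in P. t i \<omega> = s i \<omega>" by metis
  have "AE \<omega> in P. \<forall>i. t i \<omega> = s i \<omega>" using s(2) by (simp add: AE_all_countable)
  then have "AE \<omega> in P. (\<lambda>i. s i \<omega>) \<longlonglongrightarrow> f \<omega>"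
  proof eventually_elim
    case (elim \<omega>)
    then show ?case using lim[of \<omega>] by (simp only:)
  qed
  with s(1) show ?thesis by (auto simp: random_variable_in_def)
qed

text \<open>In a separable space strong measurability reduces to measurability of distances to fixed
  points, and these pass to almost sure limits.\<close>

lemma random_variable_AE_limit:
  fixes f :: "nat \<Rightarrow> 'w \<Rightarrow> 'b::real_normed_vector"
  assumes D: "countable D" "closure D = (UNIV :: 'b set)"
    and f: "\<And>i. random_variable_in P (f i)" and lim: "AE \<omega> in P. (\<lambda>i. f i \<omega>) \<longlonglongrightarrow> g \<omega>"
  shows "random_variable_in P g"
proof (rule random_variable_separableI[OF D])
  fix d
  show "(\<lambda>\<omega>. dist (g \<omega>) d) \<in> borel_measurable (completion P)"
  proof (rule measurable_completion_AE_limit)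
    show "(\<lambda>\<omega>. dist (f i \<omega>) d) \<in> borel_measurable (completion P)" for i
      by (intro random_variable_measurable[OF f] continuous_intros)
    show "AE \<omega> in P. (\<lambda>i. dist (f i \<omega>) d) \<longlonglongrightarrow> dist (g \<omega>) d"
      using lim by eventually_elim (intro tendsto_intros)
  qed
qed

text \<open>For a simple argument, distances are finite sums over its values; continuity of almost
  every \<open>G \<omega>\<close> then carries the claim to limits. This is what makes compositions
  of random operators random.\<close>

lemma random_variable_random_map:
  fixes G :: "'w \<Rightarrow> 'b::real_normed_vector \<Rightarrow> 'b"
  assumes D: "countable D" "closure D = (UNIV :: 'b set)"
    and G: "\<And>v. random_variable_in P (\<lambda>\<omega>. G \<omega> v)" "AE \<omega> in P. continuous_on UNIV (G \<omega>)"
    and f: "random_variable_in P f"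
  shows "random_variable_in P (\<lambda>\<omega>. G \<omega> (f \<omega>))"
proof -
  obtain s where s: "\<And>i::nat. simple_function P (s i)" "AE \<omega> in P. (\<lambda>i. s i \<omega>) \<longlonglongrightarrow> f \<omega>"
    using f by (auto simp: random_variable_in_def)
  show ?thesis
  proof (rule random_variable_AE_limit[OF D])
    show "random_variable_in P (\<lambda>\<omega>. G \<omega> (s i \<omega>))" for i
    proof (rule random_variable_separableI[OF D])
      fix d
      let ?h = "\<lambda>\<omega>. \<Sum>v\<in>s i ` space P. indicator (s i -` {v} \<inter> space P) \<omega> * dist (G \<omega> v) d"
      have m: "(\<lambda>\<omega>. dist (G \<omega> v) d) \<in> borel_measurable (completion P)" for v
        by (intro random_variable_measurable[OF G(1)] continuous_intros)
      have h: "?h \<in> borel_measurable (completion P)"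
        by (intro borel_measurable_sum borel_measurable_times borel_measurable_indicator m)
          (use simple_functionD[OF s(1)] in auto)
      have eq: "?h \<omega> = dist (G \<omega> (s i \<omega>)) d" if "\<omega> \<in> space (completion P)" for \<omega>
      proof -
        have "?h \<omega> = (\<Sum>v\<in>s i ` space P. if v = s i \<omega> then dist (G \<omega> v) d else 0)"
          using that by (intro sum.cong) (auto simp: indicator_def)
        also have "\<dots> = dist (G \<omega> (s i \<omega>)) d"
          using that simple_functionD(1)[OF s(1)] by (subst sum.delta) auto
        finally show ?thesis .
      qed
      show "(\<lambda>\<omega>. dist (G \<omega> (s i \<omega>)) d) \<in> borel_measurable (completion P)"
        by (rule measurable_cong[THEN iffD1, OF eq h])
    qed
    show "AE \<omega> in P. (\<lambda>i. G \<omega> (s i \<omega>)) \<longlonglongrightarrow> G \<omega> (f \<omega>)"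
      using s(2) G(2) by eventually_elim (rule continuous_on_tendsto_compose[of UNIV], simp_all)
  qed
qed

lemma separable_subset:
  fixes A :: "'b::metric_space set"
  assumes D: "countable D" "closure D = (UNIV :: 'b set)"
  shows "\<exists>C. countable C \<and> C \<subseteq> A \<and> A \<subseteq> closure C"
proof -
  define p where "p = (\<lambda>(d, n::nat). SOME x. x \<in> A \<and> dist x d < 1 / Suc n)"
  \<comment> \<open>If no point of \<open>A\<close> is that near, the choice may fall outside
    \<open>A\<close>; the intersection discards it.\<close>
  define C where "C = p ` (D \<times> UNIV) \<inter> A"
  have "x \<in> closure C" if x: "x \<in> A" for x
    unfolding closure_approachable
  proof (intro allI impI)
    fix e :: real assume e: "e > 0"
    then obtain n where n: "1 / Suc n < e / 2" using nat_approx_posE[of "e / 2"] by auto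
    have "x \<in> closure D" by (simp add: D)
    then obtain d where d: "d \<in> D" "dist d x < 1 / Suc n"
      using closure_approachable[THEN iffD1, rule_format, of x D "1 / Suc n"] by auto
    have "p (d, n) \<in> A \<and> dist (p (d, n)) d < 1 / Suc n"
      unfolding p_def prod.case by (rule someI[of _ x]) (use x d in \<open>simp add: dist_commute\<close>)
    moreover have "dist (p (d, n)) x \<le> dist (p (d, n)) d + dist d x" by (rule dist_triangle)
    ultimately show "\<exists>y\<in>C. dist y x < e"
      using d n by (intro bexI[of _ "p (d, n)"]) (auto simp: C_def)
  qed
  moreover have "countable C" unfolding C_def
    using D by (intro countable_Int1 countable_image countable_SIGMA) auto
  ultimately show ?thesis by (intro exI[of _ C]) (auto simp: C_def)
qed

section \<open>Iterates of an automorphism and recurrence\<close>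

locale probability_automorphism = prob_space P for P :: "'w measure" +
  fixes T :: "'w \<Rightarrow> 'w"
  assumes aut: "automorphism P T"
begin

abbreviation iter :: "int \<Rightarrow> 'w \<Rightarrow> 'w" where "iter \<equiv> int_iterate P T"

lemma T_bij: "bij_betw T (space P) (space P)"
  and T_meas: "T \<in> measurable P P" "distr P P T = P"
  and T_inv_meas: "inv_into (space P) T \<in> measurable P P" "distr P P (inv_into (space P) T) = P"
  using aut by (auto simp: automorphism_def)

lemma T_inv:
  assumes "\<omega> \<in> space P"
  shows "T (inv_into (space P) T \<omega>) = \<omega>" "inv_into (space P) T (T \<omega>) = \<omega>"
    "T \<omega> \<in> space P" "inv_into (space P) T \<omega> \<in> space P"
  using assms T_bij measurable_space[OF T_meas(1)] measurable_space[OF T_inv_meas(1)]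
  by (auto simp: bij_betw_def f_inv_into_f inv_into_f_f)

lemma funpow_measure_preserving:
  assumes "f \<in> measurable P P" "distr P P f = P"
  shows "(f ^^ n) \<in> measurable P P" "distr P P (f ^^ n) = P"
proof (induction n)
  case 0
  show "f ^^ 0 \<in> measurable P P" "distr P P (f ^^ 0) = P" by (simp_all add: distr_id id_def)
next
  case (Suc n)
  show "f ^^ Suc n \<in> measurable P P" using Suc(1) assms(1) by simp
  have "distr P P (f \<circ> (f ^^ n)) = distr (distr P P (f ^^ n)) P f"
    by (rule distr_distr[symmetric]) (use Suc assms in auto)
  then show "distr P P (f ^^ Suc n) = P" using Suc(2) assms(2) by simp
qed

lemma iter_meas: "iter n \<in> measurable P P" "distr P P (iter n) = P"
  unfolding int_iterate_def
  using funpow_measure_preserving[OF T_meas] funpow_measure_preserving[OF T_inv_meas] by simp_all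

lemma iter_space: "\<omega> \<in> space P \<Longrightarrow> iter n \<omega> \<in> space P"
  using measurable_space[OF iter_meas(1)] .

lemma iter_0 [simp]: "iter 0 \<omega> = \<omega>" and iter_1 [simp]: "iter 1 \<omega> = T \<omega>"
  by (simp_all add: int_iterate_def)

lemma iter_succ:
  assumes \<omega>: "\<omega> \<in> space P"
  shows "iter (n + 1) \<omega> = T (iter n \<omega>)"
proof (cases "n \<ge> 0")
  case True
  then have "nat (n + 1) = Suc (nat n)" by simp
  with True show ?thesis by (simp add: int_iterate_def)
next
  case False
  define S where "S = inv_into (space P) T"
  have "nat (- n) = Suc (nat (- (n + 1)))" using False by simp
  then have "iter n \<omega> = S ((S ^^ nat (- (n + 1))) \<omega>)"
    using False by (simp add: int_iterate_def S_def del: nat_minus_as_int)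
  moreover have "(S ^^ nat (- (n + 1))) \<omega> = iter (n + 1) \<omega>"
    using False by (cases "n = -1") (auto simp: int_iterate_def S_def)
  ultimately show ?thesis using T_inv(1)[OF iter_space[OF \<omega>]] by (simp add: S_def)
qed

lemma iter_pred: "\<omega> \<in> space P \<Longrightarrow> iter (n - 1) \<omega> = inv_into (space P) T (iter n \<omega>)"
  using iter_succ[of \<omega> "n - 1"] T_inv(2)[OF iter_space, of \<omega> "n - 1"] by simp

lemma iter_add:
  assumes \<omega>: "\<omega> \<in> space P"
  shows "iter (m + n) \<omega> = iter m (iter n \<omega>)"
proof (induction m rule: int_induct[of _ 0])
  case (step1 i)
  then show ?case using iter_succ[OF \<omega>, of "i + n"] iter_succ[OF iter_space[OF \<omega>], of i] by (simp add: algebra_simps)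
next
  case (step2 i)
  then show ?case using iter_pred[OF \<omega>, of "i + n"] iter_pred[OF iter_space[OF \<omega>], of i] by (simp add: algebra_simps)
qed simp

lemma AE_iter:
  assumes "AE \<omega> in P. Q \<omega>"
  shows "AE \<omega> in P. Q (iter n \<omega>)"
proof (rule AE_distrD[OF iter_meas(1)])
  show "AE \<omega> in distr P P (iter n). Q \<omega>" using assms by (simp only: iter_meas(2))
qed

lemma AE_iter_all: "AE \<omega> in P. Q \<omega> \<Longrightarrow> AE \<omega> in P. \<forall>n. Q (iter n \<omega>)"
  by (simp add: AE_all_countable AE_iter)

text \<open>The set \<open>B N\<close> of points visiting \<open>A\<close> at some time up to
  \<open>N\<close> pulls back under \<open>T\<close> to \<open>B (N + 1)\<close>, so all
  \<open>B N\<close> have equal measure. Their decreasing intersection \<open>C\<close> thus keeps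
  the measure of \<open>B 0\<close>, which is positive, and it is invariant, so ergodicity gives it
  full measure.\<close>

lemma recurrence:
  assumes erg: "ergodic P T" and A: "A \<in> sets P" "measure P A > 0"
  shows "AE \<omega> in P. \<forall>N. \<exists>k\<le>N. iter k \<omega> \<in> A"
proof -
  define B where "B N = {\<omega> \<in> space P. \<exists>k\<le>N. iter k \<omega> \<in> A}" for N
  have B_sets: "B N \<in> sets P" for N
  proof -
    have "B N = (\<Union>k\<in>{..N}. iter k -` A \<inter> space P)" by (auto simp: B_def)
    also have "\<dots> \<in> sets P"
      using measurable_sets[OF iter_meas(1) A(1)] by (intro sets.countable_UN') auto
    finally show ?thesis .
  qed
  have shift: "T -` B N \<inter> space P = B (N + 1)" for N
  proof -
    have "(\<exists>k\<le>N. iter k (T \<omega>) \<in> A) \<longleftrightarrow> (\<exists>k\<le>N + 1. iter k \<omega> \<in> A)" if \<omega>: "\<omega> \<in> space P" for \<omega>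
    proof -
      have eq: "iter k (T \<omega>) = iter (k + 1) \<omega>" for k using iter_add[OF \<omega>, of k 1] by simp
      show ?thesis unfolding eq
      proof safe
        fix k assume "k \<le> N + 1" "iter k \<omega> \<in> A"
        then show "\<exists>k\<le>N. iter (k + 1) \<omega> \<in> A" by (intro exI[of _ "k - 1"]) simp
      next
        fix k assume "k \<le> N" "iter (k + 1) \<omega> \<in> A"
        then show "\<exists>k\<le>N + 1. iter k \<omega> \<in> A" by (intro exI[of _ "k + 1"]) simp
      qed
    qed
    then show ?thesis using T_inv by (auto simp: B_def)
  qed
  have step: "measure P (B (N + 1)) = measure P (B N)" for N
    using measure_distr[OF T_meas(1) B_sets[of N]] by (simp add: T_meas(2) shift)
  have const: "measure P (B N) = measure P (B 0)" for N
  proof (induction N rule: int_induct[of _ 0])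
    case (step2 i)
    then show ?case using step[of "i - 1"] by simp
  qed (auto simp: step)
  have mono: "B N \<subseteq> B N'" if "N \<le> N'" for N N' unfolding B_def using order_trans[OF _ that] by blast
  define C where "C = (\<Inter>i::nat. B (- int i))"
  have C_sets: "C \<in> sets P" unfolding C_def using B_sets by (intro sets.countable_INT) auto
  have C_iff: "\<omega> \<in> C \<longleftrightarrow> (\<forall>N. \<omega> \<in> B N)" for \<omega>
  proof
    assume C: "\<omega> \<in> C"
    show "\<forall>N. \<omega> \<in> B N"
    proof
      fix N
      have "\<omega> \<in> B (- int (nat (- N)))" using C unfolding C_def by blast
      moreover have "- int (nat (- N)) \<le> N" by linarith
      ultimately show "\<omega> \<in> B N" using mono by blast
    qed
  qed (simp add: C_def)
  have "(\<lambda>i. measure P (B (- int i))) \<longlonglongrightarrow> measure P C"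
    unfolding C_def
    by (rule finite_Lim_measure_decseq) (use B_sets mono in \<open>auto simp: decseq_def\<close>)
  moreover have "(\<lambda>i. measure P (B (- int i))) = (\<lambda>_. measure P (B 0))"
    by (rule ext) (rule const)
  ultimately have "measure P C = measure P (B 0)" by (simp add: LIMSEQ_const_iff)
  moreover have "measure P A \<le> measure P (B 0)"
  proof (rule finite_measure_mono[OF _ B_sets])
    show "A \<subseteq> B 0"
    proof
      fix \<omega> assume \<omega>: "\<omega> \<in> A"
      then have "iter 0 \<omega> \<in> A" by simp
      then show "\<omega> \<in> B 0" using \<omega> sets.sets_into_space[OF A(1)] unfolding B_def by blast
    qed
  qed
  ultimately have "measure P C \<noteq> 0" using A(2) by simp
  moreover have "T -` C \<inter> space P \<subseteq> C"
  proof
    fix \<omega> assume \<omega>: "\<omega> \<in> T -` C \<inter> space P"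
    then have "\<omega> \<in> B (N - 1 + 1)" for N using shift[of "N - 1"] by (auto simp: C_iff)
    then show "\<omega> \<in> C" by (simp add: C_iff)
  qed
  ultimately have "measure P C = 1" using erg C_sets by (auto simp: ergodic_def)
  then have "AE \<omega> in P. \<omega> \<in> C" by (rule AE_prob_1)
  then show ?thesis by eventually_elim (auto simp: C_iff B_def)
qed

end

section \<open>Products of operators along an orbit\<close>

context L1_space
begin

text \<open>The cocycle with the orbit replaced by a fixed two-sided sequence of maps, so that the
  limit argument is free of probability.\<close>

definition gprod :: "(int \<Rightarrow> 'l \<Rightarrow> 'l) \<Rightarrow> int \<Rightarrow> int \<Rightarrow> 'l \<Rightarrow> 'l" where
  "gprod g n m = ordered_comp g m (nat (n - m))"

lemma gprod_same [simp]: "gprod g m m = g m"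
  by (simp add: gprod_def)

lemma gprod_succ:
  assumes "m \<le> n"
  shows "gprod g (n + 1) m = g (n + 1) \<circ> gprod g n m"
proof -
  have "nat (n + 1 - m) = Suc (nat (n - m))" using assms by simp
  then show ?thesis using assms by (simp add: gprod_def add.commute)
qed

lemma gprod_split:
  assumes "m \<le> k" "k < n"
  shows "gprod g n m = gprod g n (k + 1) \<circ> gprod g k m"
proof -
  have "k + 1 \<le> n" using assms by simp
  then show ?thesis
  proof (induction n rule: int_ge_induct)
    case base
    show ?case using assms by (simp add: gprod_succ)
  next
    case (step i)
    then show ?case using assms by (simp add: gprod_succ comp_assoc)
  qed
qed

lemma gprod_good:
  assumes "\<And>k. good_map (g k)" "m \<le> n"
  shows "good_map (gprod g n m)"
  using assms(2)
proof (induction n rule: int_ge_induct)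
  case (step i)
  show ?case unfolding gprod_succ[OF step.hyps] by (rule good_map_comp[OF assms(1) step.IH])
qed (simp add: assms(1))

lemma gprod_shift: "gprod (\<lambda>k. g (k + j)) n m = gprod g (n + j) (m + j)"
proof -
  have "ordered_comp (\<lambda>k. g (k + j)) m i = ordered_comp g (m + j) i" for i
    by (induction i) (simp_all add: add_ac)
  then show ?thesis by (simp add: gprod_def)
qed

text \<open>Induction on the number of blocks used: take a block on [a, b] with b <= n, apply the
  hypothesis up to time a - 1, gain the factor 1 - \<delta>^2 on the block, and keep the closeness
  after b by positivity. The time \<open>m0\<close> is uniform in \<open>x\<close> and
  \<open>y\<close>.\<close>

lemma close_gprod:
  assumes g: "\<And>k. good_map (g k)" and \<delta>: "0 \<le> \<delta>" "\<delta> \<le> 1"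
    and blocks: "\<And>N. \<exists>a b. a \<le> b \<and> b \<le> N \<and> block \<delta> (gprod g b a)"
  shows "\<exists>m0\<le>n. \<forall>x y. x \<in> pos_cone - {0} \<longrightarrow> y \<in> pos_cone - {0} \<longrightarrow>
    close (1 - (1 - \<delta>\<^sup>2) ^ i) (gprod g n m0 x) (gprod g n m0 y)"
proof (induction i arbitrary: n)
  case 0
  show ?case using close_0 good_mapD(2)[OF g] by (intro exI[of _ n]) simp
next
  case (Suc i)
  obtain a b where ab: "a \<le> b" "b \<le> n" "block \<delta> (gprod g b a)" using blocks by blast
  obtain m0 where m0: "m0 \<le> a - 1" and IH: "\<And>x y. x \<in> pos_cone - {0} \<Longrightarrow> y \<in> pos_cone - {0} \<Longrightarrow>
    close (1 - (1 - \<delta>\<^sup>2) ^ i) (gprod g (a - 1) m0 x) (gprod g (a - 1) m0 y)"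
    using Suc[of "a - 1"] by blast
  have good: "good_map (gprod g (a - 1) m0)" "good_map (gprod g b a)"
    using g m0 ab by (auto intro: gprod_good)
  have eq_b: "gprod g b m0 = gprod g b a \<circ> gprod g (a - 1) m0"
    using gprod_split[of m0 "a - 1" b g] m0 ab by simp
  have b: "close (1 - (1 - \<delta>\<^sup>2) ^ Suc i) (gprod g b m0 x) (gprod g b m0 y)"
    if x: "x \<in> pos_cone - {0}" and y: "y \<in> pos_cone - {0}" for x y
  proof -
    have "close (1 - (1 - \<delta>\<^sup>2) * (1 - (1 - (1 - \<delta>\<^sup>2) ^ i)))
        (gprod g b a (gprod g (a - 1) m0 x)) (gprod g b a (gprod g (a - 1) m0 y))"
      by (rule close_block[OF IH[OF x y] good(2) ab(3) \<delta>]) (use x y good_mapD[OF good(1)] in auto)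
    then show ?thesis by (simp add: eq_b)
  qed
  show ?case
  proof (intro exI[of _ m0] conjI allI impI)
    show "m0 \<le> n" using m0 ab by simp
    fix x y assume xy: "x \<in> pos_cone - {0}" "y \<in> pos_cone - {0}"
    \<comment> \<open>\<open>gprod\<close> has no empty product, \<open>gprod g n (n + 1)\<close>
      being \<open>g (n + 1)\<close>, so a block ending exactly at \<open>n\<close> is a separate
      case.\<close>
    show "close (1 - (1 - \<delta>\<^sup>2) ^ Suc i) (gprod g n m0 x) (gprod g n m0 y)"
    proof (cases "b = n")
      case True
      with b[OF xy] show ?thesis by simp
    next
      case False
      then have "gprod g n m0 = gprod g n (b + 1) \<circ> gprod g b m0" "good_map (gprod g n (b + 1))"
        using ab m0 g by (auto intro: gprod_good gprod_split)
      then show ?thesis using close_map[OF b[OF xy]] by simp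
    qed
  qed
qed

text \<open>Maps applied before time \<open>m0\<close> merely send states to nonzero elements of the
  cone, for which \<open>close_gprod\<close> already holds uniformly; different starting times and
  states are therefore compared at once.\<close>

lemma gprod_contraction:
  assumes g: "\<And>k. good_map (g k)" and \<delta>: "0 < \<delta>" "\<delta> \<le> 1"
    and blocks: "\<And>N. \<exists>a b. a \<le> b \<and> b \<le> N \<and> block \<delta> (gprod g b a)" and e: "e > 0"
  shows "\<exists>m0\<le>n. \<forall>m\<le>m0. \<forall>m'\<le>m0. \<forall>x\<in>states. \<forall>y\<in>states.
    norm (pact (gprod g n m) x - pact (gprod g n m') y) \<le> e"
proof -
  have "\<bar>1 - \<delta>\<^sup>2\<bar> < 1" using \<delta> by (simp add: abs_less_iff power_le_one less_le_trans[of _ 1])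
  then have "(\<lambda>i. (1 - \<delta>\<^sup>2) ^ i) \<longlonglongrightarrow> 0" by (simp add: LIMSEQ_power_zero)
  \<comment> \<open>The 4 compensates the factor in \<open>norm_diff_le_close\<close>.\<close>
  then obtain i where i: "(1 - \<delta>\<^sup>2) ^ i < e / 4"
    using order_tendstoD(2)[of _ 0 sequentially "e / 4"] e by (auto simp: eventually_sequentially)
  obtain m0 where m0: "m0 \<le> n" and cl: "\<And>x y. x \<in> pos_cone - {0} \<Longrightarrow> y \<in> pos_cone - {0} \<Longrightarrow>
    close (1 - (1 - \<delta>\<^sup>2) ^ i) (gprod g n m0 x) (gprod g n m0 y)"
    using close_gprod[OF g less_imp_le[OF \<delta>(1)] \<delta>(2) blocks] by blast
  have good: "good_map (gprod g n m)" if "m \<le> m0" for m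
    using g that m0 by (intro gprod_good) auto
  have reduce: "\<exists>z\<in>pos_cone - {0}. gprod g n m x = gprod g n m0 z" if m: "m \<le> m0" and x: "x \<in> states" for m x
  proof (cases "m = m0")
    case True
    then show ?thesis using x states_nonzero by (intro bexI[of _ x]) (auto simp: states_iff)
  next
    case False
    have gd: "good_map (gprod g (m0 - 1) m)" using g m False by (intro gprod_good) auto
    show ?thesis
    proof (rule bexI)
      show "gprod g n m x = gprod g n m0 (gprod g (m0 - 1) m x)"
        using gprod_split[of m "m0 - 1" n g] m False m0 by simp
      show "gprod g (m0 - 1) m x \<in> pos_cone - {0}"
        using good_mapD(2,3)[OF gd, of x] x states_nonzero by (auto simp: states_iff)
    qed
  qed
  show ?thesis
  proof (intro exI[of _ m0] conjI allI impI ballI m0)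
    fix m m' x y assume m: "m \<le> m0" "m' \<le> m0" and xy: "x \<in> states" "y \<in> states"
    obtain z w where z: "z \<in> pos_cone - {0}" "gprod g n m x = gprod g n m0 z"
      and w: "w \<in> pos_cone - {0}" "gprod g n m' y = gprod g n m0 w"
      using reduce[OF m(1) xy(1)] reduce[OF m(2) xy(2)] by (elim bexE)
    have gz: "gprod g n m0 u \<in> pos_cone" "gprod g n m0 u \<noteq> 0" if "u \<in> pos_cone - {0}" for u
      using good_mapD(2,3)[OF good[OF order_refl], of u] that by auto
    have "close (1 - (1 - \<delta>\<^sup>2) ^ i) (pact (gprod g n m) x) (pact (gprod g n m') y)"
      unfolding proj_state(2)[OF good[OF m(1)] xy(1)] proj_state(2)[OF good[OF m(2)] xy(2)] z(2) w(2)
      by (intro close_normalize cl z w gz)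
    then have "norm (pact (gprod g n m) x - pact (gprod g n m') y) \<le> 4 * (1 - (1 - (1 - \<delta>\<^sup>2) ^ i))"
      by (rule norm_diff_le_close) (intro proj_state good m xy)+
    then show "norm (pact (gprod g n m) x - pact (gprod g n m') y) \<le> e" using i by simp
  qed
qed

section \<open>Limits of the backward products\<close>

definition is_limit :: "(int \<Rightarrow> 'l \<Rightarrow> 'l) \<Rightarrow> int \<Rightarrow> 'l \<Rightarrow> bool" where
  "is_limit g n z \<longleftrightarrow> z \<in> states \<and>
     (\<forall>x\<in>states. ((\<lambda>m. norm (pact (gprod g n m) x - z)) \<longlongrightarrow> 0) at_bot)"

text \<open>The free offset \<open>k\<close> is used in \<open>is_limit_step\<close>, where products
  ending at \<open>n + 1\<close> start at \<open>n - int i\<close> and so always contain a factor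
  before the last.\<close>

lemma is_limit_sequence:
  assumes "is_limit g n z" "x \<in> states"
  shows "(\<lambda>i::nat. pact (gprod g n (k - int i)) x) \<longlonglongrightarrow> z"
proof -
  have "filterlim (\<lambda>i::nat. k - int i) at_bot sequentially"
    unfolding filterlim_at_bot eventually_sequentially
  proof
    fix Z :: int
    show "\<exists>N. \<forall>i\<ge>N. k - int i \<le> Z" by (rule exI[of _ "nat (k - Z)"]) auto
  qed
  moreover have "((\<lambda>m. norm (pact (gprod g n m) x - z)) \<longlongrightarrow> 0) at_bot"
    using assms by (auto simp: is_limit_def)
  ultimately have "(\<lambda>i::nat. norm (pact (gprod g n (k - int i)) x - z)) \<longlonglongrightarrow> 0"
    by (rule filterlim_compose[rotated])
  then show ?thesis by (simp add: tendsto_norm_zero_iff LIM_zero_iff)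
qed

text \<open>The products applied to one fixed state form a Cauchy sequence as the starting time
  recedes, and uniformity of the contraction sends all other states to the same limit.\<close>

lemma is_limit_exists:
  assumes g: "\<And>k. good_map (g k)" and \<delta>: "0 < \<delta>" "\<delta> \<le> 1"
    and blocks: "\<And>N. \<exists>a b. a \<le> b \<and> b \<le> N \<and> block \<delta> (gprod g b a)"
  shows "\<exists>z. is_limit g n z"
proof -
  note contr = gprod_contraction[OF g \<delta> blocks]
  define u where "u i = pact (gprod g n (n - int i)) (\<iota> id_blinfun)" for i :: nat
  have u_states: "u i \<in> states" for i
    unfolding u_def by (intro proj_state gprod_good g iota_id_state) simp
  have "Cauchy u"
  proof (rule metric_CauchyI)
    fix e :: real assume e: "e > 0"
    obtain m0 where "\<forall>m\<le>m0. \<forall>m'\<le>m0. \<forall>x\<in>states. \<forall>y\<in>states.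
        norm (pact (gprod g n m) x - pact (gprod g n m') y) \<le> e / 2"
      using contr[OF half_gt_zero[OF e], of n] by (elim exE conjE)
    note m0 = this[rule_format]
    show "\<exists>N. \<forall>i\<ge>N. \<forall>j\<ge>N. dist (u i) (u j) < e"
    proof (intro exI[of _ "nat (n - m0)"] allI impI)
      fix i j assume "i \<ge> nat (n - m0)" "j \<ge> nat (n - m0)"
      then have "dist (u i) (u j) \<le> e / 2"
        unfolding u_def dist_norm by (intro m0 iota_id_state) auto
      then show "dist (u i) (u j) < e" using e by simp
    qed
  qed
  then obtain z where z: "u \<longlonglongrightarrow> z" using Cauchy_convergent convergent_def by blast
  have "is_limit g n z"
    unfolding is_limit_def
  proof (intro conjI ballI)
    show "z \<in> states" by (rule closed_sequentially[OF states_closed u_states z])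
    fix x assume x: "x \<in> states"
    show "((\<lambda>m. norm (pact (gprod g n m) x - z)) \<longlongrightarrow> 0) at_bot"
    proof (rule tendstoI)
      fix e :: real assume e: "e > 0"
      obtain m0 where "\<forall>m\<le>m0. \<forall>m'\<le>m0. \<forall>x\<in>states. \<forall>y\<in>states.
          norm (pact (gprod g n m) x - pact (gprod g n m') y) \<le> e / 2"
        using contr[OF half_gt_zero[OF e], of n] by (elim exE conjE)
      note m0 = this[rule_format]
      have "norm (pact (gprod g n m) x - z) \<le> e / 2" if "m \<le> m0" for m
      proof (rule LIMSEQ_le_const2)
        show "(\<lambda>i. norm (pact (gprod g n m) x - u i)) \<longlonglongrightarrow> norm (pact (gprod g n m) x - z)"
          by (intro tendsto_intros z)
        show "\<exists>N. \<forall>i\<ge>N. norm (pact (gprod g n m) x - u i) \<le> e / 2"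
          unfolding u_def
        proof (intro exI[of _ "nat (n - m0)"] allI impI)
          fix i assume "i \<ge> nat (n - m0)"
          then have "n - int i \<le> m0" by linarith
          then show "norm (pact (gprod g n m) x - pact (gprod g n (n - int i)) (\<iota> id_blinfun)) \<le> e / 2"
            by (intro m0 that x iota_id_state)
        qed
      qed
      then show "\<forall>\<^sub>F m in at_bot. dist (norm (pact (gprod g n m) x - z)) 0 < e"
        unfolding eventually_at_bot_linorder using e by (intro exI[of _ m0]) fastforce
    qed
  qed
  then show ?thesis by blast
qed

lemma normalize_scaleR: "r > 0 \<Longrightarrow> normalize (r *\<^sub>R x) = normalize x"
  by (simp add: normalize_def rtr_linear)

lemma normalize_tendsto:
  assumes "(f \<longlongrightarrow> x) F" "x \<in> pos_cone" "x \<noteq> 0"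
  shows "((\<lambda>i. normalize (f i)) \<longlongrightarrow> normalize x) F"
  unfolding normalize_def using assms rtr_pos[of x]
  by (intro tendsto_intros tr_tendsto) auto

text \<open>Both sides are limits of the same products up to \<open>n + 1\<close>, once directly and
  once by applying the last map to the products up to \<open>n\<close>; normalization is continuous
  at the nonzero image of \<open>z\<close>.\<close>

lemma is_limit_step:
  assumes g: "\<And>k. good_map (g k)" and z: "is_limit g n z" and w: "is_limit g (n + 1) w"
  shows "pact (g (n + 1)) z = w"
proof (rule LIMSEQ_unique)
  interpret gn: bounded_linear "g (n + 1)" by (rule good_mapD[OF g])
  let ?x = "\<iota> id_blinfun"
  have zs: "z \<in> states" using z by (simp add: is_limit_def)
  show "(\<lambda>i. pact (gprod g (n + 1) (n - int i)) ?x) \<longlonglongrightarrow> w"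
    by (rule is_limit_sequence[OF w iota_id_state])
  have eq: "pact (gprod g (n + 1) (n - int i)) ?x = normalize (g (n + 1) (pact (gprod g n (n - int i)) ?x))" for i
  proof -
    let ?G = "gprod g n (n - int i)"
    have G: "good_map ?G" "good_map (gprod g (n + 1) (n - int i))" by (intro gprod_good g; simp)+
    have x: "?x \<in> pos_cone" "?x \<noteq> 0" using iota_id_state states_nonzero by (auto simp: states_iff)
    then have "rtr (?G ?x) > 0" using good_mapD[OF G(1)] by (intro rtr_pos) auto
    moreover have "g (n + 1) (normalize (?G ?x)) = (1 / rtr (?G ?x)) *\<^sub>R g (n + 1) (?G ?x)"
      by (simp add: normalize_def gn.scaleR)
    ultimately show ?thesis
      unfolding proj_state(2)[OF G(1) iota_id_state] proj_state(2)[OF G(2) iota_id_state]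
      by (simp add: normalize_scaleR gprod_succ)
  qed
  show "(\<lambda>i. pact (gprod g (n + 1) (n - int i)) ?x) \<longlonglongrightarrow> pact (g (n + 1)) z"
    unfolding eq proj_state(2)[OF g zs]
  proof (rule normalize_tendsto)
    show "(\<lambda>i. g (n + 1) (pact (gprod g n (n - int i)) ?x)) \<longlonglongrightarrow> g (n + 1) z"
      by (intro bounded_linear.tendsto[OF good_mapD(1)[OF g]] is_limit_sequence z iota_id_state)
    show "g (n + 1) z \<in> pos_cone" "g (n + 1) z \<noteq> 0"
      using good_mapD[OF g] zs states_nonzero by (auto simp: states_iff)
  qed
qed

lemma filterlim_shift_at_bot: "filterlim (\<lambda>m::int. m + j) at_bot at_bot"
  unfolding filterlim_at_bot eventually_at_bot_linorder
proof
  fix Z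
  show "\<exists>N. \<forall>m\<le>N. m + j \<le> Z" by (rule exI[of _ "Z - j"]) auto
qed

lemma is_limit_shift: "is_limit (\<lambda>k. g (k + j)) n z \<longleftrightarrow> is_limit g (n + j) z"
proof -
  have eq: "(F \<longlongrightarrow> 0) at_bot \<longleftrightarrow> ((\<lambda>m. F (m + j)) \<longlongrightarrow> 0) at_bot" for F :: "int \<Rightarrow> real"
    using filterlim_compose[OF _ filterlim_shift_at_bot[of j], of F "nhds 0"]
      filterlim_compose[OF _ filterlim_shift_at_bot[of "- j"], of "\<lambda>m. F (m + j)" "nhds 0"] by auto
  show ?thesis
    unfolding is_limit_def gprod_shift
    by (simp only: eq[of "\<lambda>m. norm (pact (gprod g (n + j) m) x - z)" for x])
qed

end

section \<open>The stationary process\<close>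

locale random_cocycle = L1_space M \<tau> \<iota> + probability_automorphism P T
  for M :: "'h::chilbert_space op set" and \<tau> and \<iota> :: "'h op \<Rightarrow> 'l::cbanach"
    and P :: "'w measure" and T +
  fixes \<gamma> :: "'w \<Rightarrow> 'l \<Rightarrow> 'l"
  assumes sep: "separable_predual M"
    and erg: "ergodic P T"
    and rlo: "random_linear_operator P \<gamma>"
    and bdd: "AE \<omega> in P. bounded_map (\<gamma> \<omega>)"
    and pos: "AE \<omega> in P. positive_map M \<tau> \<iota> (\<gamma> \<omega>)"
    and faith: "AE \<omega> in P. faithful_map M \<tau> \<iota> (\<gamma> \<omega>)"
    and contracting: "measure (completion P)
      {\<omega> \<in> space P. \<exists>n m. m \<le> n \<and> hconst (cocycle P T \<gamma> n m \<omega>) < 1} > 0"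
begin

abbreviation orbit :: "'w \<Rightarrow> int \<Rightarrow> 'l \<Rightarrow> 'l" where
  "orbit \<omega> \<equiv> (\<lambda>k. \<gamma> (iter k \<omega>))"

lemma cocycle_eq: "cocycle P T \<gamma> n m \<omega> = gprod (orbit \<omega>) n m"
  by (simp add: cocycle_def gprod_def)

lemma orbit_iter: "\<omega> \<in> space P \<Longrightarrow> orbit (iter j \<omega>) = (\<lambda>k. orbit \<omega> (k + j))"
  by (simp add: iter_add)

lemma AE_good: "AE \<omega> in P. \<forall>k. good_map (orbit \<omega> k)"
proof (rule AE_iter_all)
  have "AE \<omega> in P. clinear (\<gamma> \<omega>)" using rlo by (simp add: random_linear_operator_def)
  then show "AE \<omega> in P. good_map (\<gamma> \<omega>)"
    using bdd pos faith by eventually_elim (simp add: good_map_def)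
qed

lemma random_variable_orbit: "random_variable_in P (\<lambda>\<omega>. orbit \<omega> k v)"
  using random_variable_measure_preserving[OF _ iter_meas, of "\<lambda>\<omega>. \<gamma> \<omega> v"] rlo
  by (simp add: random_linear_operator_def)

text \<open>Each new operator is evaluated at a random vector, which
  \<open>random_variable_random_map\<close> permits because almost every operator is
  bounded.\<close>

lemma random_variable_gprod:
  assumes "m \<le> n"
  shows "random_variable_in P (\<lambda>\<omega>. gprod (orbit \<omega>) n m x)"
  using assms
proof (induction n rule: int_ge_induct)
  case base
  show ?case by (simp add: random_variable_orbit)
next
  case (step i)
  obtain D :: "'l set" where D: "countable D" "closure D = UNIV" using separable[OF sep] by blast
  have "AE \<omega> in P. continuous_on UNIV (orbit \<omega> (i + 1))"
    using AE_good
    by eventually_elim (intro linear_continuous_on good_mapD(1), simp)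
  from random_variable_random_map[OF D random_variable_orbit this step.IH]
  show ?case using step.hyps by (simp add: gprod_succ)
qed

lemma random_variable_limit:
  assumes X: "AE \<omega> in P. is_limit (orbit \<omega>) n (X \<omega>)"
  shows "random_variable_in P X"
proof -
  obtain D :: "'l set" where D: "countable D" "closure D = UNIV" using separable[OF sep] by blast
  let ?G = "\<lambda>i \<omega>. gprod (orbit \<omega>) n (n - int i)" and ?x = "\<iota> id_blinfun"
  show ?thesis
  proof (rule random_variable_AE_limit[OF D])
    fix i
    \<comment> \<open>Discontinuous where the trace vanishes; faithfulness keeps the trace of the
      product at a state positive almost surely.\<close>
    let ?h = "\<lambda>u. (1 / tr u) *\<^sub>C u"
    have "random_variable_in P (\<lambda>\<omega>. ?h (?G i \<omega> ?x))"
    proof (rule random_variable_compose[of P "\<lambda>\<omega>. ?G i \<omega> ?x" ?h])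
      show "random_variable_in P (\<lambda>\<omega>. ?G i \<omega> ?x)" by (rule random_variable_gprod) simp
      show "AE \<omega> in P. isCont ?h (?G i \<omega> ?x)"
        using AE_good
      proof eventually_elim
        case (elim \<omega>)
        have G: "good_map (?G i \<omega>)" using elim by (intro gprod_good) auto
        have "?x \<in> pos_cone" "?x \<noteq> 0" using iota_id_state states_nonzero by (auto simp: states_iff)
        then have "rtr (?G i \<omega> ?x) > 0" using good_mapD[OF G] by (intro rtr_pos) auto
        then have "tr (?G i \<omega> ?x) \<noteq> 0" by auto
        then show ?case
          unfolding isCont_def
          by (intro bounded_bilinear.tendsto[OF bounded_bilinear_scaleC] tendsto_intros tr_tendsto)
      qed
    qed
    then show "random_variable_in P (\<lambda>\<omega>. pact (?G i \<omega>) ?x)" by (simp add: proj_action_def)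
  next
    show "AE \<omega> in P. (\<lambda>i. pact (?G i \<omega>) ?x) \<longlonglongrightarrow> X \<omega>"
      using X by eventually_elim (rule is_limit_sequence[OF _ iota_id_state])
  qed
qed

text \<open>Almost surely, a point of the contracting event lies in some \<open>A n m j\<close>. If
  these countably many sets were all null, the event would be null. Testing on a countable dense set
  of states makes them measurable, and goodness of the orbit upgrades the test to
  \<open>block\<close>.\<close>

lemma block_event_exists:
  "\<exists>m n j A. m \<le> n \<and> A \<in> sets P \<and> measure P A > 0 \<and>
     (\<forall>\<omega>\<in>A. (\<forall>k. good_map (orbit \<omega> k)) \<longrightarrow> block (1 / Suc j) (gprod (orbit \<omega>) n m))"
proof -
  obtain D0 :: "'l set" where D0: "countable D0" "closure D0 = UNIV" using separable[OF sep] by blast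
  obtain D where D: "countable D" "D \<subseteq> states" "states \<subseteq> closure D"
    using separable_subset[OF D0] by blast
  define w where "w n m j x y \<omega> = rtr (gprod (orbit \<omega>) n m y) *\<^sub>R gprod (orbit \<omega>) n m x -
      (1 / Suc j * rtr (gprod (orbit \<omega>) n m x)) *\<^sub>R gprod (orbit \<omega>) n m y" for n m and j :: nat and x y \<omega>
  define A where "A n m j = {\<omega> \<in> space P. \<forall>x\<in>D. \<forall>y\<in>D. w n m j x y \<omega> \<in> pos_cone}" for n m and j :: nat
  have A_sets: "A n m j \<in> sets (completion P)" if "m \<le> n" for n m j
  proof -
    have w: "random_variable_in P (w n m j x y)" for x y
    proof -
      let ?h = "\<lambda>p::'l \<times> 'l. rtr (snd p) *\<^sub>R fst p - (1 / Suc j * rtr (fst p)) *\<^sub>R snd p"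
      have "random_variable_in P (\<lambda>\<omega>. ?h (gprod (orbit \<omega>) n m x, gprod (orbit \<omega>) n m y))"
      proof (rule random_variable_compose[of P _ ?h])
        show "random_variable_in P (\<lambda>\<omega>. (gprod (orbit \<omega>) n m x, gprod (orbit \<omega>) n m y))"
          by (intro random_variable_Pair random_variable_gprod that)
        show "AE \<omega> in P. isCont ?h (gprod (orbit \<omega>) n m x, gprod (orbit \<omega>) n m y)"
          unfolding isCont_def by (intro AE_I2 tendsto_intros tr_tendsto)
      qed
      then show ?thesis unfolding w_def[abs_def] by simp
    qed
    have "A n m j = space P \<inter> (\<Inter>p\<in>D \<times> D. {\<omega> \<in> space P. w n m j (fst p) (snd p) \<omega> \<in> pos_cone})"
      by (auto simp: A_def)
    also have "\<dots> \<in> sets (completion P)"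
    proof (cases "D = {}")
      case False
      then show ?thesis
        using D(1) random_variable_closed_vimage[OF w cone_closed]
        by (intro sets.Int sets.countable_INT') auto
    qed auto
    finally show ?thesis .
  qed
  have A_block: "block (1 / Suc j) (gprod (orbit \<omega>) n m)"
    if "m \<le> n" "\<omega> \<in> A n m j" "\<forall>k. good_map (orbit \<omega> k)" for n m j \<omega>
    using that by (intro blockI_dense[OF _ D(2,3)] gprod_good) (auto simp: A_def w_def)
  have "\<exists>n m j. m \<le> n \<and> measure (completion P) (A n m j) > 0"
  proof (rule ccontr)
    assume neg: "\<not> (\<exists>n m j. m \<le> n \<and> measure (completion P) (A n m j) > 0)"
    have null: "AE \<omega> in P. m \<le> n \<longrightarrow> \<omega> \<notin> A n m j" for n m j
    proof (cases "m \<le> n")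
      case True
      then have "measure (completion P) (A n m j) = 0" using neg measure_nonneg by (metis less_eq_real_def)
      then have "emeasure (completion P) (A n m j) = 0"
        by (metis A_sets True emeasure_completion emeasure_eq_measure ennreal_0 measure_def enn2real_ennreal measure_nonneg)
      then have "A n m j \<in> null_sets (completion P)" using A_sets[OF True] by (intro null_setsI)
      then have "AE \<omega> in completion P. \<omega> \<notin> A n m j" by (rule AE_not_in)
      then show ?thesis by (simp add: AE_completion_iff)
    qed simp
    have "AE \<omega> in P. \<forall>n m j. m \<le> n \<longrightarrow> \<omega> \<notin> A n m j" using null by (simp add: AE_all_countable)
    then have "AE \<omega> in P. \<not> (\<exists>n m. m \<le> n \<and> hconst (cocycle P T \<gamma> n m \<omega>) < 1)"
      using AE_good AE_space
    proof eventually_elim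
      case (elim \<omega>)
      show ?case
      proof
        assume "\<exists>n m. m \<le> n \<and> hconst (cocycle P T \<gamma> n m \<omega>) < 1"
        then obtain n m where nm: "m \<le> n" "hconst (gprod (orbit \<omega>) n m) < 1" by (auto simp: cocycle_eq)
        have "good_map (gprod (orbit \<omega>) n m)" using elim nm by (intro gprod_good) auto
        then obtain j where "block (1 / Suc j) (gprod (orbit \<omega>) n m)"
          using hennion_const_imp_block nm by blast
        then have "\<omega> \<in> A n m j"
          using D(2) elim unfolding A_def w_def block_def by (auto simp: subset_iff states_iff)
        with elim nm show False by blast
      qed
    qed
    then have "emeasure (completion P) {\<omega> \<in> space (completion P). \<exists>n m. m \<le> n \<and> hconst (cocycle P T \<gamma> n m \<omega>) < 1} = 0"
      by (intro emeasure_eq_0_AE) (simp add: AE_completion_iff)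
    then have "measure (completion P) {\<omega> \<in> space P. \<exists>n m. m \<le> n \<and> hconst (cocycle P T \<gamma> n m \<omega>) < 1} = 0"
      by (simp add: measure_def)
    with contracting show False by simp
  qed
  then obtain n m j where nm: "m \<le> n" "measure (completion P) (A n m j) > 0" by blast
  have sets: "A n m j \<in> sets (completion P)" by (rule A_sets[OF nm(1)])
  show ?thesis
  proof (intro exI conjI ballI impI)
    show "m \<le> n" by fact
    \<comment> \<open>Recurrence needs a set of \<open>P\<close> itself; the main part lies inside
      the completion-measurable set and has the same measure.\<close>
    show "main_part P (A n m j) \<in> sets P" using sets by simp
    show "measure P (main_part P (A n m j)) > 0" using nm(2) sets by (simp add: measure_def)
    fix \<omega> assume "\<omega> \<in> main_part P (A n m j)" and good: "\<forall>k. good_map (orbit \<omega> k)"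
    then have "\<omega> \<in> A n m j" using main_part_null_part_Un[OF sets] by blast
    then show "block (1 / Suc j) (gprod (orbit \<omega>) n m)" by (rule A_block[OF nm(1) _ good])
  qed
qed

lemma AE_limit_exists: "AE \<omega> in P. \<forall>n. \<exists>z. is_limit (orbit \<omega>) n z"
proof -
  obtain m n j A where mn: "m \<le> n" and A: "A \<in> sets P" "measure P A > 0"
    and bl: "\<And>\<omega>. \<omega> \<in> A \<Longrightarrow> \<forall>k. good_map (orbit \<omega> k) \<Longrightarrow> block (1 / Suc j) (gprod (orbit \<omega>) n m)"
    using block_event_exists by blast
  show ?thesis
    using AE_good AE_space recurrence[OF erg A]
  proof eventually_elim
    case (elim \<omega>)
    have "\<exists>z. is_limit (orbit \<omega>) i z" for i
    proof (rule is_limit_exists)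
      show "good_map (orbit \<omega> k)" for k using elim by blast
      fix N
      \<comment> \<open>With this bound the shifted block on [m + k, n + k] ends no later than
        \<open>N\<close>.\<close>
      obtain k where k: "k \<le> N - n" "iter k \<omega> \<in> A" using elim by blast
      have "block (1 / Suc j) (gprod (orbit (iter k \<omega>)) n m)"
        using elim by (intro bl[OF k(2)]) (simp flip: iter_add[OF elim(2)])
      then have "block (1 / Suc j) (gprod (orbit \<omega>) (n + k) (m + k))"
        unfolding orbit_iter[OF elim(2)] gprod_shift[of "orbit \<omega>"] .
      with k(1) mn show "\<exists>a b. a \<le> b \<and> b \<le> N \<and> block (1 / Suc j) (gprod (orbit \<omega>) b a)"
        by (intro exI[of _ "m + k"] exI[of _ "n + k"]) simp
    qed auto
    then show ?case by blast
  qed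
qed

text \<open>The default \<open>\<iota> id_blinfun\<close> keeps the values in the set of states at
  every point, also where no limit exists.\<close>

definition process :: "int \<Rightarrow> 'w \<Rightarrow> 'l" where
  "process n \<omega> = (if \<exists>z. is_limit (orbit \<omega>) n z then SOME z. is_limit (orbit \<omega>) n z else \<iota> id_blinfun)"

lemma process_is_limit: "\<exists>z. is_limit (orbit \<omega>) n z \<Longrightarrow> is_limit (orbit \<omega>) n (process n \<omega>)"
  by (simp add: process_def someI_ex)

lemma process_state: "process n \<omega> \<in> states"
proof (cases "\<exists>z. is_limit (orbit \<omega>) n z")
  case True
  from process_is_limit[OF this] show ?thesis by (simp add: is_limit_def)
qed (simp add: process_def iota_id_state)

text \<open>The two limit predicates coincide as functions, so \<open>SOME\<close> picks the same
  element and the identity holds at every point of the space.\<close>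

lemma process_shift:
  assumes "\<omega> \<in> space P"
  shows "process n (iter j \<omega>) = process (n + j) \<omega>"
proof -
  have "is_limit (orbit (iter j \<omega>)) n = is_limit (orbit \<omega>) (n + j)"
    by (rule ext) (simp only: orbit_iter[OF assms] is_limit_shift[of "orbit \<omega>"])
  then show ?thesis by (simp add: process_def)
qed

lemma AE_process: "AE \<omega> in P. \<forall>n. is_limit (orbit \<omega>) n (process n \<omega>)"
  using AE_limit_exists by eventually_elim (simp add: process_is_limit)

lemma process_properties:
  shows "random_variable_in P (process n)"
    "AE \<omega> in P. pact (\<gamma> (iter (n + 1) \<omega>)) (process n \<omega>) = process (n + 1) \<omega>"
    "AE \<omega> in P. process n (T \<omega>) = process (n + 1) \<omega> \<and> process n (iter (- 1) \<omega>) = process (n - 1) \<omega>"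
    "x \<in> states \<Longrightarrow> AE \<omega> in P. \<forall>n.
      ((\<lambda>m. norm (pact (cocycle P T \<gamma> n m \<omega>) x - process n \<omega>)) \<longlongrightarrow> 0) at_bot"
proof -
  show "random_variable_in P (process n)"
    by (rule random_variable_limit[of n]) (rule AE_mp[OF AE_process], simp)
  show "AE \<omega> in P. pact (\<gamma> (iter (n + 1) \<omega>)) (process n \<omega>) = process (n + 1) \<omega>"
    using AE_process AE_good by eventually_elim (rule is_limit_step, simp_all)
  show "AE \<omega> in P. process n (T \<omega>) = process (n + 1) \<omega> \<and> process n (iter (- 1) \<omega>) = process (n - 1) \<omega>"
    using AE_space by eventually_elim (use process_shift[of _ _ 1] process_shift[of _ _ "- 1"] in simp)
  show "AE \<omega> in P. \<forall>n. ((\<lambda>m. norm (pact (cocycle P T \<gamma> n m \<omega>) x - process n \<omega>)) \<longlongrightarrow> 0) at_bot"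
    if "x \<in> states"
    using AE_process by eventually_elim (use that in \<open>simp add: is_limit_def cocycle_eq\<close>)
qed

end

theorem theoremA:
  fixes M :: "'h::chilbert_space op set"
    and \<tau> :: "'h op \<Rightarrow> complex"
    and \<iota> :: "'h op \<Rightarrow> 'l::cbanach"
    and P :: "'w measure"
    and T :: "'w \<Rightarrow> 'w"
    and \<gamma> :: "'w \<Rightarrow> 'l \<Rightarrow> 'l"
  assumes "tracial_von_neumann_algebra M \<tau>"
    and "separable_predual M"
    and "L1_completion M \<tau> \<iota>"
    and "prob_space P"
    and "automorphism P T"
    and "ergodic P T"
    and "random_linear_operator P \<gamma>"
    and "AE \<omega> in P. bounded_map (\<gamma> \<omega>)"
    and "AE \<omega> in P. positive_map M \<tau> \<iota> (\<gamma> \<omega>)"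
    and "AE \<omega> in P. faithful_map M \<tau> \<iota> (\<gamma> \<omega>)"
    and "measure (completion P)
           {\<omega> \<in> space P. \<exists>n m. m \<le> n \<and> hennion_const M \<tau> \<iota> (cocycle P T \<gamma> n m \<omega>) < 1} > 0"
  shows "\<exists>X :: int \<Rightarrow> 'w \<Rightarrow> 'l.
     (\<forall>n. random_variable_in P (X n) \<and> (\<forall>\<omega>\<in>space P. X n \<omega> \<in> L1_states M \<tau> \<iota>)) \<and>
     (\<forall>n. AE \<omega> in P. proj_action M \<tau> \<iota> (\<gamma> (int_iterate P T (n + 1) \<omega>)) (X n \<omega>) = X (n + 1) \<omega>) \<and>
     (\<forall>n. AE \<omega> in P. X n (T \<omega>) = X (n + 1) \<omega> \<and> X n (int_iterate P T (- 1) \<omega>) = X (n - 1) \<omega>) \<and>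
     (\<forall>x\<in>L1_states M \<tau> \<iota>. AE \<omega> in P. \<forall>n.
        ((\<lambda>m. norm (proj_action M \<tau> \<iota> (cocycle P T \<gamma> n m \<omega>) x - X n \<omega>)) \<longlongrightarrow> 0) at_bot)"
proof -
  interpret random_cocycle M \<tau> \<iota> P T \<gamma>
    using assms
    by (intro random_cocycle.intro L1_space.intro probability_automorphism.intro
        probability_automorphism_axioms.intro random_cocycle_axioms.intro)
  show ?thesis
    by (intro exI[of _ process] conjI allI ballI process_properties process_state)
qed

end
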